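(* Let $d>2$, let $D\subset\mathbb R^d$ be a compact neighborhood of the origin, and denote its complement $\mathbb R^d\setminus D$ by $D^c$. Let $P$ be a probability measure on the canonical sample space $C^d[0,\infty)$ such that, under $P$, the coordinate process $X$ is a conformal local martingale in $\mathbb R^d$ (with $X_0=x_0\in D^c$) absorbed upon hitting the boundary of $D$. Then there is a probability measure $Q$ such that, under $Q$, the coordinate process is a true conformal martingale which takes values in $(D^c)^*$ and such that, for any bounded measurable function $U:D^c\to\mathbb R$ and for any bounded stopping time $\tau$, $$|x_0|^{d-2}\,E^P\left[U(X_{\tau})\right]=E^Q\left[|X_\tau|^{2-d}\,U\left(\frac{X_\tau}{|X_\tau|^2}\right)\right].$$
   Context: A $d$-dimensional conformal local martingale is a process $(X(1),\ldots,X(d))$ such that each coordinate $X(i)$ is a local martingale and $\langle X(i),X(j)\rangle=\langle X(1)\rangle1_{\{i=j\}}$ for all $1\le i,j\le d$; it is a true conformal martingale if in addition each coordinate is a true martingale. For $x\ne0$ the inversion map is $x\mapsto x^*=x/|x|^2$, with $|\cdot|$ the Euclidean norm, and $(D^c)^*$ is the image of $D^c$ under this map. $C^d[0,\infty)$ is the space of continuous $\mathbb R^d$-valued paths, $X$ is its coordinate process, and stopping times are with respect to the filtration generated by the coordinate process. $E^P$ and $E^Q$ denote expectation under $P$ and $Q$.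
   Formalization: On the Q side the stopping time is evaluated along the inverted path (the same functional of X on both sides makes the identity false); since X may be absorbed on the boundary of D, U is taken on D^c together with that boundary and the values under Q lie in the inversion of that larger set. *)

theory Defs
  imports "HOL-Probability.Probability"
begin

section \<open>The canonical space of continuous paths\<close>

text \<open>Time is the half-line \<open>{0..}\<close> inside the reals. Paths are extensional functions, so that they
  carry no information at negative times.\<close>

definition paths :: "(real \<Rightarrow> 'a::topological_space) set" where
  "paths = {\<omega> \<in> extensional {0..}. continuous_on {0..} \<omega>}"

definition path_space :: "(real \<Rightarrow> 'a::topological_space) measure" where
  "path_space = restrict_space (PiM {0..} (\<lambda>_. borel)) paths"

text \<open>The raw filtration generated by the coordinate process \<open>\<lambda>t \<omega>. \<omega> t\<close>. For negative \<open>t\<close> it is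
  trivial, so that the library's \<open>stopping_time\<close> over the index type \<open>real\<close> agrees with the usual
  notion for nonnegative random times.\<close>

definition coord_filtration :: "real \<Rightarrow> (real \<Rightarrow> 'a::topological_space) measure" where
  "coord_filtration t =
     sigma paths {(\<lambda>\<omega>. \<omega> s) -` B \<inter> paths | s B. s \<in> {0..t} \<and> B \<in> sets borel}"


section \<open>Martingales in continuous time\<close>

definition martingale :: "'w measure \<Rightarrow> (real \<Rightarrow> 'w measure) \<Rightarrow> (real \<Rightarrow> 'w \<Rightarrow> real) \<Rightarrow> bool" where
  "martingale P F M \<longleftrightarrow>
     (\<forall>t\<ge>0. M t \<in> borel_measurable (F t) \<and> integrable P (M t)) \<and>
     (\<forall>s t. 0 \<le> s \<and> s \<le> t \<longrightarrow> (AE \<omega> in P. real_cond_exp P (F s) (M t) \<omega> = M s \<omega>))"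

text \<open>Localizing times are finite valued; this is no restriction, since a localizing sequence
  \<open>T n\<close> with possibly infinite values may be replaced by \<open>min (T n) n\<close>. Path regularity is not part of
  the definition: it is automatic for the coordinate process and is required separately below.\<close>

definition local_martingale :: "'w measure \<Rightarrow> (real \<Rightarrow> 'w measure) \<Rightarrow> (real \<Rightarrow> 'w \<Rightarrow> real) \<Rightarrow> bool" where
  "local_martingale P F M \<longleftrightarrow>
     (\<forall>t\<ge>0. M t \<in> borel_measurable (F t)) \<and>
     (\<exists>T :: nat \<Rightarrow> 'w \<Rightarrow> real.
        (\<forall>n. stopping_time F (T n) \<and> (\<forall>\<omega>\<in>space P. 0 \<le> T n \<omega>)) \<and>
        (AE \<omega> in P. incseq (\<lambda>n. T n \<omega>) \<and> filterlim (\<lambda>n. T n \<omega>) at_top sequentially) \<and>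
        (\<forall>n. martingale P F (\<lambda>t \<omega>. M (min t (T n \<omega>)) \<omega> - M 0 \<omega>)))"

definition locally_bounded_variation :: "(real \<Rightarrow> real) \<Rightarrow> bool" where
  "locally_bounded_variation f \<longleftrightarrow>
     (\<forall>t\<ge>0. \<exists>C. \<forall>(n::nat) s. incseq s \<and> range s \<subseteq> {0..t} \<longrightarrow>
        (\<Sum>k<n. \<bar>f (s (Suc k)) - f (s k)\<bar>) \<le> C)"

text \<open>For continuous local martingales \<open>M\<close> and \<open>N\<close>, the bracket \<open>\<langle>M, N\<rangle>\<close> is the process \<open>A\<close>, unique
  up to indistinguishability, with the following properties. The path properties are only required
  almost surely because the filtration is not completed.\<close>

definition is_bracket ::
  "'w measure \<Rightarrow> (real \<Rightarrow> 'w measure) \<Rightarrow> (real \<Rightarrow> 'w \<Rightarrow> real) \<Rightarrow> (real \<Rightarrow> 'w \<Rightarrow> real) \<Rightarrow>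
   (real \<Rightarrow> 'w \<Rightarrow> real) \<Rightarrow> bool" where
  "is_bracket P F M N A \<longleftrightarrow>
     (\<forall>t\<ge>0. A t \<in> borel_measurable (F t)) \<and>
     (AE \<omega> in P. A 0 \<omega> = 0 \<and> continuous_on {0..} (\<lambda>t. A t \<omega>) \<and>
        locally_bounded_variation (\<lambda>t. A t \<omega>)) \<and>
     local_martingale P F (\<lambda>t \<omega>. M t \<omega> * N t \<omega> - A t \<omega>)"

text \<open>The process \<open>A\<close> below is the common bracket \<open>\<langle>X(1)\<rangle> = \<dots> = \<langle>X(d)\<rangle>\<close>.\<close>

definition conformal_local_martingale ::
  "'w measure \<Rightarrow> (real \<Rightarrow> 'w measure) \<Rightarrow> (real \<Rightarrow> 'w \<Rightarrow> real ^ 'd) \<Rightarrow> bool" where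
  "conformal_local_martingale P F X \<longleftrightarrow>
     (\<forall>i. local_martingale P F (\<lambda>t \<omega>. X t \<omega> $ i)) \<and>
     (\<exists>A. \<forall>i j. is_bracket P F (\<lambda>t \<omega>. X t \<omega> $ i) (\<lambda>t \<omega>. X t \<omega> $ j)
                  (\<lambda>t \<omega>. if i = j then A t \<omega> else 0))"

definition true_conformal_martingale ::
  "'w measure \<Rightarrow> (real \<Rightarrow> 'w measure) \<Rightarrow> (real \<Rightarrow> 'w \<Rightarrow> real ^ 'd) \<Rightarrow> bool" where
  "true_conformal_martingale P F X \<longleftrightarrow>
     conformal_local_martingale P F X \<and> (\<forall>i. martingale P F (\<lambda>t \<omega>. X t \<omega> $ i))"


section \<open>Absorption and inversion\<close>

definition absorbed_at :: "'a set \<Rightarrow> (real \<Rightarrow> 'a) \<Rightarrow> bool" where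
  "absorbed_at B \<omega> \<longleftrightarrow> (\<forall>s t. 0 \<le> s \<and> s \<le> t \<and> \<omega> s \<in> B \<longrightarrow> \<omega> t = \<omega> s)"

definition inversion :: "'a::real_normed_vector \<Rightarrow> 'a" where
  "inversion x = x /\<^sub>R (norm x)\<^sup>2"

text \<open>Pointwise inversion of a path. Paths through the origin have no continuous inverted path and
  are left unchanged, which keeps the map total and measurable from path space to itself.\<close>

definition path_inversion :: "(real \<Rightarrow> 'a::real_normed_vector) \<Rightarrow> (real \<Rightarrow> 'a)" where
  "path_inversion \<omega> =
     (if \<forall>t\<ge>0. \<omega> t \<noteq> 0 then restrict (\<lambda>t. inversion (\<omega> t)) {0..} else \<omega>)"

text \<open>The closed state space of a process in the complement of \<open>D\<close> that is absorbed upon hitting the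
  boundary of \<open>D\<close>; for closed \<open>D\<close> it is the closure of the complement.\<close>

definition absorbed_exterior :: "'a::topological_space set \<Rightarrow> 'a set" where
  "absorbed_exterior D = - D \<union> frontier D"

end

theory Submission
  imports Defs
begin

text \<open>
  Put \<open>h x = \<bar>x\<bar>\<^sup>2\<^sup>-\<^sup>d\<close>. Since \<open>X\<close> stays away from the origin, \<open>h(X)\<close> is a bounded
  martingale, hence closed by a limit \<open>Z\<close>, and \<open>Q\<close> is the law of the inverted path under the measure
  with density \<open>Z / h x\<^sub>0\<close>. With \<open>y\<close> the inverse of \<open>x\<close>, the functions \<open>h x\<close>, \<open>h x y\<^sub>i\<close>,
  \<open>h x y\<^sub>i y\<^sub>j\<close> for \<open>i \<noteq> j\<close> and \<open>h x (y\<^sub>i\<^sup>2 - y\<^sub>c\<^sup>2)\<close> are Kelvin transforms of harmonic polynomials,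
  hence harmonic, and harmonic functions of a conformal local martingale are local martingales. So under
  \<open>Q\<close> the coordinates, their mixed products and the differences of their squares are bounded
  martingales. The common bracket of the coordinates is therefore the quadratic variation of any one
  of them; it is constructed from dyadic sums, which avoids transforming the bracket given under \<open>P\<close>.
  The integral identity is optional stopping for \<open>h(X)\<close>, tested on the events \<open>X\<^sub>\<tau> \<in> B\<close>.
\<close>

section \<open>Martingales and dyadic integrals\<close>

text \<open>The paths avoid a ball of radius \<rho> around the origin. This bounds the density by a
  power of \<rho> and the inverted paths by \<open>1 / \<rho>\<close>, and boundedness is what turns
  local martingales into martingales. Being closed by a limit, the density gives one measure on all
  of path space instead of a family indexed by time.

  The obstacle is the raw filtration: what is determined only up to null sets may fail to be
  adapted. Stopped martingales and quadratic variations are therefore limits of adapted sequences,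
  identified almost surely afterwards. Stopping times are rounded up to dyadic grids, and
  convergence in L1 follows by comparing integrals of \<open>max 0 (\<bar>x\<bar> - c)\<close>,
  which do not decrease in time for a martingale.

  In the final identity the function integrated under \<open>Q\<close> may be unbounded near the
  origin, so the change of measure is proved for the laws of the stopped position, and unbounded
  functions are integrated only against these laws. The random time belongs to the original path; it
  is carried over by composition with the involution \<open>path_inversion\<close>.\<close>

locale filtered_prob_space = prob_space P for P :: "'w measure" +
  fixes F :: "real \<Rightarrow> 'w measure"
  assumes space_F: "space (F t) = space P"
    and sets_F: "sets (F t) \<subseteq> sets P"
    and sets_F_mono: "s \<le> t \<Longrightarrow> sets (F s) \<subseteq> sets (F t)"
begin

lemma subalgebra_F: "subalgebra P (F t)"
  using space_F sets_F by (auto simp: subalgebra_def)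

lemma measurable_F: "f \<in> measurable (F t) N \<Longrightarrow> f \<in> measurable P N"
  using measurable_from_subalg[OF subalgebra_F] .

lemma measurable_F_mono: "f \<in> measurable (F s) N \<Longrightarrow> s \<le> t \<Longrightarrow> f \<in> measurable (F t) N"
  using space_F sets_F_mono by (auto simp: measurable_def subset_iff)

lemma sigma_finite_subalgebra_F: "sigma_finite_subalgebra P (F t)"
  by (intro finite_measure_subalgebra_is_sigma_finite finite_measure_subalgebra.intro
      finite_measure_subalgebra_axioms.intro subalgebra_F finite_measure_axioms)

section \<open>Calculus of martingales in integrated form\<close>

lemma martingale_adapted: "martingale P F M \<Longrightarrow> 0 \<le> t \<Longrightarrow> M t \<in> borel_measurable (F t)"
  and martingale_integrable: "martingale P F M \<Longrightarrow> 0 \<le> t \<Longrightarrow> integrable P (M t)"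
  by (auto simp: martingale_def)

lemma martingale_measurable: "martingale P F M \<Longrightarrow> 0 \<le> t \<Longrightarrow> M t \<in> borel_measurable P"
  using martingale_integrable by (rule borel_measurable_integrable)

text \<open>Pull-out property: conditioning on \<open>F s\<close> treats \<open>H\<close> as a
  constant. Integrability is required at the later time only and passes to \<open>s\<close>, because
  the conditional expectation of \<open>H * M t\<close> agrees almost surely with
  \<open>H * M s\<close>.\<close>

lemma martingale_mult:
  assumes "martingale P F M" "0 \<le> s" "s \<le> t" "H \<in> borel_measurable (F s)"
    "integrable P (\<lambda>\<omega>. H \<omega> * M t \<omega>)"
  shows "integrable P (\<lambda>\<omega>. H \<omega> * M s \<omega>)"
    and "(\<integral>\<omega>. H \<omega> * M t \<omega> \<partial>P) = (\<integral>\<omega>. H \<omega> * M s \<omega> \<partial>P)"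
proof -
  interpret S: sigma_finite_subalgebra P "F s" by (rule sigma_finite_subalgebra_F)
  have [measurable]: "H \<in> borel_measurable P" "M t \<in> borel_measurable P" "M s \<in> borel_measurable P"
    using martingale_measurable[OF assms(1)] measurable_F[OF assms(4)] assms(2,3) by auto
  have ae: "AE \<omega> in P. real_cond_exp P (F s) (M t) \<omega> = M s \<omega>"
    using assms by (auto simp: martingale_def)
  have 1: "integrable P (\<lambda>\<omega>. H \<omega> * real_cond_exp P (F s) (M t) \<omega>)"
    and 2: "(\<integral>\<omega>. H \<omega> * real_cond_exp P (F s) (M t) \<omega> \<partial>P) = (\<integral>\<omega>. H \<omega> * M t \<omega> \<partial>P)"
    using S.real_cond_exp_intg[OF assms(5,4)] by auto
  have "AE \<omega> in P. H \<omega> * real_cond_exp P (F s) (M t) \<omega> = H \<omega> * M s \<omega>"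
    using ae by eventually_elim simp
  then show "integrable P (\<lambda>\<omega>. H \<omega> * M s \<omega>)"
    by (intro integrable_cong_AE_imp[OF 1]) (auto elim: eventually_mono)
  show "(\<integral>\<omega>. H \<omega> * M t \<omega> \<partial>P) = (\<integral>\<omega>. H \<omega> * M s \<omega> \<partial>P)"
    unfolding 2[symmetric] using ae by (intro integral_cong_AE) (auto elim: eventually_mono)
qed

lemma integrable_bounded_mult:
  fixes H M :: "'w \<Rightarrow> real"
  assumes "integrable P M" "H \<in> borel_measurable P" "\<And>\<omega>. \<omega> \<in> space P \<Longrightarrow> \<bar>H \<omega>\<bar> \<le> C"
  shows "integrable P (\<lambda>\<omega>. H \<omega> * M \<omega>)"
proof (rule Bochner_Integration.integrable_bound)
  show "integrable P (\<lambda>\<omega>. C * M \<omega>)" using assms by simp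
  show "AE \<omega> in P. norm (H \<omega> * M \<omega>) \<le> norm (C * M \<omega>)"
  proof (rule AE_I2)
    fix \<omega> assume "\<omega> \<in> space P"
    then have "\<bar>H \<omega>\<bar> \<le> \<bar>C\<bar>" using assms(3)[of \<omega>] by linarith
    then show "norm (H \<omega> * M \<omega>) \<le> norm (C * M \<omega>)" by (simp add: abs_mult mult_right_mono)
  qed
qed (use assms in auto)

lemma martingale_mult_bounded:
  assumes "martingale P F M" "0 \<le> s" "s \<le> t" "H \<in> borel_measurable (F s)"
    "\<And>\<omega>. \<omega> \<in> space P \<Longrightarrow> \<bar>H \<omega>\<bar> \<le> C"
  shows "(\<integral>\<omega>. H \<omega> * M t \<omega> \<partial>P) = (\<integral>\<omega>. H \<omega> * M s \<omega> \<partial>P)"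
proof (rule martingale_mult(2)[OF assms(1-4)])
  show "integrable P (\<lambda>\<omega>. H \<omega> * M t \<omega>)"
    by (rule integrable_bounded_mult[OF martingale_integrable[OF assms(1)] measurable_F[OF assms(4)] assms(5)])
      (use assms in auto)
qed

text \<open>Conditional expectations are characterised by their integrals over events of
  \<open>F s\<close>; in this form the martingale property passes to sums, modifications and limits
  in L1.\<close>

lemma martingaleI:
  assumes "\<And>t. 0 \<le> t \<Longrightarrow> M t \<in> borel_measurable (F t)"
    and "\<And>t. 0 \<le> t \<Longrightarrow> integrable P (M t)"
    and "\<And>s t A. 0 \<le> s \<Longrightarrow> s \<le> t \<Longrightarrow> A \<in> sets (F s) \<Longrightarrow>
      (\<integral>\<omega>. indicator A \<omega> * M t \<omega> \<partial>P) = (\<integral>\<omega>. indicator A \<omega> * M s \<omega> \<partial>P)"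
  shows "martingale P F M"
  unfolding martingale_def
proof (intro conjI allI impI)
  fix s t :: real assume "0 \<le> s \<and> s \<le> t"
  then have st: "0 \<le> s" "s \<le> t" by auto
  interpret S: sigma_finite_subalgebra P "F s" by (rule sigma_finite_subalgebra_F)
  show "AE \<omega> in P. real_cond_exp P (F s) (M t) \<omega> = M s \<omega>"
  proof (rule S.real_cond_exp_charact)
    show "set_lebesgue_integral P A (M t) = set_lebesgue_integral P A (M s)"
      if "A \<in> sets (F s)" for A
      using assms(3)[OF st that] by (simp add: set_lebesgue_integral_def)
  qed (use assms st in auto)
qed (use assms in auto)

text \<open>Adaptedness of \<open>N\<close> is a separate hypothesis because the filtration need not
  contain the null sets on which \<open>N\<close> and \<open>M\<close> differ.\<close>

lemma martingale_cong_AE: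
  assumes "martingale P F M" "\<And>t. 0 \<le> t \<Longrightarrow> N t \<in> borel_measurable (F t)"
    and "\<And>t. 0 \<le> t \<Longrightarrow> AE \<omega> in P. N t \<omega> = M t \<omega>"
  shows "martingale P F N"
proof (rule martingaleI)
  have m: "M t \<in> borel_measurable P" "N t \<in> borel_measurable P" if "0 \<le> t" for t
    using measurable_F[OF assms(2)[OF that]] martingale_measurable[OF assms(1) that] by auto
  show "integrable P (N t)" if t: "0 \<le> t" for t
  proof -
    have "AE \<omega> in P. M t \<omega> = N t \<omega>" using assms(3)[OF t] by eventually_elim simp
    then show ?thesis
      by (intro integrable_cong_AE_imp[OF martingale_integrable[OF assms(1) t] m(2)[OF t]])
  qed
  fix s t A assume st: "0 \<le> s" "s \<le> t" "A \<in> sets (F s)"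
  then have t: "0 \<le> t" by simp
  have [measurable]: "A \<in> sets P" using st sets_F by auto
  note [measurable] = m[OF st(1)] m[OF t]
  have "(\<integral>\<omega>. indicator A \<omega> * N t \<omega> \<partial>P) = (\<integral>\<omega>. indicator A \<omega> * M t \<omega> \<partial>P)"
    using assms(3)[OF t] by (intro integral_cong_AE) (auto elim: eventually_mono)
  also have "\<dots> = (\<integral>\<omega>. indicator A \<omega> * M s \<omega> \<partial>P)"
    by (rule martingale_mult_bounded[OF assms(1) st(1,2), where C=1])
       (use st(3) in \<open>auto split: split_indicator\<close>)
  also have "\<dots> = (\<integral>\<omega>. indicator A \<omega> * N s \<omega> \<partial>P)"
    using assms(3)[OF st(1)] by (intro integral_cong_AE) (auto elim: eventually_mono)
  finally show "(\<integral>\<omega>. indicator A \<omega> * N t \<omega> \<partial>P) = (\<integral>\<omega>. indicator A \<omega> * N s \<omega> \<partial>P)" .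
qed (use assms in auto)

lemma martingale_set:
  assumes "martingale P F M" "0 \<le> s" "s \<le> t" "A \<in> sets (F s)"
  shows "(\<integral>\<omega>. indicator A \<omega> * M t \<omega> \<partial>P) = (\<integral>\<omega>. indicator A \<omega> * M s \<omega> \<partial>P)"
  by (rule martingale_mult_bounded[OF assms(1-3), where C=1])
     (use assms(4) in \<open>auto split: split_indicator\<close>)

lemma integrable_indicator_mult:
  fixes M :: "'w \<Rightarrow> real"
  assumes "integrable P M" "A \<in> sets P"
  shows "integrable P (\<lambda>\<omega>. indicator A \<omega> * M \<omega>)"
  using integrable_mult_indicator[OF assms(2,1)] by simp

lemma indicator_F: "A \<in> sets (F s) \<Longrightarrow> A \<in> sets P"
  using sets_F by auto

lemma martingale_sum:
  assumes "\<And>k. k \<in> I \<Longrightarrow> martingale P F (M k)"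
  shows "martingale P F (\<lambda>t \<omega>. \<Sum>k\<in>I. M k t \<omega>)"
proof (rule martingaleI)
  fix s t A assume st: "0 \<le> s" "s \<le> t" "A \<in> sets (F s)"
  have i: "integrable P (\<lambda>\<omega>. indicator A \<omega> * M k r \<omega>)" if "k \<in> I" "0 \<le> r" for k r
    by (rule integrable_indicator_mult[OF martingale_integrable[OF assms[OF that(1)] that(2)] indicator_F[OF st(3)]])
  show "(\<integral>\<omega>. indicator A \<omega> * (\<Sum>k\<in>I. M k t \<omega>) \<partial>P) = (\<integral>\<omega>. indicator A \<omega> * (\<Sum>k\<in>I. M k s \<omega>) \<partial>P)"
    unfolding sum_distrib_left
    using st by (subst (1 2) Bochner_Integration.integral_sum)
      (auto intro!: i sum.cong martingale_set[OF assms])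
qed (auto intro!: borel_measurable_sum Bochner_Integration.integrable_sum
      intro: martingale_adapted[OF assms] martingale_integrable[OF assms])

lemma martingale_diff:
  assumes "martingale P F M" "martingale P F N"
  shows "martingale P F (\<lambda>t \<omega>. M t \<omega> - N t \<omega>)"
proof (rule martingaleI)
  fix s t A assume st: "0 \<le> s" "s \<le> t" "A \<in> sets (F s)"
  have i: "integrable P (\<lambda>\<omega>. indicator A \<omega> * M r \<omega>)" "integrable P (\<lambda>\<omega>. indicator A \<omega> * N r \<omega>)"
    if "0 \<le> r" for r
    using integrable_indicator_mult[OF martingale_integrable[OF _ that] indicator_F[OF st(3)]] assms by auto
  show "(\<integral>\<omega>. indicator A \<omega> * (M t \<omega> - N t \<omega>) \<partial>P) = (\<integral>\<omega>. indicator A \<omega> * (M s \<omega> - N s \<omega>) \<partial>P)"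
    using st i[of t] i[of s] martingale_set[OF assms(1) st] martingale_set[OF assms(2) st]
    by (simp add: right_diff_distrib)
qed (use assms in \<open>auto intro!: borel_measurable_diff Bochner_Integration.integrable_diff
      intro: martingale_adapted martingale_integrable\<close>)

lemma martingale_const:
  assumes "Z \<in> borel_measurable (F 0)" "integrable P Z"
  shows "martingale P F (\<lambda>t. Z)"
  by (rule martingaleI) (use assms measurable_F_mono in auto)

lemma martingale_add:
  assumes "martingale P F M" "martingale P F N"
  shows "martingale P F (\<lambda>t \<omega>. M t \<omega> + N t \<omega>)"
  using martingale_sum[of UNIV "\<lambda>b. if b then M else N"] assms by (simp add: UNIV_bool add.commute)

lemma martingale_cmult:
  assumes "martingale P F M"
  shows "martingale P F (\<lambda>t \<omega>. c * M t \<omega>)"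
proof (rule martingaleI)
  fix s t A assume st: "0 \<le> s" "s \<le> t" "A \<in> sets (F s)"
  show "(\<integral>\<omega>. indicator A \<omega> * (c * M t \<omega>) \<partial>P) = (\<integral>\<omega>. indicator A \<omega> * (c * M s \<omega>) \<partial>P)"
    using martingale_set[OF assms st] by (simp add: mult.left_commute[of _ c])
qed (use martingale_adapted[OF assms] martingale_integrable[OF assms] in auto)

text \<open>The integral over a fixed event is continuous in L1, so the equality between the times
  \<open>s\<close> and \<open>t\<close> survives. Adaptedness of \<open>Z\<close> has to be
  supplied, since an L1 limit is fixed only up to null sets.\<close>

lemma martingale_L1_limit:
  assumes M: "\<And>n. martingale P F (M n)"
    and Z: "\<And>t. 0 \<le> t \<Longrightarrow> Z t \<in> borel_measurable (F t)" "\<And>t. 0 \<le> t \<Longrightarrow> integrable P (Z t)"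
    and lim: "\<And>t. 0 \<le> t \<Longrightarrow> (\<lambda>n. \<integral>\<omega>. \<bar>M n t \<omega> - Z t \<omega>\<bar> \<partial>P) \<longlonglongrightarrow> 0"
  shows "martingale P F Z"
proof (rule martingaleI[OF Z])
  fix s t A assume st: "0 \<le> s" "s \<le> t" "A \<in> sets (F s)"
  have A: "A \<in> sets P" using st indicator_F by auto
  have L: "(\<lambda>n. \<integral>\<omega>. indicator A \<omega> * M n r \<omega> \<partial>P) \<longlonglongrightarrow> (\<integral>\<omega>. indicator A \<omega> * Z r \<omega> \<partial>P)" if r: "0 \<le> r" for r
  proof (rule LIM_zero_cancel, rule Lim_null_comparison[OF _ lim[OF r]], rule always_eventually, rule allI)
    fix n
    have i: "integrable P (M n r)" "integrable P (Z r)" using r Z martingale_integrable[OF M] by auto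
    note i' = integrable_indicator_mult[OF i(1) A] integrable_indicator_mult[OF i(2) A]
    have "(\<integral>\<omega>. indicator A \<omega> * M n r \<omega> \<partial>P) - (\<integral>\<omega>. indicator A \<omega> * Z r \<omega> \<partial>P)
       = (\<integral>\<omega>. indicator A \<omega> * (M n r \<omega> - Z r \<omega>) \<partial>P)"
      using i' by (simp add: right_diff_distrib)
    also have "norm \<dots> \<le> (\<integral>\<omega>. norm (indicator A \<omega> * (M n r \<omega> - Z r \<omega>)) \<partial>P)"
      by (rule integral_norm_bound)
    also have "\<dots> \<le> (\<integral>\<omega>. \<bar>M n r \<omega> - Z r \<omega>\<bar> \<partial>P)"
      by (rule integral_mono) (use i i' in \<open>auto simp: right_diff_distrib split: split_indicator\<close>)
    finally show "norm ((\<integral>\<omega>. indicator A \<omega> * M n r \<omega> \<partial>P) - (\<integral>\<omega>. indicator A \<omega> * Z r \<omega> \<partial>P))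
      \<le> (\<integral>\<omega>. \<bar>M n r \<omega> - Z r \<omega>\<bar> \<partial>P)" .
  qed
  have "(\<lambda>n. \<integral>\<omega>. indicator A \<omega> * M n t \<omega> \<partial>P) = (\<lambda>n. \<integral>\<omega>. indicator A \<omega> * M n s \<omega> \<partial>P)"
    using martingale_set[OF M st] by auto
  with L[of s] L[of t] st show "(\<integral>\<omega>. indicator A \<omega> * Z t \<omega> \<partial>P) = (\<integral>\<omega>. indicator A \<omega> * Z s \<omega> \<partial>P)"
    using LIMSEQ_unique by fastforce
qed

text \<open>Stochastic integral of the step process that equals \<open>H\<close> between the times
  \<open>a\<close> and \<open>b\<close> and zero elsewhere.\<close>

lemma martingale_increment:
  assumes M: "martingale P F M" and ab: "0 \<le> a" "a \<le> b"
    and H: "H \<in> borel_measurable (F a)" and C: "\<And>\<omega>. \<omega> \<in> space P \<Longrightarrow> \<bar>H \<omega>\<bar> \<le> C"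
  shows "martingale P F (\<lambda>t \<omega>. H \<omega> * (M (min b t) \<omega> - M (min a t) \<omega>))"
proof (rule martingaleI)
  have ad: "M r \<in> borel_measurable (F t)" if "0 \<le> r" "r \<le> t" for r t
    using measurable_F_mono[OF martingale_adapted[OF M that(1)] that(2)] .
  show "(\<lambda>\<omega>. H \<omega> * (M (min b t) \<omega> - M (min a t) \<omega>)) \<in> borel_measurable (F t)" if "0 \<le> t" for t
  \<comment> \<open>Before \<open>a\<close> both minima equal \<open>t\<close> and the process is
    identically zero, so \<open>H\<close>, which is known only from \<open>a\<close> on, does not
    enter.\<close>
  proof (cases "t < a")
    case True then show ?thesis using ab by (simp add: min_def)
  next
    case False
    then have "H \<in> borel_measurable (F t)" using measurable_F_mono[OF H] by auto
    then show ?thesis using ab that by (intro borel_measurable_times borel_measurable_diff ad) auto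
  qed
  show I: "integrable P (\<lambda>\<omega>. H \<omega> * (M (min b t) \<omega> - M (min a t) \<omega>))" if "0 \<le> t" for t
    by (rule integrable_bounded_mult[OF _ measurable_F[OF H] C])
       (use martingale_integrable[OF M] that ab in auto)
  fix s t A assume st: "0 \<le> s" "s \<le> t" "A \<in> sets (F s)"
  have A: "A \<in> sets P" using st indicator_F by auto
  \<comment> \<open>An event of \<open>F s\<close> is also one of \<open>F u\<close>, and nothing
    accrues before \<open>a\<close>; testing at \<open>u\<close> brings \<open>H\<close> and the
    event into one sigma-algebra.\<close>
  define u where "u = max s a"
  have u: "0 \<le> u" "a \<le> u" "s \<le> u" using st by (auto simp: u_def)
  let ?H = "\<lambda>\<omega>. indicator A \<omega> * H \<omega>"
  have Hu: "?H \<in> borel_measurable (F u)"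
    using measurable_F_mono[OF H u(2)] st(3) sets_F_mono[OF u(3)] by auto
  have Hb: "\<bar>?H \<omega>\<bar> \<le> C" if "\<omega> \<in> space P" for \<omega>
    using C[OF that] by (auto split: split_indicator)
  have HP: "integrable P (\<lambda>\<omega>. ?H \<omega> * M r \<omega>)" if "0 \<le> r" for r
    using integrable_bounded_mult[OF martingale_integrable[OF M that] measurable_F[OF Hu] Hb] .
  have eq: "(\<integral>\<omega>. ?H \<omega> * M r \<omega> \<partial>P) = (\<integral>\<omega>. ?H \<omega> * M u \<omega> \<partial>P)" if "u \<le> r" for r
    by (rule martingale_mult_bounded[OF M u(1) that Hu Hb])
  have 0: "(\<integral>\<omega>. indicator A \<omega> * (H \<omega> * (M (min b r) \<omega> - M (min a r) \<omega>)) \<partial>P)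
     = (\<integral>\<omega>. ?H \<omega> * M (min b r) \<omega> \<partial>P) - (\<integral>\<omega>. ?H \<omega> * M (min a r) \<omega> \<partial>P)" if "0 \<le> r" for r
    using HP[of "min b r"] HP[of "min a r"] that ab by (simp add: algebra_simps)
  consider "t \<le> a" | "s \<le> a" "a < t" | "a < s" "b \<le> s" | "a < s" "s < b" by linarith
  then show "(\<integral>\<omega>. indicator A \<omega> * (H \<omega> * (M (min b t) \<omega> - M (min a t) \<omega>)) \<partial>P)
     = (\<integral>\<omega>. indicator A \<omega> * (H \<omega> * (M (min b s) \<omega> - M (min a s) \<omega>)) \<partial>P)"
  proof cases
    case 1 then show ?thesis using ab st by (simp add: min_absorb2)
  next
    case 2
    then have "u = a" by (simp add: u_def)
    moreover have "min b t \<ge> a" "min a t = a" "min a s = s" "min b s = s" using 2 ab by auto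
    ultimately show ?thesis using 2 ab st eq[of "min b t"] 0[of t] by simp
  next
    case 3 then show ?thesis using ab st by (simp add: min_def)
  next
    case 4
    then have "u = s" by (simp add: u_def)
    then show ?thesis using 4 ab st eq[of "min b t"] 0[of t] 0[of s] by (simp add: min_def)
  qed
qed

section \<open>Integrals of step processes on dyadic grids\<close>

definition dyadic_incr :: "(real \<Rightarrow> 'w \<Rightarrow> real) \<Rightarrow> nat \<Rightarrow> nat \<Rightarrow> real \<Rightarrow> 'w \<Rightarrow> real" where
  "dyadic_incr M m k t \<omega> = M (min (real (Suc k) / 2 ^ m) t) \<omega> - M (min (real k / 2 ^ m) t) \<omega>"

text \<open>The upper limit grows with \<open>t\<close>, so no horizon is fixed in advance. Cells
  that begin at or after \<open>t\<close> contribute zero, and \<open>dyadic_integral_eq\<close>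
  exchanges the limit for any grid bound \<open>N\<close> beyond \<open>t\<close>.\<close>

definition dyadic_integral ::
  "nat \<Rightarrow> (nat \<Rightarrow> 'w \<Rightarrow> real) \<Rightarrow> (real \<Rightarrow> 'w \<Rightarrow> real) \<Rightarrow> real \<Rightarrow> 'w \<Rightarrow> real" where
  "dyadic_integral m H M t \<omega> = (\<Sum>k<nat \<lceil>t * 2 ^ m\<rceil>. H k \<omega> * dyadic_incr M m k t \<omega>)"

lemma dyadic_incr_0: "t \<le> real k / 2 ^ m \<Longrightarrow> dyadic_incr M m k t \<omega> = 0"
proof -
  assume a: "t \<le> real k / 2 ^ m"
  also have "\<dots> \<le> real (Suc k) / 2 ^ m" by (simp add: divide_right_mono)
  finally show ?thesis using a by (simp add: dyadic_incr_def min_def)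
qed

lemma dyadic_integral_eq:
  assumes "t \<le> real N / 2 ^ m"
  shows "dyadic_integral m H M t \<omega> = (\<Sum>k<N. H k \<omega> * dyadic_incr M m k t \<omega>)"
  unfolding dyadic_integral_def
proof (rule sum.mono_neutral_left)
  have "t * 2 ^ m \<le> real N" using assms by (simp add: field_simps)
  then show "{..<nat \<lceil>t * 2 ^ m\<rceil>} \<subseteq> {..<N}" by (auto simp: nat_less_iff)
  show "\<forall>k\<in>{..<N} - {..<nat \<lceil>t * 2 ^ m\<rceil>}. H k \<omega> * dyadic_incr M m k t \<omega> = 0"
  proof
    fix k assume "k \<in> {..<N} - {..<nat \<lceil>t * 2 ^ m\<rceil>}"
    then have "t * 2 ^ m \<le> real k" by simp
    then show "H k \<omega> * dyadic_incr M m k t \<omega> = 0" by (subst dyadic_incr_0) (auto simp: field_simps)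
  qed
qed simp

text \<open>The bounds \<open>C k\<close> may depend on the cell, as only finitely many cells
  contribute up to a given time.\<close>

lemma martingale_dyadic_integral:
  assumes M: "martingale P F M"
    and H: "\<And>k. H k \<in> borel_measurable (F (real k / 2 ^ m))"
    and C: "\<And>k \<omega>. \<omega> \<in> space P \<Longrightarrow> \<bar>H k \<omega>\<bar> \<le> C k"
  shows "martingale P F (dyadic_integral m H M)"
proof -
  have S: "martingale P F (\<lambda>t \<omega>. \<Sum>k<N. H k \<omega> * dyadic_incr M m k t \<omega>)" for N
    unfolding dyadic_incr_def
    by (intro martingale_sum martingale_increment[OF M _ _ H C]) (auto simp: divide_right_mono)
  have N: "\<exists>N. t \<le> real N / 2 ^ m" for t
    using real_arch_simple[of "t * 2 ^ m"] by (auto simp: field_simps)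
  show ?thesis
  proof (rule martingaleI)
    fix t :: real assume t: "0 \<le> t"
    obtain N where N: "t \<le> real N / 2 ^ m" using N by auto
    have e: "dyadic_integral m H M t = (\<lambda>\<omega>. \<Sum>k<N. H k \<omega> * dyadic_incr M m k t \<omega>)"
      using dyadic_integral_eq[OF N] by auto
    show "dyadic_integral m H M t \<in> borel_measurable (F t)" "integrable P (dyadic_integral m H M t)"
      unfolding e using martingale_adapted[OF S t] martingale_integrable[OF S t] by auto
  next
    fix s t A assume st: "0 \<le> s" "s \<le> t" "A \<in> sets (F s)"
    obtain N where N: "t \<le> real N / 2 ^ m" using N by auto
    then have N': "s \<le> real N / 2 ^ m" using st by simp
    show "(\<integral>\<omega>. indicator A \<omega> * dyadic_integral m H M t \<omega> \<partial>P)
       = (\<integral>\<omega>. indicator A \<omega> * dyadic_integral m H M s \<omega> \<partial>P)"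
      unfolding dyadic_integral_eq[OF N] dyadic_integral_eq[OF N'] by (rule martingale_set[OF S st])
  qed
qed

text \<open>Jensen's inequality for the convex excess function, by hand: where
  \<open>M s > c\<close> or \<open>M s < - c\<close> the excess is affine in \<open>M s\<close>, so
  \<open>M s\<close> may be replaced by \<open>M t\<close> there, and at time \<open>t\<close> the
  affine expressions lie below the excess. With \<open>c = 0\<close> this is the submartingale
  property of the absolute value.\<close>

lemma martingale_excess_mono:
  assumes M: "martingale P F M" and st: "0 \<le> s" "s \<le> t" "A \<in> sets (F s)" and c: "0 \<le> c"
  shows "(\<integral>\<omega>. indicator A \<omega> * max 0 (\<bar>M s \<omega>\<bar> - c) \<partial>P) \<le> (\<integral>\<omega>. indicator A \<omega> * max 0 (\<bar>M t \<omega>\<bar> - c) \<partial>P)"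
proof -
  have ad: "M s \<in> borel_measurable (F s)" using martingale_adapted[OF M st(1)] .
  define B where "B = {\<omega>\<in>space (F s). M s \<omega> > c} \<inter> A"
  define D where "D = {\<omega>\<in>space (F s). M s \<omega> < - c} \<inter> A"
  have B: "B \<in> sets (F s)" and D: "D \<in> sets (F s)" unfolding B_def D_def using ad st(3) by auto
  note BP = indicator_F[OF B] and DP = indicator_F[OF D] and AP = indicator_F[OF st(3)]
  have is_M: "integrable P (M s)" "integrable P (M t)" using martingale_integrable[OF M] st by auto
  note I = integrable_indicator_mult
  have ic: "integrable P (\<lambda>\<omega>. max 0 (\<bar>f \<omega>\<bar> - c))" if "integrable P f" for f :: "'w \<Rightarrow> real"
    by (rule Bochner_Integration.integrable_bound[OF that]) (use c that in auto)
  have "(\<integral>\<omega>. indicator A \<omega> * max 0 (\<bar>M s \<omega>\<bar> - c) \<partial>P)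
    = (\<integral>\<omega>. indicator B \<omega> * (M s \<omega> - c) - indicator D \<omega> * (M s \<omega> + c) \<partial>P)"
    using c st(3) sets.sets_into_space[OF st(3)]
    by (intro Bochner_Integration.integral_cong) (auto simp: B_def D_def space_F split: split_indicator)
  also have "\<dots> = (\<integral>\<omega>. indicator B \<omega> * (M t \<omega> - c) - indicator D \<omega> * (M t \<omega> + c) \<partial>P)"
  proof -
    have "(\<integral>\<omega>. indicator B \<omega> * (Z \<omega> - c) - indicator D \<omega> * (Z \<omega> + c) \<partial>P)
      = (\<integral>\<omega>. indicator B \<omega> * Z \<omega> \<partial>P) - (\<integral>\<omega>. indicator D \<omega> * Z \<omega> \<partial>P)
        - c * measure P B - c * measure P D" if "integrable P Z" for Z
    proof -
      have "(\<lambda>\<omega>. indicator B \<omega> * (Z \<omega> - c) - indicator D \<omega> * (Z \<omega> + c))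
        = (\<lambda>\<omega>. indicator B \<omega> * Z \<omega> - indicator D \<omega> * Z \<omega> - c * indicator B \<omega> - c * indicator D \<omega>)"
        by (auto simp: algebra_simps)
      moreover have "integrable P (indicat_real B)" "integrable P (indicat_real D)"
        using I[of "\<lambda>_. 1", OF _ BP] I[of "\<lambda>_. 1", OF _ DP] by simp_all
      ultimately show ?thesis using I[OF that BP] I[OF that DP] BP DP
        by (simp add: Bochner_Integration.integrable_diff)
    qed
    from this[OF is_M(1)] this[OF is_M(2)] show ?thesis
      using martingale_set[OF M st(1,2) B] martingale_set[OF M st(1,2) D] by simp
  qed
  also have "\<dots> \<le> (\<integral>\<omega>. indicator A \<omega> * max 0 (\<bar>M t \<omega>\<bar> - c) \<partial>P)"
  proof (rule integral_mono)
    show "integrable P (\<lambda>\<omega>. indicator B \<omega> * (M t \<omega> - c) - indicator D \<omega> * (M t \<omega> + c))"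
      by (intro Bochner_Integration.integrable_diff I BP DP Bochner_Integration.integrable_add is_M) auto
    show "integrable P (\<lambda>\<omega>. indicator A \<omega> * max 0 (\<bar>M t \<omega>\<bar> - c))" by (intro I ic is_M AP)
    show "indicator B \<omega> * (M t \<omega> - c) - indicator D \<omega> * (M t \<omega> + c) \<le> indicator A \<omega> * max 0 (\<bar>M t \<omega>\<bar> - c)" for \<omega>
      using c by (auto simp: B_def D_def split: split_indicator)
  qed
  finally show ?thesis .
qed

end

section \<open>Optional stopping\<close>

context prob_space
begin

text \<open>The excess \<open>max 0 (\<bar>x\<bar> - c)\<close> is the distance of \<open>x\<close> to its truncation at level \<open>c\<close>.\<close>

lemma L1_convergence_excess:
  fixes Z :: "nat \<Rightarrow> 'a \<Rightarrow> real"
  assumes Z: "\<And>n. integrable M (Z n)" and Y[measurable]: "Y \<in> borel_measurable M"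
    and lim: "AE \<omega> in M. (\<lambda>n. Z n \<omega>) \<longlonglongrightarrow> Y \<omega>" and V: "integrable M V"
    and le: "\<And>n c. 0 \<le> c \<Longrightarrow> (\<integral>\<omega>. max 0 (\<bar>Z n \<omega>\<bar> - c) \<partial>M) \<le> (\<integral>\<omega>. max 0 (\<bar>V \<omega>\<bar> - c) \<partial>M)"
  shows "integrable M Y" and "(\<lambda>n. \<integral>\<omega>. \<bar>Z n \<omega> - Y \<omega>\<bar> \<partial>M) \<longlonglongrightarrow> 0"
proof -
  have [measurable]: "Z n \<in> borel_measurable M" "V \<in> borel_measurable M" for n using Z V by auto
  have ic: "integrable M (\<lambda>\<omega>. max 0 (\<bar>f \<omega>\<bar> - c))" if "integrable M f" "0 \<le> c" for f :: "'a \<Rightarrow> real" and c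
    by (rule Bochner_Integration.integrable_bound[OF that(1)]) (use that in auto)
  \<comment> \<open>Fatou's lemma hands the bound by the excess of \<open>V\<close> on to the limit;
    the level \<open>c = 0\<close> already gives integrability of \<open>Y\<close>.\<close>
  have fatou: "(\<integral>\<^sup>+\<omega>. ennreal (max 0 (\<bar>Y \<omega>\<bar> - c)) \<partial>M) \<le> ennreal (\<integral>\<omega>. max 0 (\<bar>V \<omega>\<bar> - c) \<partial>M)"
    if c: "0 \<le> c" for c
  proof -
    have "(\<integral>\<^sup>+\<omega>. ennreal (max 0 (\<bar>Y \<omega>\<bar> - c)) \<partial>M)
      = (\<integral>\<^sup>+\<omega>. liminf (\<lambda>n. ennreal (max 0 (\<bar>Z n \<omega>\<bar> - c))) \<partial>M)"
    proof (rule nn_integral_cong_AE, use lim in eventually_elim)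
      fix \<omega> assume "(\<lambda>n. Z n \<omega>) \<longlonglongrightarrow> Y \<omega>"
      then have "(\<lambda>n. ennreal (max 0 (\<bar>Z n \<omega>\<bar> - c))) \<longlonglongrightarrow> ennreal (max 0 (\<bar>Y \<omega>\<bar> - c))"
        by (intro tendsto_ennrealI tendsto_max tendsto_intros)
      then show "ennreal (max 0 (\<bar>Y \<omega>\<bar> - c)) = liminf (\<lambda>n. ennreal (max 0 (\<bar>Z n \<omega>\<bar> - c)))"
        by (intro lim_imp_Liminf[symmetric]) auto
    qed
    also have "\<dots> \<le> liminf (\<lambda>n. \<integral>\<^sup>+\<omega>. ennreal (max 0 (\<bar>Z n \<omega>\<bar> - c)) \<partial>M)"
      by (rule nn_integral_liminf) simp
    also have "\<dots> \<le> ennreal (\<integral>\<omega>. max 0 (\<bar>V \<omega>\<bar> - c) \<partial>M)"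
    proof -
      have "(\<integral>\<^sup>+\<omega>. ennreal (max 0 (\<bar>Z n \<omega>\<bar> - c)) \<partial>M) \<le> ennreal (\<integral>\<omega>. max 0 (\<bar>V \<omega>\<bar> - c) \<partial>M)" for n
        using le[OF c, of n] by (subst nn_integral_eq_integral[OF ic[OF Z c]]) (auto simp: ennreal_leI)
      then have "liminf (\<lambda>n. \<integral>\<^sup>+\<omega>. ennreal (max 0 (\<bar>Z n \<omega>\<bar> - c)) \<partial>M)
         \<le> liminf (\<lambda>n. ennreal (\<integral>\<omega>. max 0 (\<bar>V \<omega>\<bar> - c) \<partial>M))"
        by (intro Liminf_mono always_eventually) auto
      then show ?thesis by (simp add: Liminf_const)
    qed
    finally show ?thesis .
  qed
  show YI: "integrable M Y"
  proof (rule integrableI_bounded)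
    have "(\<integral>\<^sup>+\<omega>. ennreal (norm (Y \<omega>)) \<partial>M) \<le> ennreal (\<integral>\<omega>. max 0 (\<bar>V \<omega>\<bar> - 0) \<partial>M)"
      using fatou[of 0] by simp
    then show "(\<integral>\<^sup>+\<omega>. ennreal (norm (Y \<omega>)) \<partial>M) < \<infinity>"
      by (rule order.strict_trans1) simp
  qed fact
  have Yc: "(\<integral>\<omega>. max 0 (\<bar>Y \<omega>\<bar> - c) \<partial>M) \<le> (\<integral>\<omega>. max 0 (\<bar>V \<omega>\<bar> - c) \<partial>M)" if c: "0 \<le> c" for c
    using fatou[OF c] unfolding nn_integral_eq_integral[OF ic[OF YI c] AE_I2[OF max.cobounded1]]
    by (subst (asm) ennreal_le_iff) (auto intro!: integral_nonneg_AE)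
  have Vlim: "(\<lambda>n. \<integral>\<omega>. max 0 (\<bar>V \<omega>\<bar> - real n) \<partial>M) \<longlonglongrightarrow> (\<integral>\<omega>. 0 \<partial>M)"
  proof (rule integral_dominated_convergence[where w="\<lambda>\<omega>. \<bar>V \<omega>\<bar>"])
    show "AE \<omega> in M. (\<lambda>n. max 0 (\<bar>V \<omega>\<bar> - real n)) \<longlonglongrightarrow> 0"
    proof (rule AE_I2, rule tendsto_eventually)
      fix \<omega>
      obtain N :: nat where "\<bar>V \<omega>\<bar> \<le> real N" using real_arch_simple by blast
      then show "\<forall>\<^sub>F n in sequentially. max 0 (\<bar>V \<omega>\<bar> - real n) = 0"
        by (intro eventually_sequentiallyI[of N]) auto
    qed
  qed (use V in auto)
  \<comment> \<open>\<open>cl c\<close> truncates to the interval from \<open>- c\<close> to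
    \<open>c\<close>. At a level where the excess of \<open>V\<close> is below \<open>r / 3\<close>,
    the truncated variables converge by dominated convergence, and the two truncation errors are
    excesses, each bounded by that of \<open>V\<close>.\<close>
  define cl where "cl c x = max (- c) (min c x)" for c x :: real
  have cl: "\<bar>x - cl c x\<bar> = max 0 (\<bar>x\<bar> - c)" if "0 \<le> c" for x c
    using that by (auto simp: cl_def)
  have [measurable]: "cl c \<in> borel_measurable borel" for c unfolding cl_def by measurable
  show "(\<lambda>n. \<integral>\<omega>. \<bar>Z n \<omega> - Y \<omega>\<bar> \<partial>M) \<longlonglongrightarrow> 0"
  proof (rule LIMSEQ_I)
    fix r :: real assume r: "0 < r"
    have "\<forall>\<^sub>F n in sequentially. (\<integral>\<omega>. max 0 (\<bar>V \<omega>\<bar> - real n) \<partial>M) < r / 3"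
      using Vlim r by (intro order_tendstoD) auto
    then obtain N where N: "(\<integral>\<omega>. max 0 (\<bar>V \<omega>\<bar> - real N) \<partial>M) < r / 3"
      by (auto simp: eventually_sequentially)
    let ?c = "real N"
    have clb: "\<bar>cl ?c x\<bar> \<le> ?c" for x by (auto simp: cl_def)
    have ci: "integrable M (\<lambda>\<omega>. cl ?c (f \<omega>))" if "f \<in> borel_measurable M" for f :: "'a \<Rightarrow> real"
      by (rule integrable_const_bound[where B="?c"]) (use that clb in auto)
    have "(\<lambda>n. \<integral>\<omega>. \<bar>cl ?c (Z n \<omega>) - cl ?c (Y \<omega>)\<bar> \<partial>M) \<longlonglongrightarrow> (\<integral>\<omega>. 0 \<partial>M)"
    proof (rule integral_dominated_convergence[where w="\<lambda>_. 2 * ?c"])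
      show "AE \<omega> in M. (\<lambda>n. \<bar>cl ?c (Z n \<omega>) - cl ?c (Y \<omega>)\<bar>) \<longlonglongrightarrow> 0"
        using lim
      proof eventually_elim
        fix \<omega> assume "(\<lambda>n. Z n \<omega>) \<longlonglongrightarrow> Y \<omega>"
        then have "(\<lambda>n. \<bar>cl ?c (Z n \<omega>) - cl ?c (Y \<omega>)\<bar>) \<longlonglongrightarrow> \<bar>cl ?c (Y \<omega>) - cl ?c (Y \<omega>)\<bar>"
          unfolding cl_def by (intro tendsto_intros tendsto_max tendsto_min)
        then show "(\<lambda>n. \<bar>cl ?c (Z n \<omega>) - cl ?c (Y \<omega>)\<bar>) \<longlonglongrightarrow> 0" by simp
      qed
      show "AE \<omega> in M. norm \<bar>cl ?c (Z n \<omega>) - cl ?c (Y \<omega>)\<bar> \<le> 2 * ?c" for n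
        using clb abs_triangle_ineq4 by (intro AE_I2) (smt (verit) real_norm_def)
    qed auto
    then have "\<forall>\<^sub>F n in sequentially. (\<integral>\<omega>. \<bar>cl ?c (Z n \<omega>) - cl ?c (Y \<omega>)\<bar> \<partial>M) < r / 3"
      using r by (intro order_tendstoD) auto
    then obtain n0 where n0: "\<And>n. n \<ge> n0 \<Longrightarrow> (\<integral>\<omega>. \<bar>cl ?c (Z n \<omega>) - cl ?c (Y \<omega>)\<bar> \<partial>M) < r / 3"
      by (auto simp: eventually_sequentially)
    show "\<exists>n0. \<forall>n\<ge>n0. norm ((\<integral>\<omega>. \<bar>Z n \<omega> - Y \<omega>\<bar> \<partial>M) - 0) < r"
    proof (intro exI allI impI)
      fix n assume n: "n \<ge> n0"
      have "(\<integral>\<omega>. \<bar>Z n \<omega> - Y \<omega>\<bar> \<partial>M)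
        \<le> (\<integral>\<omega>. \<bar>cl ?c (Z n \<omega>) - cl ?c (Y \<omega>)\<bar> + max 0 (\<bar>Z n \<omega>\<bar> - ?c) + max 0 (\<bar>Y \<omega>\<bar> - ?c) \<partial>M)"
      proof (rule integral_mono)
        fix \<omega>
        show "\<bar>Z n \<omega> - Y \<omega>\<bar> \<le> \<bar>cl ?c (Z n \<omega>) - cl ?c (Y \<omega>)\<bar> + max 0 (\<bar>Z n \<omega>\<bar> - ?c) + max 0 (\<bar>Y \<omega>\<bar> - ?c)"
          using cl[of ?c "Z n \<omega>"] cl[of ?c "Y \<omega>"] by linarith
      qed (use Z YI ic ci in auto)
      also have "\<dots> = (\<integral>\<omega>. \<bar>cl ?c (Z n \<omega>) - cl ?c (Y \<omega>)\<bar> \<partial>M) + (\<integral>\<omega>. max 0 (\<bar>Z n \<omega>\<bar> - ?c) \<partial>M)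
         + (\<integral>\<omega>. max 0 (\<bar>Y \<omega>\<bar> - ?c) \<partial>M)"
        using ic[OF Z, of ?c n] ic[OF YI, of ?c] ci[of "Z n"] ci[of Y] by simp
      also have "\<dots> < r" using n0[OF n] le[of ?c n] Yc[of ?c] N by simp
      finally have "(\<integral>\<omega>. \<bar>Z n \<omega> - Y \<omega>\<bar> \<partial>M) < r" .
      moreover have "0 \<le> (\<integral>\<omega>. \<bar>Z n \<omega> - Y \<omega>\<bar> \<partial>M)" by (intro integral_nonneg_AE) auto
      ultimately show "norm ((\<integral>\<omega>. \<bar>Z n \<omega> - Y \<omega>\<bar> \<partial>M) - 0) < r" by simp
    qed
  qed
qed

end

section \<open>Dyadic approximation of times from above\<close>

definition dyadic_ceiling :: "nat \<Rightarrow> real \<Rightarrow> real" where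
  "dyadic_ceiling m r = real (nat \<lceil>r * 2 ^ m\<rceil>) / 2 ^ m"

lemma dyadic_ceiling_bounds:
  assumes "0 \<le> r"
  shows "r \<le> dyadic_ceiling m r" "dyadic_ceiling m r \<le> r + 1 / 2 ^ m"
proof -
  have "real (nat \<lceil>r * 2 ^ m\<rceil>) = of_int \<lceil>r * 2 ^ m\<rceil>"
    using assms by (simp add: of_nat_nat)
  then have "r * 2 ^ m \<le> real (nat \<lceil>r * 2 ^ m\<rceil>)" "real (nat \<lceil>r * 2 ^ m\<rceil>) \<le> r * 2 ^ m + 1"
    by linarith+
  then show "r \<le> dyadic_ceiling m r" "dyadic_ceiling m r \<le> r + 1 / 2 ^ m"
    unfolding dyadic_ceiling_def by (auto simp: field_simps)
qed

lemma tendsto_half_power: "(\<lambda>m. c / 2 ^ m) \<longlonglongrightarrow> (0::real)"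
proof -
  have "(\<lambda>m. c * (1 / 2) ^ m) \<longlonglongrightarrow> c * 0"
    by (intro tendsto_intros LIMSEQ_realpow_zero) auto
  then show ?thesis by (simp add: power_one_over)
qed

lemma dyadic_ceiling_tendsto: "0 \<le> r \<Longrightarrow> (\<lambda>m. dyadic_ceiling m r) \<longlonglongrightarrow> r"
proof (rule tendsto_sandwich[where f="\<lambda>_. r" and h="\<lambda>m. r + 1 / 2 ^ m"])
  show "(\<lambda>m. r + 1 / 2 ^ m) \<longlonglongrightarrow> r"
    using tendsto_add[OF tendsto_const[of r] tendsto_half_power[of 1]] by simp
qed (auto simp: dyadic_ceiling_bounds)

lemma continuous_on_halfline_tendsto:
  fixes f :: "real \<Rightarrow> 'b::topological_space"
  assumes "continuous_on {0..} f" "0 \<le> r" "u \<longlonglongrightarrow> r" "\<And>n. 0 \<le> u n"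
  shows "(\<lambda>n. f (u n)) \<longlonglongrightarrow> f r"
  using continuous_on_tendsto_compose[OF assms(1,3)] assms(2,4) by (simp add: always_eventually)

context filtered_prob_space
begin

section \<open>Stopped martingales\<close>

lemma stopping_time_set: "stopping_time F S \<Longrightarrow> {\<omega> \<in> space P. S \<omega> \<le> r} \<in> sets (F r)"
  using stopping_timeD[of F S r] by (simp add: pred_def space_F)

text \<open>Rounding up makes the rounded time a stopping time on the grid: whether \<open>S\<close>
  falls into the cell ending at \<open>k / 2 ^ m\<close> is known at that end point. The level
  \<open>0\<close> collects the event \<open>S \<le> 0\<close>, as \<open>nat\<close> maps
  nonpositive ceilings to zero.\<close>

lemma stopping_time_dyadic_level:
  assumes S: "stopping_time F S" and S0: "\<And>\<omega>. \<omega> \<in> space P \<Longrightarrow> 0 \<le> S \<omega>"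
  shows "{\<omega> \<in> space P. nat \<lceil>S \<omega> * 2 ^ m\<rceil> = k} \<in> sets (F (real k / 2 ^ m))"
proof -
  define j where "j \<omega> = nat \<lceil>S \<omega> * 2 ^ m\<rceil>" for \<omega>
  have le: "{\<omega> \<in> space P. j \<omega> \<le> l} = {\<omega> \<in> space P. S \<omega> \<le> real l / 2 ^ m}" for l
    by (auto simp: j_def ceiling_le_iff field_simps nat_le_iff)
  show ?thesis
  proof (cases k)
    case 0
    then show ?thesis using le[of 0] stopping_time_set[OF S, of 0] by (simp add: j_def)
  next
    case (Suc l)
    have "{\<omega> \<in> space P. j \<omega> = k}
      = {\<omega> \<in> space P. S \<omega> \<le> real k / 2 ^ m} - {\<omega> \<in> space P. S \<omega> \<le> real l / 2 ^ m}"
      unfolding le[symmetric] Suc by auto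
    also have "\<dots> \<in> sets (F (real k / 2 ^ m))"
      using stopping_time_set[OF S] sets_F_mono[of "real l / 2 ^ m" "real k / 2 ^ m"]
      by (intro sets.Diff) (auto simp: Suc divide_right_mono)
    finally show ?thesis unfolding j_def .
  qed
qed

text \<open>Stopping is integration of the indicator that \<open>S\<close> has not yet occurred. On
  each cell the integrand is its value at the left end, and the telescoping sum breaks off at the
  first grid point that is not below \<open>S\<close>.\<close>

lemma dyadic_integral_stopping:
  assumes "0 \<le> S \<omega>" "0 \<le> t"
  shows "M 0 \<omega> + dyadic_integral m (\<lambda>k \<omega>. of_bool (real k / 2 ^ m < S \<omega>)) M t \<omega>
    = M (min (dyadic_ceiling m (S \<omega>)) t) \<omega>"
proof -
  define j where "j = nat \<lceil>S \<omega> * 2 ^ m\<rceil>"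
  have kj: "real k / 2 ^ m < S \<omega> \<longleftrightarrow> k < j" for k
  proof -
    have "k < j \<longleftrightarrow> int k < \<lceil>S \<omega> * 2 ^ m\<rceil>" unfolding j_def by linarith
    also have "\<dots> \<longleftrightarrow> real k < S \<omega> * 2 ^ m" by (simp add: less_ceiling_iff)
    finally show ?thesis by (simp add: field_simps)
  qed
  have ind: "(\<Sum>k<n. of_bool (k < j) * dyadic_incr M m k t \<omega>) = M (min (real (min n j) / 2 ^ m) t) \<omega> - M 0 \<omega>" for n
  proof (induction n)
    case 0 then show ?case using assms by simp
  next
    case (Suc n) then show ?case
      by (cases "n < j") (simp_all add: dyadic_incr_def min_absorb1 min_absorb2)
  qed
  obtain n where n: "t * 2 ^ m \<le> real n" using real_arch_simple by blast
  have n': "t \<le> real n / 2 ^ m" using n by (simp add: field_simps)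
  have "min (real (min n j) / 2 ^ m) t = min (real j / 2 ^ m) t"
  proof (cases "j \<le> n")
    case False
    then have "real n / 2 ^ m \<le> real j / 2 ^ m" by (simp add: divide_right_mono)
    then show ?thesis using n' False by simp
  qed simp
  then show ?thesis
    unfolding dyadic_integral_eq[OF n'] kj ind by (simp add: dyadic_ceiling_def j_def)
qed

text \<open>Optional stopping for the excess, with a bound independent of the grid level: on the
  event \<open>A k\<close> the rounded time is \<open>k / 2 ^ m\<close>, and
  \<open>martingale_excess_mono\<close> moves the excess up to \<open>t\<close>. On the remaining
  event \<open>R\<close> the rounded time is at least \<open>t\<close>.\<close>

lemma excess_stopped_le:
  assumes M: "martingale P F M" and S: "stopping_time F S" and S0: "\<And>\<omega>. \<omega> \<in> space P \<Longrightarrow> 0 \<le> S \<omega>"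
    and t: "0 \<le> t" and c: "0 \<le> c"
  shows "(\<integral>\<omega>. max 0 (\<bar>M (min (dyadic_ceiling m (S \<omega>)) t) \<omega>\<bar> - c) \<partial>P) \<le> (\<integral>\<omega>. max 0 (\<bar>M t \<omega>\<bar> - c) \<partial>P)"
proof -
  define j where "j \<omega> = nat \<lceil>S \<omega> * 2 ^ m\<rceil>" for \<omega>
  define A where "A k = {\<omega> \<in> space P. j \<omega> = k}" for k
  have A: "A k \<in> sets (F (real k / 2 ^ m))" for k
    unfolding A_def j_def by (rule stopping_time_dyadic_level[OF S S0])
  obtain n where n: "t * 2 ^ m \<le> real n" using real_arch_simple by blast
  have n': "t \<le> real n / 2 ^ m" using n by (simp add: field_simps)
  let ?\<phi> = "\<lambda>r \<omega>. max 0 (\<bar>M r \<omega>\<bar> - c)"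
  have i\<phi>: "integrable P (?\<phi> r)" if "0 \<le> r" for r
    by (rule Bochner_Integration.integrable_bound[OF martingale_integrable[OF M that]])
       (use c martingale_measurable[OF M that] in auto)
  have iA: "integrable P (\<lambda>\<omega>. indicator (A k) \<omega> * ?\<phi> r \<omega>)" if "0 \<le> r" for r k
    by (rule integrable_indicator_mult[OF i\<phi>[OF that] indicator_F[OF A]])
  define R where "R = space P - (\<Union>k<n. A k)"
  have R: "R \<in> sets P" unfolding R_def using indicator_F[OF A] by auto
  have iR: "integrable P (\<lambda>\<omega>. indicator R \<omega> * ?\<phi> t \<omega>)"
    by (rule integrable_indicator_mult[OF i\<phi>[OF t] R])
  have split: "f (j \<omega>) = (\<Sum>k<n. indicator (A k) \<omega> * f k) + indicator R \<omega> * f (j \<omega>)"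
    if "\<omega> \<in> space P" for f :: "nat \<Rightarrow> real" and \<omega>
  proof (cases "j \<omega> < n")
    case True
    have "(\<Sum>k<n. indicator (A k) \<omega> * f k) = (\<Sum>k<n. if k = j \<omega> then f k else 0)"
      using that by (intro sum.cong) (auto simp: A_def)
    moreover have "indicat_real R \<omega> = 0" using True that by (auto simp: R_def A_def)
    ultimately show ?thesis using True by simp
  next
    case False
    then have "(\<Sum>k<n. indicator (A k) \<omega> * f k) = 0"
      by (intro sum.neutral) (auto simp: A_def)
    moreover have "indicat_real R \<omega> = 1" using False that by (auto simp: R_def A_def)
    ultimately show ?thesis by simp
  qed
  have stay: "min (real (j \<omega>) / 2 ^ m) t = t" if "\<omega> \<in> R" for \<omega>
  proof -
    have "n \<le> j \<omega>" using that by (auto simp: R_def A_def not_less[symmetric])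
    then have "real n / 2 ^ m \<le> real (j \<omega>) / 2 ^ m" by (simp add: divide_right_mono)
    then show ?thesis using n' by simp
  qed
  have "(\<integral>\<omega>. max 0 (\<bar>M (min (dyadic_ceiling m (S \<omega>)) t) \<omega>\<bar> - c) \<partial>P)
    = (\<integral>\<omega>. (\<Sum>k<n. indicator (A k) \<omega> * ?\<phi> (min (real k / 2 ^ m) t) \<omega>) + indicator R \<omega> * ?\<phi> t \<omega> \<partial>P)"
  proof (rule Bochner_Integration.integral_cong[OF refl])
    fix \<omega> assume w: "\<omega> \<in> space P"
    show "max 0 (\<bar>M (min (dyadic_ceiling m (S \<omega>)) t) \<omega>\<bar> - c)
      = (\<Sum>k<n. indicator (A k) \<omega> * ?\<phi> (min (real k / 2 ^ m) t) \<omega>) + indicator R \<omega> * ?\<phi> t \<omega>"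
      using split[OF w, of "\<lambda>k. ?\<phi> (min (real k / 2 ^ m) t) \<omega>"] stay[of \<omega>]
      unfolding dyadic_ceiling_def j_def[symmetric] by (cases "\<omega> \<in> R") auto
  qed
  also have "\<dots> = (\<Sum>k<n. \<integral>\<omega>. indicator (A k) \<omega> * ?\<phi> (min (real k / 2 ^ m) t) \<omega> \<partial>P)
      + (\<integral>\<omega>. indicator R \<omega> * ?\<phi> t \<omega> \<partial>P)"
    by (subst Bochner_Integration.integral_add, intro Bochner_Integration.integrable_sum iA)
       (use iA iR t in \<open>auto intro!: Bochner_Integration.integral_sum simp del: sum_indicator_mult\<close>)
  also have "\<dots> \<le> (\<Sum>k<n. \<integral>\<omega>. indicator (A k) \<omega> * ?\<phi> t \<omega> \<partial>P) + (\<integral>\<omega>. indicator R \<omega> * ?\<phi> t \<omega> \<partial>P)"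
  proof (intro add_right_mono sum_mono)
    fix k
    show "(\<integral>\<omega>. indicator (A k) \<omega> * ?\<phi> (min (real k / 2 ^ m) t) \<omega> \<partial>P) \<le> (\<integral>\<omega>. indicator (A k) \<omega> * ?\<phi> t \<omega> \<partial>P)"
      using martingale_excess_mono[OF M _ _ A c, of k t] by (cases "real k / 2 ^ m \<le> t") auto
  qed
  also have "\<dots> = (\<integral>\<omega>. (\<Sum>k<n. indicator (A k) \<omega> * ?\<phi> t \<omega>) + indicator R \<omega> * ?\<phi> t \<omega> \<partial>P)"
    by (subst Bochner_Integration.integral_add, intro Bochner_Integration.integrable_sum iA)
       (use iA iR t in \<open>auto intro!: Bochner_Integration.integral_sum[symmetric] simp del: sum_indicator_mult\<close>)
  also have "\<dots> = (\<integral>\<omega>. ?\<phi> t \<omega> \<partial>P)"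
    using split[of _ "\<lambda>k. ?\<phi> t _"] by (intro Bochner_Integration.integral_cong) auto
  finally show ?thesis .
qed

text \<open>A modification \<open>Z\<close> is delivered because paths are continuous only almost
  surely, so that the stopped process itself may fail to be adapted. \<open>Z\<close> is the
  \<open>lim\<close> of integrals of the indicators of \<open>k / 2 ^ m < S\<close>, hence adapted;
  the excesses of these integrals are dominated by that of \<open>M t\<close>, which gives
  convergence in L1.\<close>

lemma stopped_martingale:
  assumes M: "martingale P F M" and S: "stopping_time F S" and S0: "\<And>\<omega>. \<omega> \<in> space P \<Longrightarrow> 0 \<le> S \<omega>"
    and cont: "AE \<omega> in P. continuous_on {0..} (\<lambda>t. M t \<omega>)"
  obtains Z where "martingale P F Z" "\<And>t. 0 \<le> t \<Longrightarrow> AE \<omega> in P. Z t \<omega> = M (min t (S \<omega>)) \<omega>"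
proof -
  define H where "H m k \<omega> = (of_bool (real k / 2 ^ m < S \<omega>) :: real)" for m k :: nat and \<omega>
  define Y where "Y m t \<omega> = M 0 \<omega> + dyadic_integral m (H m) M t \<omega>" for m t \<omega>
  define Z where "Z t \<omega> = lim (\<lambda>m. Y m t \<omega>)" for t \<omega>
  have H: "H m k \<in> borel_measurable (F (real k / 2 ^ m))" for m k
    using stopping_timeD2[OF S, of "real k / 2 ^ m"] unfolding H_def by measurable
  have Y: "martingale P F (Y m)" for m
    unfolding Y_def
    by (rule martingale_add[OF martingale_const martingale_dyadic_integral[OF M H, where C="\<lambda>_. 1"]])
       (use martingale_adapted[OF M, of 0] martingale_integrable[OF M, of 0] in \<open>auto simp: H_def\<close>)
  have Y_eq: "Y m t \<omega> = M (min (dyadic_ceiling m (S \<omega>)) t) \<omega>" if "\<omega> \<in> space P" "0 \<le> t" for m t \<omega>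
    unfolding Y_def H_def using dyadic_integral_stopping[of S \<omega> t M m] S0[OF that(1)] that(2) by simp
  have lim: "AE \<omega> in P. (\<lambda>m. Y m t \<omega>) \<longlonglongrightarrow> M (min t (S \<omega>)) \<omega>" if t: "0 \<le> t" for t
    using cont AE_space
  proof eventually_elim
    case (elim \<omega>)
    have "(\<lambda>m. min (dyadic_ceiling m (S \<omega>)) t) \<longlonglongrightarrow> min (S \<omega>) t"
      by (intro tendsto_min dyadic_ceiling_tendsto tendsto_const S0 elim)
    from continuous_on_halfline_tendsto[OF elim(1) _ this]
    have "(\<lambda>m. M (min (dyadic_ceiling m (S \<omega>)) t) \<omega>) \<longlonglongrightarrow> M (min (S \<omega>) t) \<omega>"
      using S0[OF elim(2)] t dyadic_ceiling_bounds(1)[of "S \<omega>"]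
      by (metis min.bounded_iff order_trans)
    then show ?case using Y_eq[OF elim(2) t] by (simp add: min.commute)
  qed
  have Z_eq: "AE \<omega> in P. Z t \<omega> = M (min t (S \<omega>)) \<omega>" if "0 \<le> t" for t
    using lim[OF that] unfolding Z_def by eventually_elim (rule limI)
  have ZF: "Z t \<in> borel_measurable (F t)" if "0 \<le> t" for t
    unfolding Z_def using martingale_adapted[OF Y that] by measurable
  have L: "integrable P (Z t) \<and> (\<lambda>m. \<integral>\<omega>. \<bar>Y m t \<omega> - Z t \<omega>\<bar> \<partial>P) \<longlonglongrightarrow> 0" if t: "0 \<le> t" for t
  proof -
    have ae: "AE \<omega> in P. (\<lambda>n. Y n t \<omega>) \<longlonglongrightarrow> Z t \<omega>" using lim[OF t] Z_eq[OF t] by eventually_elim simp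
    have le: "(\<integral>\<omega>. max 0 (\<bar>Y n t \<omega>\<bar> - c) \<partial>P) \<le> (\<integral>\<omega>. max 0 (\<bar>M t \<omega>\<bar> - c) \<partial>P)" if "0 \<le> c" for n c
    proof -
      have "(\<integral>\<omega>. max 0 (\<bar>Y n t \<omega>\<bar> - c) \<partial>P)
         = (\<integral>\<omega>. max 0 (\<bar>M (min (dyadic_ceiling n (S \<omega>)) t) \<omega>\<bar> - c) \<partial>P)"
        using Y_eq[OF _ t] by (intro Bochner_Integration.integral_cong) auto
      then show ?thesis using excess_stopped_le[OF M S S0 t that] by simp
    qed
    show ?thesis
      using L1_convergence_excess[OF martingale_integrable[OF Y t] measurable_F[OF ZF[OF t]] ae
          martingale_integrable[OF M t] le] by simp
  qed
  have "martingale P F Z"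
    using L by (intro martingale_L1_limit[where M=Y, OF Y ZF]) auto
  then show ?thesis using that Z_eq by blast
qed

end

section \<open>Bounded martingales\<close>

context prob_space
begin

text \<open>By monotone convergence the sum of the absolute differences is integrable. It is finite
  almost surely, which gives convergence, and together with \<open>Z 0\<close> it dominates the
  whole sequence.\<close>

lemma summable_L1_differences:
  fixes Z :: "nat \<Rightarrow> 'a \<Rightarrow> real"
  assumes Z: "\<And>n. integrable M (Z n)"
    and S: "summable (\<lambda>n. \<integral>\<omega>. \<bar>Z (Suc n) \<omega> - Z n \<omega>\<bar> \<partial>M)"
  shows "AE \<omega> in M. (\<lambda>n. Z n \<omega>) \<longlonglongrightarrow> lim (\<lambda>n. Z n \<omega>)"
    and "integrable M (\<lambda>\<omega>. lim (\<lambda>n. Z n \<omega>))"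
    and "(\<lambda>n. \<integral>\<omega>. \<bar>Z n \<omega> - lim (\<lambda>n. Z n \<omega>)\<bar> \<partial>M) \<longlonglongrightarrow> 0"
proof -
  define f where "f n \<omega> = \<bar>Z (Suc n) \<omega> - Z n \<omega>\<bar>" for n \<omega>
  have f: "integrable M (f n)" for n unfolding f_def using Z by auto
  have [measurable]: "Z n \<in> borel_measurable M" "f n \<in> borel_measurable M" for n using Z f by auto
  have "(\<integral>\<^sup>+\<omega>. (\<Sum>n. ennreal (f n \<omega>)) \<partial>M) = (\<Sum>n. \<integral>\<^sup>+\<omega>. ennreal (f n \<omega>) \<partial>M)"
    by (rule nn_integral_suminf) simp
  also have "\<dots> = (\<Sum>n. ennreal (\<integral>\<omega>. f n \<omega> \<partial>M))"
    by (subst nn_integral_eq_integral[OF f]) (auto simp: f_def)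
  also have "\<dots> = ennreal (\<Sum>n. \<integral>\<omega>. f n \<omega> \<partial>M)"
    using S by (intro suminf_ennreal2) (auto simp: f_def)
  finally have "(\<integral>\<^sup>+\<omega>. (\<Sum>n. ennreal (f n \<omega>)) \<partial>M) \<noteq> \<infinity>" by simp
  then have "AE \<omega> in M. (\<Sum>n. ennreal (f n \<omega>)) \<noteq> \<infinity>"
    by (intro nn_integral_PInf_AE) auto
  then have sf: "AE \<omega> in M. summable (\<lambda>n. f n \<omega>)"
    by eventually_elim (auto intro!: summable_suminf_not_top simp: f_def)
  have W: "integrable M (\<lambda>\<omega>. \<Sum>n. f n \<omega>)"
    by (rule integrable_suminf[OF f]) (use sf S in \<open>auto simp: f_def\<close>)
  have bnd: "\<bar>Z n \<omega>\<bar> \<le> \<bar>Z 0 \<omega>\<bar> + (\<Sum>n. f n \<omega>)" if "summable (\<lambda>n. f n \<omega>)" for n \<omega>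
  proof -
    have "\<bar>Z n \<omega>\<bar> \<le> \<bar>Z 0 \<omega>\<bar> + (\<Sum>i<n. f i \<omega>)"
      by (induction n) (auto simp: f_def)
    also have "(\<Sum>i<n. f i \<omega>) \<le> (\<Sum>n. f n \<omega>)"
      using that by (intro sum_le_suminf) (auto simp: f_def)
    finally show ?thesis by simp
  qed
  have conv: "(\<lambda>n. Z n \<omega>) \<longlonglongrightarrow> lim (\<lambda>n. Z n \<omega>)" if "summable (\<lambda>n. f n \<omega>)" for \<omega>
  proof -
    have "summable (\<lambda>n. Z (Suc n) \<omega> - Z n \<omega>)"
      by (rule summable_rabs_cancel) (use that in \<open>simp add: f_def\<close>)
    then have "convergent (\<lambda>n. (\<Sum>i<n. Z (Suc i) \<omega> - Z i \<omega>) + Z 0 \<omega>)"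
      by (intro convergent_add convergent_const) (simp add: summable_iff_convergent)
    moreover have "(\<Sum>i<n. Z (Suc i) \<omega> - Z i \<omega>) = Z n \<omega> - Z 0 \<omega>" for n
      by (rule sum_lessThan_telescope[where f="\<lambda>n. Z n \<omega>"])
    ultimately have "convergent (\<lambda>n. Z n \<omega>)" by simp
    then show ?thesis by (simp add: convergent_LIMSEQ_iff)
  qed
  show c: "AE \<omega> in M. (\<lambda>n. Z n \<omega>) \<longlonglongrightarrow> lim (\<lambda>n. Z n \<omega>)" using sf conv by auto
  let ?w = "\<lambda>\<omega>. \<bar>Z 0 \<omega>\<bar> + (\<Sum>n. f n \<omega>)"
  have w: "integrable M ?w" using Z W by auto
  have lb: "\<bar>lim (\<lambda>n. Z n \<omega>)\<bar> \<le> ?w \<omega>" if "summable (\<lambda>n. f n \<omega>)" for \<omega>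
    using tendsto_rabs[OF conv[OF that]] bnd[OF that] by (intro LIMSEQ_le_const2) auto
  show I: "integrable M (\<lambda>\<omega>. lim (\<lambda>n. Z n \<omega>))"
    by (rule Bochner_Integration.integrable_bound[OF w], measurable)
       (use sf lb in \<open>auto elim!: eventually_mono intro: order_trans[OF _ abs_ge_self]\<close>)
  have "(\<lambda>n. \<integral>\<omega>. \<bar>Z n \<omega> - lim (\<lambda>n. Z n \<omega>)\<bar> \<partial>M) \<longlonglongrightarrow> (\<integral>\<omega>. 0 \<partial>M)"
  proof (rule integral_dominated_convergence[where w="\<lambda>\<omega>. 2 * ?w \<omega>"])
    show "AE \<omega> in M. (\<lambda>n. \<bar>Z n \<omega> - lim (\<lambda>n. Z n \<omega>)\<bar>) \<longlonglongrightarrow> 0"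
      using c by eventually_elim (auto intro!: tendsto_rabs_zero LIM_zero)
    show "AE \<omega> in M. norm \<bar>Z n \<omega> - lim (\<lambda>n. Z n \<omega>)\<bar> \<le> 2 * ?w \<omega>" for n
      using sf
    proof eventually_elim
      case (elim \<omega>)
      show ?case using bnd[OF elim, of n] lb[OF elim] by simp
    qed
    show "integrable M (\<lambda>\<omega>. 2 * ?w \<omega>)" by (rule integrable_mult_right[OF w])
  qed auto
  then show "(\<lambda>n. \<integral>\<omega>. \<bar>Z n \<omega> - lim (\<lambda>n. Z n \<omega>)\<bar> \<partial>M) \<longlonglongrightarrow> 0" by simp
qed

text \<open>The Cauchy-Schwarz inequality on a probability space, obtained from
  \<open>2 * \<delta> * \<bar>W\<bar> \<le> W^2 + \<delta>^2\<close>.\<close>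

lemma integral_abs_le_square:
  fixes W :: "'a \<Rightarrow> real"
  assumes W: "integrable M W" "integrable M (\<lambda>\<omega>. (W \<omega>)\<^sup>2)" and d: "0 < \<delta>"
    and le: "(\<integral>\<omega>. (W \<omega>)\<^sup>2 \<partial>M) \<le> \<delta>\<^sup>2"
  shows "(\<integral>\<omega>. \<bar>W \<omega>\<bar> \<partial>M) \<le> \<delta>"
proof -
  have "(\<integral>\<omega>. \<bar>W \<omega>\<bar> \<partial>M) \<le> (\<integral>\<omega>. (W \<omega>)\<^sup>2 / (2 * \<delta>) + \<delta> / 2 \<partial>M)"
  proof (rule integral_mono)
    fix \<omega>
    have "0 \<le> (\<bar>W \<omega>\<bar> - \<delta>)\<^sup>2" by simp
    then have "2 * \<delta> * \<bar>W \<omega>\<bar> \<le> (W \<omega>)\<^sup>2 + \<delta>\<^sup>2" by (simp add: power2_diff mult.commute mult.left_commute)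
    then show "\<bar>W \<omega>\<bar> \<le> (W \<omega>)\<^sup>2 / (2 * \<delta>) + \<delta> / 2"
      using d by (simp add: field_simps power2_eq_square)
  qed (use W in auto)
  also have "\<dots> = (\<integral>\<omega>. (W \<omega>)\<^sup>2 \<partial>M) / (2 * \<delta>) + \<delta> / 2" using W by (simp add: prob_space)
  also have "\<dots> \<le> \<delta>\<^sup>2 / (2 * \<delta>) + \<delta> / 2" using le d by (intro add_right_mono divide_right_mono) auto
  also have "\<dots> = \<delta>" using d by (simp add: power2_eq_square)
  finally show ?thesis .
qed

end

context filtered_prob_space
begin

lemma integrable_bounded:
  fixes f :: "'w \<Rightarrow> real"
  assumes "f \<in> borel_measurable P" "\<And>\<omega>. \<omega> \<in> space P \<Longrightarrow> \<bar>f \<omega>\<bar> \<le> C"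
  shows "integrable P f"
  by (rule integrable_const_bound[where B=C]) (use assms in auto)

text \<open>Increments are orthogonal to the past: the cross term of the expanded square carries the
  factor \<open>H * M s\<close>, known at time \<open>s\<close>, and there \<open>M t\<close> may be
  replaced by \<open>M s\<close>.\<close>

lemma martingale_square_increment:
  assumes M: "martingale P F M" and st: "0 \<le> s" "s \<le> t"
    and K: "\<And>t \<omega>. 0 \<le> t \<Longrightarrow> \<omega> \<in> space P \<Longrightarrow> \<bar>M t \<omega>\<bar> \<le> K"
    and H: "H \<in> borel_measurable (F s)" and C: "\<And>\<omega>. \<omega> \<in> space P \<Longrightarrow> \<bar>H \<omega>\<bar> \<le> C"
  shows "(\<integral>\<omega>. H \<omega> * (M t \<omega> - M s \<omega>)\<^sup>2 \<partial>P) = (\<integral>\<omega>. H \<omega> * ((M t \<omega>)\<^sup>2 - (M s \<omega>)\<^sup>2) \<partial>P)"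
proof -
  have t: "0 \<le> t" using st by simp
  have [measurable]: "H \<in> borel_measurable P" "M t \<in> borel_measurable P" "M s \<in> borel_measurable P"
    using measurable_F[OF H] martingale_measurable[OF M] st(1) t by auto
  have 1: "integrable P (\<lambda>\<omega>. H \<omega> * (M a \<omega> * M b \<omega>))" if "a \<in> {s, t}" "b \<in> {s, t}" for a b
  proof (rule integrable_bounded[where C="C * (K * K)"])
    fix \<omega> assume w: "\<omega> \<in> space P"
    show "\<bar>H \<omega> * (M a \<omega> * M b \<omega>)\<bar> \<le> C * (K * K)"
      unfolding abs_mult using that st t
      by (intro mult_mono K C w mult_nonneg_nonneg abs_ge_zero order_trans[OF abs_ge_zero C[OF w]]
          order_trans[OF abs_ge_zero K[OF t w]]) auto
  qed (use that in auto)
  have "(\<integral>\<omega>. H \<omega> * M s \<omega> * M t \<omega> \<partial>P) = (\<integral>\<omega>. H \<omega> * M s \<omega> * M s \<omega> \<partial>P)"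
    by (rule martingale_mult(2)[OF M st])
       (use 1[of s t] H martingale_adapted[OF M st(1)] in \<open>auto simp: mult.assoc\<close>)
  then have e: "(\<integral>\<omega>. H \<omega> * (M s \<omega> * M t \<omega>) \<partial>P) = (\<integral>\<omega>. H \<omega> * (M s \<omega> * M s \<omega>) \<partial>P)"
    by (simp add: mult.assoc)
  have "(\<integral>\<omega>. H \<omega> * (M t \<omega> - M s \<omega>)\<^sup>2 \<partial>P)
    = (\<integral>\<omega>. H \<omega> * (M t \<omega> * M t \<omega>) - 2 * (H \<omega> * (M s \<omega> * M t \<omega>)) + H \<omega> * (M s \<omega> * M s \<omega>) \<partial>P)"
    by (intro Bochner_Integration.integral_cong) (auto simp: power2_eq_square algebra_simps)
  also have "\<dots> = (\<integral>\<omega>. H \<omega> * (M t \<omega> * M t \<omega>) \<partial>P) - (\<integral>\<omega>. H \<omega> * (M s \<omega> * M s \<omega>) \<partial>P)"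
    using 1[of s t] 1[of s s] 1[of t t] e by simp
  also have "\<dots> = (\<integral>\<omega>. H \<omega> * (M t \<omega> * M t \<omega>) - H \<omega> * (M s \<omega> * M s \<omega>) \<partial>P)"
    using 1[of s s] 1[of t t] by simp
  also have "\<dots> = (\<integral>\<omega>. H \<omega> * ((M t \<omega>)\<^sup>2 - (M s \<omega>)\<^sup>2) \<partial>P)"
    by (intro Bochner_Integration.integral_cong) (auto simp: power2_eq_square algebra_simps)
  finally show ?thesis .
qed

text \<open>Second moments of a bounded martingale increase to a limit, and by orthogonality of
  increments their differences are squared L2 distances. A rapidly converging subsequence of times
  is chosen; almost sure convergence along it suffices to locate the values of
  \<open>Z\<close>.\<close>

lemma bounded_martingale_closed:
  assumes M: "martingale P F M" and K: "\<And>t \<omega>. 0 \<le> t \<Longrightarrow> \<omega> \<in> space P \<Longrightarrow> \<bar>M t \<omega>\<bar> \<le> K"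
  obtains Z and r :: "nat \<Rightarrow> real" where "Z \<in> borel_measurable P" "integrable P Z"
    "AE \<omega> in P. (\<lambda>n. M (r n) \<omega>) \<longlonglongrightarrow> Z \<omega>"
    "\<And>t A. 0 \<le> t \<Longrightarrow> A \<in> sets (F t) \<Longrightarrow> (\<integral>\<omega>. indicator A \<omega> * Z \<omega> \<partial>P) = (\<integral>\<omega>. indicator A \<omega> * M t \<omega> \<partial>P)"
proof -
  have [measurable]: "M (real n) \<in> borel_measurable P" for n using martingale_measurable[OF M] by simp
  have sqb: "(M (real n) \<omega>)\<^sup>2 \<le> K\<^sup>2" if "\<omega> \<in> space P" for n \<omega>
    using K[OF _ that, of "real n"] by (intro abs_le_square_iff[THEN iffD1]) auto
  have sqi: "integrable P (\<lambda>\<omega>. (M (real n) \<omega>)\<^sup>2)" for n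
    by (rule integrable_bounded[where C="K\<^sup>2"]) (use sqb in auto)
  define a where "a n = (\<integral>\<omega>. (M (real n) \<omega>)\<^sup>2 \<partial>P)" for n
  have diff: "(\<integral>\<omega>. (M (real n) \<omega> - M (real m) \<omega>)\<^sup>2 \<partial>P) = a n - a m" if "m \<le> n" for m n
    using martingale_square_increment[OF M _ _ K, of "real m" "real n" "\<lambda>_. 1" 1] that sqi
    by (simp add: a_def)
  have a_mono: "incseq a"
  proof (rule incseq_SucI)
    fix n
    have "0 \<le> (\<integral>\<omega>. (M (real (Suc n)) \<omega> - M (real n) \<omega>)\<^sup>2 \<partial>P)" by (intro integral_nonneg_AE) auto
    also have "\<dots> = a (Suc n) - a n" by (rule diff) simp
    finally show "a n \<le> a (Suc n)" by simp
  qed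
  have "a n \<le> K\<^sup>2" for n
  proof -
    have "a n \<le> (\<integral>\<omega>. K\<^sup>2 \<partial>P)" unfolding a_def by (rule integral_mono) (use sqi sqb in auto)
    then show ?thesis by (simp add: prob_space)
  qed
  then obtain L where L: "a \<longlonglongrightarrow> L" using incseq_convergent[OF a_mono, of "K\<^sup>2"] by blast
  \<comment> \<open>Two errors of \<open>(1 / 4) ^ k / 2\<close> bound the squared L2 distance by
    \<open>(1 / 4) ^ k\<close>, hence the L1 distance by the summable \<open>(1 / 2) ^ k\<close>.
    The condition \<open>N \<ge> k\<close> makes the times unbounded.\<close>
  have "\<exists>N\<ge>k. \<forall>n\<ge>N. \<bar>a n - L\<bar> < (1 / 4) ^ k / 2" for k :: nat
  proof -
    obtain N where N: "\<And>n. n \<ge> N \<Longrightarrow> norm (a n - L) < (1 / 4) ^ k / 2"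
      using LIMSEQ_D[OF L, of "(1 / 4) ^ k / 2"] by auto
    show ?thesis by (rule exI[of _ "max N k"]) (use N in auto)
  qed
  then obtain N where N: "\<And>k. N k \<ge> k" "\<And>k n. n \<ge> N k \<Longrightarrow> \<bar>a n - L\<bar> < (1 / 4) ^ k / 2"
    by metis
  \<comment> \<open>Partial sums turn the indices \<open>N k\<close> into a monotone sequence that
    still dominates them.\<close>
  define r where "r k = (\<Sum>i\<le>k. N i)" for k :: nat
  have rN: "r k \<ge> N k" for k unfolding r_def by (rule member_le_sum) auto
  have rS: "r k \<le> r (Suc k)" for k unfolding r_def by simp
  have step: "(\<integral>\<omega>. \<bar>M (real (r (Suc k))) \<omega> - M (real (r k)) \<omega>\<bar> \<partial>P) \<le> (1 / 2) ^ k" for k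
  proof (rule integral_abs_le_square)
    have "(\<integral>\<omega>. (M (real (r (Suc k))) \<omega> - M (real (r k)) \<omega>)\<^sup>2 \<partial>P) = a (r (Suc k)) - a (r k)"
      by (rule diff[OF rS])
    also have "\<dots> \<le> (1 / 4) ^ k"
      using N(2)[of k "r (Suc k)"] N(2)[of k "r k"] rN[of k] rS[of k] by linarith
    also have "\<dots> = ((1 / 2) ^ k)\<^sup>2" by (simp add: power_mult_distrib[symmetric] power2_eq_square)
    finally show "(\<integral>\<omega>. (M (real (r (Suc k))) \<omega> - M (real (r k)) \<omega>)\<^sup>2 \<partial>P) \<le> ((1 / 2) ^ k)\<^sup>2" .
    show "integrable P (\<lambda>\<omega>. (M (real (r (Suc k))) \<omega> - M (real (r k)) \<omega>)\<^sup>2)"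
    proof (rule integrable_bounded[where C="(2 * K)\<^sup>2"])
      fix \<omega> assume "\<omega> \<in> space P"
      then have "\<bar>M (real (r (Suc k))) \<omega> - M (real (r k)) \<omega>\<bar> \<le> \<bar>2 * K\<bar>"
        using K[of "real (r (Suc k))" \<omega>] K[of "real (r k)" \<omega>] by simp
      then show "\<bar>(M (real (r (Suc k))) \<omega> - M (real (r k)) \<omega>)\<^sup>2\<bar> \<le> (2 * K)\<^sup>2"
        by (simp add: abs_le_square_iff)
    qed auto
  qed (use martingale_integrable[OF M] in auto)
  define Z where "Z \<omega> = lim (\<lambda>k. M (real (r k)) \<omega>)" for \<omega>
  have S: "summable (\<lambda>k. \<integral>\<omega>. \<bar>M (real (r (Suc k))) \<omega> - M (real (r k)) \<omega>\<bar> \<partial>P)"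
    by (rule summable_comparison_test'[of "\<lambda>k. (1 / 2) ^ k" 0])
       (use step in \<open>auto intro!: integral_nonneg_AE summable_geometric simp: abs_of_nonneg\<close>)
  note lims = summable_L1_differences[OF martingale_integrable[OF M of_nat_0_le_iff] S, folded Z_def]
  show ?thesis
  proof (rule that[of Z "\<lambda>k. real (r k)"])
    fix t :: real and A assume t: "0 \<le> t" and A: "A \<in> sets (F t)"
    have AP: "A \<in> sets P" using indicator_F[OF A] .
    have "(\<lambda>k. \<integral>\<omega>. indicator A \<omega> * M (real (r k)) \<omega> \<partial>P) \<longlonglongrightarrow> (\<integral>\<omega>. indicator A \<omega> * Z \<omega> \<partial>P)"
    proof (rule LIM_zero_cancel, rule Lim_null_comparison[OF _ lims(3)], rule always_eventually, rule allI)
      fix k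
      have i: "integrable P (M (real (r k)))" "integrable P Z" using martingale_integrable[OF M] lims(2) by auto
      note i' = integrable_indicator_mult[OF i(1) AP] integrable_indicator_mult[OF i(2) AP]
      have "(\<integral>\<omega>. indicator A \<omega> * M (real (r k)) \<omega> \<partial>P) - (\<integral>\<omega>. indicator A \<omega> * Z \<omega> \<partial>P)
         = (\<integral>\<omega>. indicator A \<omega> * (M (real (r k)) \<omega> - Z \<omega>) \<partial>P)"
        using i' by (simp add: right_diff_distrib)
      also have "norm \<dots> \<le> (\<integral>\<omega>. norm (indicator A \<omega> * (M (real (r k)) \<omega> - Z \<omega>)) \<partial>P)"
        by (rule integral_norm_bound)
      also have "\<dots> \<le> (\<integral>\<omega>. \<bar>M (real (r k)) \<omega> - Z \<omega>\<bar> \<partial>P)"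
        by (rule integral_mono) (use i i' in \<open>auto simp: right_diff_distrib split: split_indicator\<close>)
      finally show "norm ((\<integral>\<omega>. indicator A \<omega> * M (real (r k)) \<omega> \<partial>P) - (\<integral>\<omega>. indicator A \<omega> * Z \<omega> \<partial>P))
        \<le> (\<integral>\<omega>. \<bar>M (real (r k)) \<omega> - Z \<omega>\<bar> \<partial>P)" .
    qed
    moreover have "(\<lambda>k. \<integral>\<omega>. indicator A \<omega> * M (real (r k)) \<omega> \<partial>P) \<longlonglongrightarrow> (\<integral>\<omega>. indicator A \<omega> * M t \<omega> \<partial>P)"
    proof (rule tendsto_eventually, rule eventually_sequentiallyI)
      fix k assume "k \<ge> nat \<lceil>t\<rceil>"
      then have "t \<le> real k" by linarith
      also have "real k \<le> real (r k)" using N(1)[of k] rN[of k] by simp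
      finally show "(\<integral>\<omega>. indicator A \<omega> * M (real (r k)) \<omega> \<partial>P) = (\<integral>\<omega>. indicator A \<omega> * M t \<omega> \<partial>P)"
        by (rule martingale_set[OF M t _ A])
    qed
    ultimately show "(\<integral>\<omega>. indicator A \<omega> * Z \<omega> \<partial>P) = (\<integral>\<omega>. indicator A \<omega> * M t \<omega> \<partial>P)"
      by (rule LIMSEQ_unique)
  qed (use lims in auto)
qed

section \<open>Partition sums of squared increments\<close>

definition square_sum :: "(real \<Rightarrow> 'w \<Rightarrow> real) \<Rightarrow> (nat \<Rightarrow> real) \<Rightarrow> nat \<Rightarrow> 'w \<Rightarrow> real" where
  "square_sum M u n \<omega> = (\<Sum>k<n. (M (u (Suc k)) \<omega> - M (u k) \<omega>)\<^sup>2)"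

text \<open>The bound does not depend on the partition. The squared sum is twice the sum of
  \<open>?S k * d k\<close> plus the sum of \<open>d k * d k\<close>. In the first, orthogonality
  replaces \<open>d k\<close> by an increment of the squared martingale, and Abel summation leaves
  at most \<open>K^2\<close> times the mean of the square sum, itself at most \<open>K^2\<close>; in
  the second, \<open>d k \<le> 4 * K^2\<close>. Together this is
  \<open>2 * K^4 + 4 * K^4\<close>.\<close>

lemma square_sum_second_moment:
  assumes M: "martingale P F M" and K: "\<And>t \<omega>. 0 \<le> t \<Longrightarrow> \<omega> \<in> space P \<Longrightarrow> \<bar>M t \<omega>\<bar> \<le> K"
    and u: "incseq u" "0 \<le> u 0"
  shows "(\<integral>\<omega>. (square_sum M u n \<omega>)\<^sup>2 \<partial>P) \<le> 6 * K ^ 4"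
    and "square_sum M u n \<in> borel_measurable (F (u n))"
    and "\<And>\<omega>. \<omega> \<in> space P \<Longrightarrow> \<bar>square_sum M u n \<omega>\<bar> \<le> real n * (4 * K\<^sup>2)"
proof -
  let ?S = "square_sum M u"
  define d where "d k \<omega> = (M (u (Suc k)) \<omega> - M (u k) \<omega>)\<^sup>2" for k \<omega>
  have u0: "0 \<le> u k" for k using u(2) incseqD[OF u(1), of 0 k] by simp
  have uS: "u k \<le> u (Suc k)" for k using incseqD[OF u(1), of k "Suc k"] by simp
  have S: "?S n \<omega> = (\<Sum>k<n. d k \<omega>)" for n \<omega> unfolding square_sum_def d_def ..
  have [measurable]: "M (u k) \<in> borel_measurable P" for k using martingale_measurable[OF M u0] .
  have dm[measurable]: "d k \<in> borel_measurable P" for k unfolding d_def by measurable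
  have SF: "?S n \<in> borel_measurable (F (u n))" for n
    unfolding square_sum_def
    by (intro borel_measurable_sum borel_measurable_power borel_measurable_diff
        measurable_F_mono[OF martingale_adapted[OF M u0]] incseqD[OF u(1)]) auto
  then show "?S n \<in> borel_measurable (F (u n))" .
  have Sm[measurable]: "?S n \<in> borel_measurable P" for n using measurable_F[OF SF] .
  have d0: "0 \<le> d k \<omega>" for k \<omega> by (simp add: d_def)
  have db: "d k \<omega> \<le> 4 * K\<^sup>2" if "\<omega> \<in> space P" for k \<omega>
  proof -
    have "\<bar>M (u (Suc k)) \<omega> - M (u k) \<omega>\<bar> \<le> \<bar>2 * K\<bar>"
      using K[OF u0[of "Suc k"] that] K[OF u0[of k] that] by simp
    then have "d k \<omega> \<le> (2 * K)\<^sup>2" unfolding d_def by (simp add: abs_le_square_iff)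
    then show ?thesis by (simp add: power2_eq_square)
  qed
  have S0: "0 \<le> ?S n \<omega>" for n \<omega> unfolding S using d0 by (simp add: sum_nonneg)
  have Sb: "\<bar>?S n \<omega>\<bar> \<le> real n * (4 * K\<^sup>2)" if "\<omega> \<in> space P" for n \<omega>
    using sum_bounded_above[of "{..<n}" "\<lambda>k. d k \<omega>" "4 * K\<^sup>2"] db[OF that] S0[of n \<omega>] by (simp add: S)
  then show "\<And>\<omega>. \<omega> \<in> space P \<Longrightarrow> \<bar>square_sum M u n \<omega>\<bar> \<le> real n * (4 * K\<^sup>2)" .
  define Q where "Q k \<omega> = (M (u k) \<omega>)\<^sup>2" for k \<omega>
  have Q_eq: "Q k = (\<lambda>\<omega>. (M (u k) \<omega>)\<^sup>2)" for k by (auto simp: Q_def)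
  have [measurable]: "Q k \<in> borel_measurable P" for k unfolding Q_def by measurable
  have Qb: "0 \<le> Q k \<omega>" "Q k \<omega> \<le> K\<^sup>2" if "\<omega> \<in> space P" for k \<omega>
    using K[OF u0 that, of k] unfolding Q_def by (auto simp: abs_le_square_iff[symmetric])
  have bI: "integrable P (\<lambda>\<omega>. f \<omega> * g \<omega>)"
    if "f \<in> borel_measurable P" "g \<in> borel_measurable P" "\<And>\<omega>. \<omega> \<in> space P \<Longrightarrow> \<bar>f \<omega>\<bar> \<le> B" "\<And>\<omega>. \<omega> \<in> space P \<Longrightarrow> \<bar>g \<omega>\<bar> \<le> C"
    for f g :: "'w \<Rightarrow> real" and B C
    by (rule integrable_bounded_mult[OF integrable_bounded]) (use that in auto)
  have absQ: "\<bar>Q k \<omega>\<bar> \<le> K\<^sup>2" if "\<omega> \<in> space P" for k \<omega> using Qb[OF that] by simp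
  have absd: "\<bar>d k \<omega>\<bar> \<le> 4 * K\<^sup>2" if "\<omega> \<in> space P" for k \<omega> using db[OF that, of k] d0[of k \<omega>] by simp
  have ID: "integrable P (d k)" "integrable P (?S k)" "integrable P (Q k)" for k
    by (rule integrable_bounded[OF dm absd], simp, rule integrable_bounded[OF Sm Sb], simp,
        rule integrable_bounded[OF _ absQ], auto)
  have ISd: "integrable P (\<lambda>\<omega>. ?S k \<omega> * d l \<omega>)" for k l by (rule bI[OF Sm dm Sb absd])
  have ISQ: "integrable P (\<lambda>\<omega>. ?S k \<omega> * Q l \<omega>)" for k l by (rule bI[OF Sm _ Sb absQ]) auto
  have IdQ: "integrable P (\<lambda>\<omega>. d k \<omega> * Q l \<omega>)" for k l by (rule bI[OF dm _ absd absQ]) auto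
  have Idd: "integrable P (\<lambda>\<omega>. d k \<omega> * d l \<omega>)" for k l by (rule bI[OF dm dm absd absd])
  have ES: "(\<integral>\<omega>. ?S n \<omega> \<partial>P) \<le> K\<^sup>2"
  proof -
    have "(\<integral>\<omega>. d k \<omega> \<partial>P) = (\<integral>\<omega>. Q (Suc k) \<omega> \<partial>P) - (\<integral>\<omega>. Q k \<omega> \<partial>P)" for k
      using martingale_square_increment[OF M u0[of k] uS[of k], where K=K and H="\<lambda>_. 1" and C=1]
        K ID(3)[of k] ID(3)[of "Suc k"]
      by (simp add: d_def Q_eq)
    then have "(\<integral>\<omega>. ?S n \<omega> \<partial>P) = (\<Sum>k<n. (\<integral>\<omega>. Q (Suc k) \<omega> \<partial>P) - (\<integral>\<omega>. Q k \<omega> \<partial>P))"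
      unfolding S using ID(1) by (subst Bochner_Integration.integral_sum) auto
    also have "\<dots> = (\<integral>\<omega>. Q n \<omega> \<partial>P) - (\<integral>\<omega>. Q 0 \<omega> \<partial>P)"
      by (rule sum_lessThan_telescope[where f="\<lambda>k. \<integral>\<omega>. Q k \<omega> \<partial>P"])
    also have "\<dots> \<le> (\<integral>\<omega>. Q n \<omega> \<partial>P)" using Qb by (simp add: integral_nonneg_AE)
    also have "\<dots> \<le> (\<integral>\<omega>. K\<^sup>2 \<partial>P)" by (rule integral_mono) (use ID Qb in auto)
    finally show ?thesis by (simp add: prob_space)
  qed
  have abel: "(\<Sum>k<n. ?S k \<omega> * (Q (Suc k) \<omega> - Q k \<omega>)) = ?S n \<omega> * Q n \<omega> - (\<Sum>k<n. d k \<omega> * Q (Suc k) \<omega>)" for \<omega>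
    by (induction n) (auto simp: S algebra_simps)
  have square: "(?S n \<omega>)\<^sup>2 = 2 * (\<Sum>k<n. ?S k \<omega> * d k \<omega>) + (\<Sum>k<n. d k \<omega> * d k \<omega>)" for \<omega>
    by (induction n) (auto simp: S power2_eq_square algebra_simps)
  have "(\<integral>\<omega>. (\<Sum>k<n. ?S k \<omega> * d k \<omega>) \<partial>P) = (\<Sum>k<n. \<integral>\<omega>. ?S k \<omega> * d k \<omega> \<partial>P)"
    using ISd by (intro Bochner_Integration.integral_sum) auto
  also have "\<dots> = (\<Sum>k<n. \<integral>\<omega>. ?S k \<omega> * (Q (Suc k) \<omega> - Q k \<omega>) \<partial>P)"
    unfolding d_def Q_def by (intro sum.cong refl martingale_square_increment[OF M u0 uS K SF Sb])
  also have "\<dots> = (\<integral>\<omega>. (\<Sum>k<n. ?S k \<omega> * (Q (Suc k) \<omega> - Q k \<omega>)) \<partial>P)"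
    using ISQ by (intro Bochner_Integration.integral_sum[symmetric]) (auto simp: right_diff_distrib)
  also have "\<dots> \<le> (\<integral>\<omega>. ?S n \<omega> * Q n \<omega> \<partial>P)"
    unfolding abel
  proof (rule integral_mono)
    fix \<omega> assume w: "\<omega> \<in> space P"
    have "0 \<le> (\<Sum>k<n. d k \<omega> * Q (Suc k) \<omega>)" using d0 Qb[OF w] by (intro sum_nonneg) auto
    then show "?S n \<omega> * Q n \<omega> - (\<Sum>k<n. d k \<omega> * Q (Suc k) \<omega>) \<le> ?S n \<omega> * Q n \<omega>" by simp
  qed (use ISQ IdQ in auto)
  also have "\<dots> \<le> (\<integral>\<omega>. ?S n \<omega> * K\<^sup>2 \<partial>P)"
    by (rule integral_mono) (use ISQ ID Qb S0 in \<open>auto intro!: mult_left_mono\<close>)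
  also have "\<dots> = (\<integral>\<omega>. ?S n \<omega> \<partial>P) * K\<^sup>2" by simp
  also have "\<dots> \<le> K\<^sup>2 * K\<^sup>2" using ES by (intro mult_right_mono) auto
  finally have 1: "(\<integral>\<omega>. (\<Sum>k<n. ?S k \<omega> * d k \<omega>) \<partial>P) \<le> K\<^sup>2 * K\<^sup>2" .
  have "(\<integral>\<omega>. (\<Sum>k<n. d k \<omega> * d k \<omega>) \<partial>P) \<le> (\<integral>\<omega>. 4 * K\<^sup>2 * ?S n \<omega> \<partial>P)"
  proof (rule integral_mono)
    fix \<omega> assume w: "\<omega> \<in> space P"
    show "(\<Sum>k<n. d k \<omega> * d k \<omega>) \<le> 4 * K\<^sup>2 * ?S n \<omega>"
      unfolding S sum_distrib_left using db[OF w] d0 by (intro sum_mono mult_right_mono) auto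
  qed (use Idd ID in auto)
  also have "\<dots> \<le> 4 * K\<^sup>2 * K\<^sup>2" using mult_left_mono[OF ES, of "4 * K\<^sup>2"] by simp
  finally have 2: "(\<integral>\<omega>. (\<Sum>k<n. d k \<omega> * d k \<omega>) \<partial>P) \<le> 4 * K\<^sup>2 * K\<^sup>2" .
  have "(\<integral>\<omega>. (?S n \<omega>)\<^sup>2 \<partial>P) = 2 * (\<integral>\<omega>. (\<Sum>k<n. ?S k \<omega> * d k \<omega>) \<partial>P) + (\<integral>\<omega>. (\<Sum>k<n. d k \<omega> * d k \<omega>) \<partial>P)"
    unfolding square using ISd Idd by simp
  also have "\<dots> \<le> 6 * (K\<^sup>2 * K\<^sup>2)" using 1 2 by linarith
  finally show "(\<integral>\<omega>. (?S n \<omega>)\<^sup>2 \<partial>P) \<le> 6 * K ^ 4" by (simp add: power2_eq_square power4_eq_xxxx mult.assoc)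
qed

text \<open>Young's inequality separates the two factors, and the uniform second moment of square
  sums lets \<open>n0\<close> be chosen before the partition. In later use \<open>g n\<close> is
  built from oscillations at scale \<open>n\<close>.\<close>

lemma vanishing_times_square_sum:
  assumes M: "martingale P F M" and K: "\<And>t \<omega>. 0 \<le> t \<Longrightarrow> \<omega> \<in> space P \<Longrightarrow> \<bar>M t \<omega>\<bar> \<le> K"
    and g: "\<And>n. g n \<in> borel_measurable P" "\<And>n \<omega>. \<omega> \<in> space P \<Longrightarrow> \<bar>g n \<omega>\<bar> \<le> C"
    and lim: "AE \<omega> in P. (\<lambda>n. g n \<omega>) \<longlonglongrightarrow> 0" and e: "0 < \<epsilon>"
  shows "\<exists>n0. \<forall>n\<ge>n0. \<forall>u N. incseq u \<and> 0 \<le> u 0 \<longrightarrow> (\<integral>\<omega>. g n \<omega> * square_sum M u N \<omega> \<partial>P) \<le> \<epsilon>"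
proof -
  \<comment> \<open>Makes the second half of Young's inequality at most
    \<open>\<epsilon> / 2\<close>; the summand \<open>1\<close> keeps the denominator positive when
    \<open>K = 0\<close>.\<close>
  define \<eta> where "\<eta> = \<epsilon> / (6 * K ^ 4 + 1)"
  have K4: "0 \<le> K ^ 4" by simp
  have \<eta>: "0 < \<eta>" "\<eta> * (6 * K ^ 4) \<le> \<epsilon>"
    using e K4 by (auto simp: \<eta>_def field_simps add_pos_nonneg)
  note [measurable] = g(1)
  have gi: "integrable P (\<lambda>\<omega>. (g n \<omega>)\<^sup>2)" for n
  proof (rule integrable_bounded[where C="C\<^sup>2"])
    fix \<omega> assume w: "\<omega> \<in> space P"
    then have "0 \<le> C" using g(2)[OF w, of n] by linarith
    then show "\<bar>(g n \<omega>)\<^sup>2\<bar> \<le> C\<^sup>2" using g(2)[OF w, of n] by (simp add: abs_le_square_iff[symmetric])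
  qed auto
  have "(\<lambda>n. \<integral>\<omega>. (g n \<omega>)\<^sup>2 \<partial>P) \<longlonglongrightarrow> (\<integral>\<omega>. 0 \<partial>P)"
  proof (rule integral_dominated_convergence[where w="\<lambda>_. C\<^sup>2"])
    show "AE \<omega> in P. (\<lambda>n. (g n \<omega>)\<^sup>2) \<longlonglongrightarrow> 0"
      using lim
    proof eventually_elim
      case (elim \<omega>)
      show ?case using tendsto_power[OF elim, of 2] by simp
    qed
    show "AE \<omega> in P. norm ((g n \<omega>)\<^sup>2) \<le> C\<^sup>2" for n
    proof (rule AE_I2)
      fix \<omega> assume w: "\<omega> \<in> space P"
      then have "0 \<le> C" using g(2)[OF w, of n] by linarith
      then show "norm ((g n \<omega>)\<^sup>2) \<le> C\<^sup>2" using g(2)[OF w, of n] by (simp add: abs_le_square_iff[symmetric])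
    qed
  qed auto
  then have "\<forall>\<^sub>F n in sequentially. (\<integral>\<omega>. (g n \<omega>)\<^sup>2 \<partial>P) < \<eta> * \<epsilon>"
    using \<eta>(1) e by (intro order_tendstoD) auto
  then obtain n0 where n0: "\<And>n. n \<ge> n0 \<Longrightarrow> (\<integral>\<omega>. (g n \<omega>)\<^sup>2 \<partial>P) < \<eta> * \<epsilon>"
    by (auto simp: eventually_sequentially)
  show ?thesis
  proof (intro exI allI impI)
    fix n u N assume n: "n \<ge> n0" and u: "incseq u \<and> (0::real) \<le> u 0"
    have S: "(\<integral>\<omega>. (square_sum M u N \<omega>)\<^sup>2 \<partial>P) \<le> 6 * K ^ 4"
      "square_sum M u N \<in> borel_measurable (F (u N))"
      "\<And>\<omega>. \<omega> \<in> space P \<Longrightarrow> \<bar>square_sum M u N \<omega>\<bar> \<le> real N * (4 * K\<^sup>2)"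
      using square_sum_second_moment[OF M, where K=K and u=u and n=N] K u by auto
    note [measurable] = measurable_F[OF S(2)]
    have Si: "integrable P (\<lambda>\<omega>. (square_sum M u N \<omega>)\<^sup>2)"
      using integrable_bounded_mult[OF integrable_bounded[OF measurable_F[OF S(2)] S(3)] measurable_F[OF S(2)] S(3)]
      by (simp add: power2_eq_square)
    have "(\<integral>\<omega>. g n \<omega> * square_sum M u N \<omega> \<partial>P)
      \<le> (\<integral>\<omega>. (g n \<omega>)\<^sup>2 / (2 * \<eta>) + \<eta> / 2 * (square_sum M u N \<omega>)\<^sup>2 \<partial>P)"
    proof (rule integral_mono)
      show "integrable P (\<lambda>\<omega>. g n \<omega> * square_sum M u N \<omega>)"
        by (rule integrable_bounded_mult[OF integrable_bounded[OF _ S(3)] g(1) g(2)]) auto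
      fix \<omega>
      have "0 \<le> (g n \<omega> - \<eta> * square_sum M u N \<omega>)\<^sup>2" by simp
      then have "2 * \<eta> * (g n \<omega> * square_sum M u N \<omega>) \<le> (g n \<omega>)\<^sup>2 + \<eta>\<^sup>2 * (square_sum M u N \<omega>)\<^sup>2"
        by (simp add: power2_diff power_mult_distrib algebra_simps)
      then show "g n \<omega> * square_sum M u N \<omega> \<le> (g n \<omega>)\<^sup>2 / (2 * \<eta>) + \<eta> / 2 * (square_sum M u N \<omega>)\<^sup>2"
        using \<eta>(1) by (simp add: field_simps power2_eq_square)
    qed (use gi Si in auto)
    also have "\<dots> = (\<integral>\<omega>. (g n \<omega>)\<^sup>2 \<partial>P) / (2 * \<eta>) + \<eta> / 2 * (\<integral>\<omega>. (square_sum M u N \<omega>)\<^sup>2 \<partial>P)"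
      using gi Si by simp
    also have "\<dots> \<le> (\<eta> * \<epsilon>) / (2 * \<eta>) + \<eta> / 2 * (6 * K ^ 4)"
      using n0[OF n] S(1) \<eta>(1) by (intro add_mono divide_right_mono mult_left_mono) auto
    also have "\<dots> \<le> \<epsilon>" using \<eta> by simp
    finally show "(\<integral>\<omega>. g n \<omega> * square_sum M u N \<omega> \<partial>P) \<le> \<epsilon>" .
  qed
qed

end

section \<open>Quadratic variation\<close>

lemma continuous_on_halflineI:
  fixes f :: "real \<Rightarrow> 'b::topological_space"
  assumes "\<And>T::nat. continuous_on {0..real T} f"
  shows "continuous_on {0..} f"
  unfolding continuous_on_sequentially
proof (intro allI ballI impI, elim conjE)
  fix x a assume a: "a \<in> {0..}" and x: "\<forall>n. x n \<in> {0..}" and lim: "x \<longlonglongrightarrow> (a::real)"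
  obtain B where B: "\<And>n. \<bar>x n\<bar> \<le> B" using convergent_imp_Bseq[OF convergentI[OF lim]]
    by (auto simp: Bseq_def)
  obtain T :: nat where T: "max B a \<le> real T" using real_arch_simple by blast
  have "x n \<le> real T" for n using B[of n] T by auto
  then show "(f \<circ> x) \<longlonglongrightarrow> f a"
    using assms[of T] a x lim T unfolding continuous_on_sequentially by auto
qed

definition dyadic_floor :: "nat \<Rightarrow> real \<Rightarrow> real" where
  "dyadic_floor m r = real (nat \<lfloor>r * 2 ^ m\<rfloor>) / 2 ^ m"

lemma dyadic_floor_bounds:
  assumes "0 \<le> r"
  shows "dyadic_floor m r \<le> r" "r - 1 / 2 ^ m \<le> dyadic_floor m r" "0 \<le> dyadic_floor m r"
proof -
  have "real (nat \<lfloor>r * 2 ^ m\<rfloor>) = of_int \<lfloor>r * 2 ^ m\<rfloor>" using assms by (simp add: of_nat_nat)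
  then have "real (nat \<lfloor>r * 2 ^ m\<rfloor>) \<le> r * 2 ^ m" "r * 2 ^ m - 1 \<le> real (nat \<lfloor>r * 2 ^ m\<rfloor>)" by linarith+
  moreover have "r - 1 / 2 ^ m = (r * 2 ^ m - 1) / 2 ^ m" by (simp add: diff_divide_distrib)
  ultimately show "dyadic_floor m r \<le> r" "r - 1 / 2 ^ m \<le> dyadic_floor m r"
    unfolding dyadic_floor_def by (simp_all add: pos_divide_le_eq divide_right_mono)
  show "0 \<le> dyadic_floor m r" by (simp add: dyadic_floor_def)
qed

lemma dyadic_floor_tendsto: "0 \<le> r \<Longrightarrow> (\<lambda>m. dyadic_floor m r) \<longlonglongrightarrow> r"
proof (rule tendsto_sandwich[where f="\<lambda>m. r - 1 / 2 ^ m" and h="\<lambda>_. r"])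
  show "(\<lambda>m. r - 1 / 2 ^ m) \<longlonglongrightarrow> r"
    using tendsto_diff[OF tendsto_const[of r] tendsto_half_power[of 1]] by simp
qed (auto simp: dyadic_floor_bounds)

text \<open>The bound at step \<open>k\<close> is assumed only up to time \<open>k\<close>; on each
  interval \<open>{0..real T}\<close> it holds from \<open>max k0 T\<close> on, which is enough for
  the Weierstrass test there.\<close>

lemma uniform_telescoping:
  fixes f :: "nat \<Rightarrow> real \<Rightarrow> real"
  assumes c: "\<And>k. continuous_on {0..} (f k)"
    and le: "\<And>k t. k \<ge> k0 \<Longrightarrow> 0 \<le> t \<Longrightarrow> t \<le> real k \<Longrightarrow> \<bar>f (Suc k) t - f k t\<bar> \<le> (1 / 2) ^ k"
  shows "0 \<le> t \<Longrightarrow> (\<lambda>k. f k t) \<longlonglongrightarrow> lim (\<lambda>k. f k t)"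
    and "continuous_on {0..} (\<lambda>t. lim (\<lambda>k. f k t))"
proof -
  define g where "g t = (\<Sum>i. f (Suc i) t - f i t) + f 0 t" for t
  have tel: "(\<Sum>i<n. f (Suc i) t - f i t) = f n t - f 0 t" for n t
    by (rule sum_lessThan_telescope[where f="\<lambda>n. f n t"])
  have U: "uniform_limit {0..real T} (\<lambda>n t. f n t - f 0 t) (\<lambda>t. \<Sum>i. f (Suc i) t - f i t) sequentially" for T :: nat
    unfolding tel[symmetric]
  proof (rule Weierstrass_m_test_ev)
    show "summable (\<lambda>k. (1 / 2 :: real) ^ k)" by (rule summable_geometric) simp
    show "\<forall>\<^sub>F n in sequentially. \<forall>x\<in>{0..real T}. norm (f (Suc n) x - f n x) \<le> (1 / 2) ^ n"
      using le by (intro eventually_sequentiallyI[of "max k0 T"]) auto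
  qed
  have lim: "(\<lambda>k. f k t) \<longlonglongrightarrow> g t" if "0 \<le> t" for t
  proof -
    obtain T :: nat where "t \<le> real T" using real_arch_simple by blast
    then have "(\<lambda>n. f n t - f 0 t) \<longlonglongrightarrow> (\<Sum>i. f (Suc i) t - f i t)"
      using tendsto_uniform_limitI[OF U] that by auto
    then show ?thesis using tendsto_add[OF _ tendsto_const[of "f 0 t"]] by (fastforce simp: g_def)
  qed
  then have limg: "lim (\<lambda>k. f k t) = g t" if "0 \<le> t" for t using that limI by blast
  then show "0 \<le> t \<Longrightarrow> (\<lambda>k. f k t) \<longlonglongrightarrow> lim (\<lambda>k. f k t)" using lim by simp
  have "continuous_on {0..real T} g" for T :: nat
    unfolding g_def
  proof (intro continuous_on_add)
    have c': "continuous_on {0..real T} (f k)" for k by (rule continuous_on_subset[OF c]) auto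
    then show "continuous_on {0..real T} (f 0)" .
    show "continuous_on {0..real T} (\<lambda>t. \<Sum>i. f (Suc i) t - f i t)"
      by (rule uniform_limit_theorem[OF _ U]) (auto intro!: always_eventually continuous_on_diff c')
  qed
  then have "continuous_on {0..} g" by (rule continuous_on_halflineI)
  then show "continuous_on {0..} (\<lambda>t. lim (\<lambda>k. f k t))"
    by (rule continuous_on_eq) (auto simp: limg)
qed

text \<open>The modulus of continuity is taken over rational times to make it measurable.\<close>

definition rational_pairs :: "nat \<Rightarrow> nat \<Rightarrow> (real \<times> real) set" where
  "rational_pairs T n = {(p, q). p \<in> \<rat> \<and> q \<in> \<rat> \<and> 0 \<le> p \<and> p \<le> real T \<and> 0 \<le> q \<and> q \<le> real T \<and> \<bar>p - q\<bar> \<le> 1 / 2 ^ n}"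

definition oscillation :: "(real \<Rightarrow> 'w \<Rightarrow> real) \<Rightarrow> nat \<Rightarrow> nat \<Rightarrow> 'w \<Rightarrow> real" where
  "oscillation M T n \<omega> = (SUP z\<in>rational_pairs T n. \<bar>M (fst z) \<omega> - M (snd z) \<omega>\<bar>)"

lemma countable_rational_pairs: "countable (rational_pairs T n)"
  by (rule countable_subset[of _ "\<rat> \<times> \<rat>"]) (auto simp: rational_pairs_def countable_rat)

lemma rational_pairs_nonempty: "rational_pairs T n \<noteq> {}"
proof -
  have "(0, 0) \<in> rational_pairs T n" by (auto simp: rational_pairs_def)
  then show ?thesis by auto
qed

lemma
  assumes K: "\<And>t. 0 \<le> t \<Longrightarrow> \<bar>M t \<omega>\<bar> \<le> K"
  shows bdd_above_oscillation: "bdd_above ((\<lambda>z. \<bar>M (fst z) \<omega> - M (snd z) \<omega>\<bar>) ` rational_pairs T n)"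
    and oscillation_ge: "z \<in> rational_pairs T n \<Longrightarrow> \<bar>M (fst z) \<omega> - M (snd z) \<omega>\<bar> \<le> oscillation M T n \<omega>"
    and oscillation_nonneg: "0 \<le> oscillation M T n \<omega>"
    and oscillation_le: "oscillation M T n \<omega> \<le> 2 * K"
proof -
  have b: "\<bar>M (fst z) \<omega> - M (snd z) \<omega>\<bar> \<le> 2 * K" if "z \<in> rational_pairs T n" for z
    using that K[of "fst z"] K[of "snd z"] by (auto simp: rational_pairs_def)
  then show bd: "bdd_above ((\<lambda>z. \<bar>M (fst z) \<omega> - M (snd z) \<omega>\<bar>) ` rational_pairs T n)"
    by (intro bdd_aboveI2)
  show ge: "\<bar>M (fst z) \<omega> - M (snd z) \<omega>\<bar> \<le> oscillation M T n \<omega>" if "z \<in> rational_pairs T n" for z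
    unfolding oscillation_def by (rule cSUP_upper[OF that bd])
  have "(0, 0) \<in> rational_pairs T n" by (auto simp: rational_pairs_def)
  from ge[OF this] show "0 \<le> oscillation M T n \<omega>" by simp
  show "oscillation M T n \<omega> \<le> 2 * K"
    unfolding oscillation_def by (rule cSUP_least[OF rational_pairs_nonempty b])
qed

lemma oscillation_tendsto_0:
  assumes K: "\<And>t. 0 \<le> t \<Longrightarrow> \<bar>M t \<omega>\<bar> \<le> K" and c: "continuous_on {0..} (\<lambda>t. M t \<omega>)"
  shows "(\<lambda>n. oscillation M T n \<omega>) \<longlonglongrightarrow> 0"
proof (rule LIMSEQ_I)
  fix e :: real assume e: "0 < e"
  have "uniformly_continuous_on {0..real T} (\<lambda>t. M t \<omega>)"
    by (intro compact_uniformly_continuous continuous_on_subset[OF c]) auto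
  then obtain d where d: "d > 0"
    "\<And>x y. x \<in> {0..real T} \<Longrightarrow> y \<in> {0..real T} \<Longrightarrow> dist y x < d \<Longrightarrow> dist (M y \<omega>) (M x \<omega>) < e / 2"
    using e unfolding uniformly_continuous_on_def by (meson half_gt_zero)
  have "\<forall>\<^sub>F n in sequentially. 1 / 2 ^ n < d"
    using tendsto_half_power[of 1] d(1) by (intro order_tendstoD) auto
  then obtain n0 where n0: "\<And>n. n \<ge> n0 \<Longrightarrow> 1 / 2 ^ n < d" by (auto simp: eventually_sequentially)
  show "\<exists>n0. \<forall>n\<ge>n0. norm (oscillation M T n \<omega> - 0) < e"
  proof (intro exI allI impI)
    fix n assume n: "n \<ge> n0"
    have "oscillation M T n \<omega> \<le> e / 2"
      unfolding oscillation_def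
    proof (rule cSUP_least[OF rational_pairs_nonempty])
      fix z assume "z \<in> rational_pairs T n"
      then show "\<bar>M (fst z) \<omega> - M (snd z) \<omega>\<bar> \<le> e / 2"
        using d(2)[of "snd z" "fst z"] n0[OF n] by (auto simp: rational_pairs_def dist_real_def)
    qed
    then show "norm (oscillation M T n \<omega> - 0) < e"
      using oscillation_nonneg[where M=M and \<omega>=\<omega>, OF K, of T n] e by simp
  qed
qed

context filtered_prob_space
begin

lemma measurable_oscillation:
  assumes "\<And>t. 0 \<le> t \<Longrightarrow> M t \<in> borel_measurable P"
    and "\<And>t \<omega>. 0 \<le> t \<Longrightarrow> \<omega> \<in> space P \<Longrightarrow> \<bar>M t \<omega>\<bar> \<le> K"
  shows "oscillation M T n \<in> borel_measurable P"
proof -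
  have "(\<lambda>\<omega>. SUP z\<in>rational_pairs T n. \<bar>M (fst z) \<omega> - M (snd z) \<omega>\<bar>) \<in> borel_measurable P"
  proof (rule borel_measurable_cSUP[OF countable_rational_pairs])
    fix z assume "z \<in> rational_pairs T n"
    then have "0 \<le> fst z" "0 \<le> snd z" by (auto simp: rational_pairs_def)
    then show "(\<lambda>\<omega>. \<bar>M (fst z) \<omega> - M (snd z) \<omega>\<bar>) \<in> borel_measurable P"
      using assms(1) by (intro borel_measurable_abs borel_measurable_diff) auto
  next
    fix \<omega> assume "\<omega> \<in> space P"
    then show "bdd_above ((\<lambda>z. \<bar>M (fst z) \<omega> - M (snd z) \<omega>\<bar>) ` rational_pairs T n)"
      using bdd_above_oscillation[of M \<omega> K] assms(2) by auto
  qed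
  then show ?thesis unfolding oscillation_def[abs_def] .
qed

text \<open>Doob's maximal inequality. On the grid of level \<open>l\<close> the exceedance event is
  split by the first grid point with a value above \<delta>, and the absolute value is moved from
  there to the horizon. The grids are nested, so the bound survives in the limit, and continuity
  extends it to all times.\<close>

lemma martingale_maximal:
  assumes W: "martingale P F W" and c: "\<And>\<omega>. \<omega> \<in> space P \<Longrightarrow> continuous_on {0..} (\<lambda>t. W t \<omega>)"
    and d: "0 < \<delta>"
  obtains B where "B \<in> sets P" "measure P B \<le> (\<integral>\<omega>. \<bar>W (real T) \<omega>\<bar> \<partial>P) / \<delta>"
    "\<And>\<omega> t. \<omega> \<in> space P - B \<Longrightarrow> 0 \<le> t \<Longrightarrow> t \<le> real T \<Longrightarrow> \<bar>W t \<omega>\<bar> \<le> \<delta>"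
proof -
  define E where "E l = {\<omega>\<in>space P. \<exists>k\<le>T * 2 ^ l. \<bar>W (real k / 2 ^ l) \<omega>\<bar> > \<delta>}" for l :: nat
  have Wm: "W (real k / 2 ^ l) \<in> borel_measurable P" for k l
    using martingale_measurable[OF W] by simp
  have E: "E l \<in> sets P" for l unfolding E_def using Wm by measurable
  have IT: "integrable P (\<lambda>\<omega>. \<bar>W (real T) \<omega>\<bar>)" using martingale_integrable[OF W] by simp
  have bound: "measure P (E l) \<le> (\<integral>\<omega>. \<bar>W (real T) \<omega>\<bar> \<partial>P) / \<delta>" for l
  proof -
    define A where "A k = {\<omega>\<in>space P. \<bar>W (real k / 2 ^ l) \<omega>\<bar> > \<delta> \<and> (\<forall>i<k. \<bar>W (real i / 2 ^ l) \<omega>\<bar> \<le> \<delta>)}" for k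
    have AF: "A k \<in> sets (F (real k / 2 ^ l))" for k
    proof -
      let ?G = "F (real k / 2 ^ l)"
      have W': "W (real i / 2 ^ l) \<in> borel_measurable ?G" if "i \<le> k" for i
        using that by (intro measurable_F_mono[OF martingale_adapted[OF W]] divide_right_mono) auto
      have 1: "{\<omega>\<in>space ?G. \<delta> < \<bar>W (real k / 2 ^ l) \<omega>\<bar>} \<in> sets ?G"
        using W'[of k] by (intro borel_measurable_less borel_measurable_abs) auto
      have 2: "{\<omega>\<in>space ?G. \<bar>W (real i / 2 ^ l) \<omega>\<bar> \<le> \<delta>} \<in> sets ?G" if "i \<in> {..<k}" for i
        using W'[of i] that by (intro borel_measurable_le borel_measurable_abs) auto
      have "{\<omega>\<in>space ?G. \<delta> < \<bar>W (real k / 2 ^ l) \<omega>\<bar> \<and> (\<forall>i\<in>{..<k}. \<bar>W (real i / 2 ^ l) \<omega>\<bar> \<le> \<delta>)} \<in> sets ?G"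
        by (intro sets.sets_Collect_conj 1 sets.sets_Collect_finite_All 2 finite_lessThan)
      then show ?thesis by (simp only: A_def space_F Ball_def lessThan_iff)
    qed
    note AP = indicator_F[OF AF]
    have disj: "disjoint_family_on A {..T * 2 ^ l}"
      unfolding disjoint_family_on_def
    proof (intro ballI impI)
      fix i j :: nat assume "i \<noteq> j"
      then show "A i \<inter> A j = {}" by (cases i j rule: linorder_cases) (auto simp: A_def not_less[symmetric])
    qed
    have "E l \<subseteq> (\<Union>k\<le>T * 2 ^ l. A k)"
    proof
      fix \<omega> assume w: "\<omega> \<in> E l"
      define k where "k = (LEAST k. \<bar>W (real k / 2 ^ l) \<omega>\<bar> > \<delta>)"
      obtain k' where k': "k' \<le> T * 2 ^ l" "\<bar>W (real k' / 2 ^ l) \<omega>\<bar> > \<delta>" using w by (auto simp: E_def)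
      have "\<bar>W (real k / 2 ^ l) \<omega>\<bar> > \<delta>" unfolding k_def
        by (rule LeastI[where P="\<lambda>k. \<bar>W (real k / 2 ^ l) \<omega>\<bar> > \<delta>", OF k'(2)])
      moreover have "\<forall>i<k. \<not> \<bar>W (real i / 2 ^ l) \<omega>\<bar> > \<delta>" unfolding k_def using not_less_Least by blast
      moreover have "k \<le> k'" unfolding k_def
        by (rule Least_le[where P="\<lambda>k. \<bar>W (real k / 2 ^ l) \<omega>\<bar> > \<delta>", OF k'(2)])
      ultimately have "\<omega> \<in> A k" "k \<le> T * 2 ^ l" using w k' by (auto simp: A_def E_def not_less)
      then show "\<omega> \<in> (\<Union>k\<le>T * 2 ^ l. A k)" by auto
    qed
    then have "measure P (E l) \<le> measure P (\<Union>k\<le>T * 2 ^ l. A k)"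
      using AP by (intro finite_measure_mono) auto
    also have "\<dots> \<le> (\<Sum>k\<le>T * 2 ^ l. measure P (A k))"
      using AP by (intro finite_measure_subadditive_finite) auto
    finally have "\<delta> * measure P (E l) \<le> (\<Sum>k\<le>T * 2 ^ l. \<delta> * measure P (A k))"
      using d by (simp add: sum_distrib_left[symmetric])
    also have "\<dots> \<le> (\<Sum>k\<le>T * 2 ^ l. \<integral>\<omega>. indicator (A k) \<omega> * \<bar>W (real T) \<omega>\<bar> \<partial>P)"
    proof (rule sum_mono)
      fix k assume "k \<in> {..T * 2 ^ l}"
      then have "real k \<le> real (T * 2 ^ l)" by (simp only: of_nat_le_iff atMost_iff)
      then have k: "real k / 2 ^ l \<le> real T" by (simp add: field_simps)
      have "\<delta> * measure P (A k) = (\<integral>\<omega>. indicator (A k) \<omega> * \<delta> \<partial>P)" using AP by simp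
      also have "\<dots> \<le> (\<integral>\<omega>. indicator (A k) \<omega> * \<bar>W (real k / 2 ^ l) \<omega>\<bar> \<partial>P)"
      proof (rule integral_mono)
        show "integrable P (\<lambda>\<omega>. indicator (A k) \<omega> * \<bar>W (real k / 2 ^ l) \<omega>\<bar>)"
          using martingale_integrable[OF W, of "real k / 2 ^ l"]
          by (intro integrable_indicator_mult AP) auto
        show "indicator (A k) \<omega> * \<delta> \<le> indicator (A k) \<omega> * \<bar>W (real k / 2 ^ l) \<omega>\<bar>" for \<omega>
          by (auto simp: A_def split: split_indicator)
      qed (intro integrable_indicator_mult AP, simp)
      also have "\<dots> \<le> (\<integral>\<omega>. indicator (A k) \<omega> * \<bar>W (real T) \<omega>\<bar> \<partial>P)"
        using martingale_excess_mono[OF W _ k AF, of 0] by simp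
      finally show "\<delta> * measure P (A k) \<le> (\<integral>\<omega>. indicator (A k) \<omega> * \<bar>W (real T) \<omega>\<bar> \<partial>P)" .
    qed
    also have "\<dots> = (\<integral>\<omega>. (\<Sum>k\<le>T * 2 ^ l. indicator (A k) \<omega> * \<bar>W (real T) \<omega>\<bar>) \<partial>P)"
      by (rule Bochner_Integration.integral_sum[symmetric], rule integrable_indicator_mult[OF IT AP])
    also have "\<dots> = (\<integral>\<omega>. indicator (\<Union>k\<le>T * 2 ^ l. A k) \<omega> * \<bar>W (real T) \<omega>\<bar> \<partial>P)"
      by (subst indicator_UN_disjoint[OF finite_atMost disj]) (simp only: sum_distrib_right)
    also have "\<dots> \<le> (\<integral>\<omega>. \<bar>W (real T) \<omega>\<bar> \<partial>P)"
      using AP by (intro integral_mono integrable_indicator_mult IT sets.finite_UN) (auto split: split_indicator)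
    finally show ?thesis using d by (simp add: field_simps)
  qed
  have inc: "incseq E"
  proof (rule incseq_SucI, rule subsetI)
    fix l \<omega> assume "\<omega> \<in> E l"
    then obtain k where k: "k \<le> T * 2 ^ l" "\<bar>W (real k / 2 ^ l) \<omega>\<bar> > \<delta>" "\<omega> \<in> space P" by (auto simp: E_def)
    have "real (2 * k) / 2 ^ Suc l = real k / 2 ^ l" by simp
    then show "\<omega> \<in> E (Suc l)" using k by (auto simp: E_def intro!: exI[of _ "2 * k"])
  qed
  show ?thesis
  proof (rule that[of "\<Union>l. E l"])
    show "(\<Union>l. E l) \<in> sets P" using E by auto
    show "measure P (\<Union>l. E l) \<le> (\<integral>\<omega>. \<bar>W (real T) \<omega>\<bar> \<partial>P) / \<delta>"
    proof (rule LIMSEQ_le_const2)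
      show "(\<lambda>l. measure P (E l)) \<longlonglongrightarrow> measure P (\<Union>l. E l)"
        by (rule finite_Lim_measure_incseq) (use E inc in auto)
    qed (use bound in auto)
    fix \<omega> t assume w: "\<omega> \<in> space P - (\<Union>l. E l)" and t: "0 \<le> t" "t \<le> real T"
    have dy: "dyadic_ceiling l t = real (nat \<lceil>t * 2 ^ l\<rceil>) / 2 ^ l" for l by (simp add: dyadic_ceiling_def)
    have "(\<lambda>l. \<bar>W (dyadic_ceiling l t) \<omega>\<bar>) \<longlonglongrightarrow> \<bar>W t \<omega>\<bar>"
      using dyadic_ceiling_bounds(1)[OF t(1)] t(1) w
      by (intro tendsto_rabs continuous_on_halfline_tendsto[OF c _ dyadic_ceiling_tendsto]) (auto intro: order_trans)
    moreover have "\<bar>W (dyadic_ceiling l t) \<omega>\<bar> \<le> \<delta>" for l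
    proof -
      \<comment> \<open>The horizon is a natural number, hence a grid point of every level, so
        rounding up never passes it.\<close>
      have "t * 2 ^ l \<le> real (T * 2 ^ l)" using t(2) by simp
      then have "nat \<lceil>t * 2 ^ l\<rceil> \<le> T * 2 ^ l" by (simp add: nat_le_iff ceiling_le_iff)
      then show ?thesis using w unfolding dy by (auto simp: E_def not_less)
    qed
    ultimately show "\<bar>W t \<omega>\<bar> \<le> \<delta>" by (intro LIMSEQ_le_const2) auto
  qed
qed

text \<open>Ito isometry on a grid, by induction on the number of cells: the cross term vanishes
  because the partial sum times the next integrand is known when the next cell begins.\<close>

lemma dyadic_isometry:
  assumes M: "martingale P F M" and K: "\<And>t \<omega>. 0 \<le> t \<Longrightarrow> \<omega> \<in> space P \<Longrightarrow> \<bar>M t \<omega>\<bar> \<le> K"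
    and H: "\<And>k. H k \<in> borel_measurable (F (real k / 2 ^ m))"
    and C: "\<And>k \<omega>. \<omega> \<in> space P \<Longrightarrow> \<bar>H k \<omega>\<bar> \<le> C"
  defines "d \<equiv> \<lambda>k \<omega>. M (real (Suc k) / 2 ^ m) \<omega> - M (real k / 2 ^ m) \<omega>"
  shows "(\<integral>\<omega>. (\<Sum>k<n. H k \<omega> * d k \<omega>)\<^sup>2 \<partial>P) = (\<integral>\<omega>. (\<Sum>k<n. (H k \<omega> * d k \<omega>)\<^sup>2) \<partial>P)"
proof -
  have [measurable]: "M (real k / 2 ^ m) \<in> borel_measurable P" for k using martingale_measurable[OF M] by simp
  have Hm[measurable]: "H k \<in> borel_measurable P" for k using measurable_F[OF H] .
  have dm[measurable]: "d k \<in> borel_measurable P" for k unfolding d_def by measurable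
  have db: "\<bar>H k \<omega> * d k \<omega>\<bar> \<le> C * (2 * K)" if w: "\<omega> \<in> space P" for k \<omega>
  proof -
    have "\<bar>M (real (Suc k) / 2 ^ m) \<omega>\<bar> \<le> K" "\<bar>M (real k / 2 ^ m) \<omega>\<bar> \<le> K" using K w by auto
    then have "\<bar>d k \<omega>\<bar> \<le> 2 * K" unfolding d_def by linarith
    then show ?thesis unfolding abs_mult using C[OF w, of k] by (intro mult_mono) auto
  qed
  define I where "I n \<omega> = (\<Sum>k<n. H k \<omega> * d k \<omega>)" for n \<omega>
  have Ib: "\<bar>I n \<omega>\<bar> \<le> real n * (C * (2 * K))" if w: "\<omega> \<in> space P" for n \<omega>
  proof -
    have "\<bar>I n \<omega>\<bar> \<le> (\<Sum>k<n. \<bar>H k \<omega> * d k \<omega>\<bar>)" unfolding I_def by (rule sum_abs)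
    also have "\<dots> \<le> real n * (C * (2 * K))" using sum_bounded_above[of "{..<n}" "\<lambda>k. \<bar>H k \<omega> * d k \<omega>\<bar>" "C * (2 * K)"] db[OF w] by simp
    finally show ?thesis .
  qed
  have MF: "M (real k / 2 ^ m) \<in> borel_measurable (F (real n / 2 ^ m))" if "k \<le> n" for k n
    using that by (intro measurable_F_mono[OF martingale_adapted[OF M]] divide_right_mono) auto
  have IF: "I n \<in> borel_measurable (F (real n / 2 ^ m))" for n
    unfolding I_def d_def
    by (intro borel_measurable_sum borel_measurable_times borel_measurable_diff MF measurable_F_mono[OF H] divide_right_mono) auto
  have Im[measurable]: "I n \<in> borel_measurable P" for n using measurable_F[OF IF] .
  have bI: "integrable P (\<lambda>\<omega>. f \<omega> * g \<omega>)"
    if "f \<in> borel_measurable P" "g \<in> borel_measurable P" "\<And>\<omega>. \<omega> \<in> space P \<Longrightarrow> \<bar>f \<omega>\<bar> \<le> A" "\<And>\<omega>. \<omega> \<in> space P \<Longrightarrow> \<bar>g \<omega>\<bar> \<le> B"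
    for f g :: "'w \<Rightarrow> real" and A B
    by (rule integrable_bounded_mult[OF integrable_bounded[OF that(2,4)] that(1,3)])
  have Hd: "(\<lambda>\<omega>. H k \<omega> * d k \<omega>) \<in> borel_measurable P" for k by measurable
  have i1: "integrable P (\<lambda>\<omega>. (I n \<omega>)\<^sup>2)" for n using bI[OF Im Im Ib Ib] by (simp add: power2_eq_square)
  have i2: "integrable P (\<lambda>\<omega>. I n \<omega> * (H n \<omega> * d n \<omega>))" for n using bI[OF Im Hd Ib db] .
  have i3: "integrable P (\<lambda>\<omega>. (H k \<omega> * d k \<omega>)\<^sup>2)" for k
    using bI[OF Hd Hd db db] by (simp add: power2_eq_square)
  have cross: "(\<integral>\<omega>. I n \<omega> * (H n \<omega> * d n \<omega>) \<partial>P) = 0" for n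
  proof -
    let ?H = "\<lambda>\<omega>. I n \<omega> * H n \<omega>"
    have HF: "?H \<in> borel_measurable (F (real n / 2 ^ m))" using IF H by auto
    have Hb: "\<bar>?H \<omega>\<bar> \<le> real n * (C * (2 * K)) * C" if "\<omega> \<in> space P" for \<omega>
      unfolding abs_mult using Ib[OF that, of n] C[OF that, of n] by (intro mult_mono') auto
    have "(\<integral>\<omega>. ?H \<omega> * M (real (Suc n) / 2 ^ m) \<omega> \<partial>P) = (\<integral>\<omega>. ?H \<omega> * M (real n / 2 ^ m) \<omega> \<partial>P)"
      by (rule martingale_mult_bounded[OF M _ _ HF Hb]) (auto intro!: divide_right_mono)
    moreover have "integrable P (\<lambda>\<omega>. ?H \<omega> * M (real k / 2 ^ m) \<omega>)" for k
      by (rule bI[OF _ _ Hb K]) auto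
    ultimately have "(\<integral>\<omega>. ?H \<omega> * M (real (Suc n) / 2 ^ m) \<omega> - ?H \<omega> * M (real n / 2 ^ m) \<omega> \<partial>P) = 0"
      by (subst Bochner_Integration.integral_diff) (auto simp del: of_nat_Suc)
    then show ?thesis by (simp add: d_def algebra_simps)
  qed
  show ?thesis
    unfolding I_def[symmetric]
  proof (induction n)
    case 0 show ?case by (simp add: I_def)
  next
    case (Suc n)
    have "(\<integral>\<omega>. (I (Suc n) \<omega>)\<^sup>2 \<partial>P) = (\<integral>\<omega>. (I n \<omega>)\<^sup>2 + 2 * (I n \<omega> * (H n \<omega> * d n \<omega>)) + (H n \<omega> * d n \<omega>)\<^sup>2 \<partial>P)"
      by (simp add: I_def power2_eq_square algebra_simps)
    also have "\<dots> = (\<integral>\<omega>. (I n \<omega>)\<^sup>2 \<partial>P) + (\<integral>\<omega>. (H n \<omega> * d n \<omega>)\<^sup>2 \<partial>P)"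
      using i1 i2 i3 cross by simp
    also have "\<dots> = (\<integral>\<omega>. (\<Sum>k<n. (H k \<omega> * d k \<omega>)\<^sup>2) + (H n \<omega> * d n \<omega>)\<^sup>2 \<partial>P)"
      unfolding Suc.IH using i3 by (subst Bochner_Integration.integral_add) auto
    finally show ?case by simp
  qed
qed

section \<open>Grid refinement and the integral of a martingale against itself\<close>

lemma dyadic_incr_refine:
  "dyadic_incr M (Suc m) (2 * k) t \<omega> + dyadic_incr M (Suc m) (Suc (2 * k)) t \<omega> = dyadic_incr M m k t \<omega>"
proof -
  have "real (Suc (Suc (2 * k))) / 2 ^ Suc m = real (Suc k) / 2 ^ m" by (simp add: field_simps)
  moreover have "real (2 * k) / 2 ^ Suc m = real k / 2 ^ m" by simp
  ultimately show ?thesis unfolding dyadic_incr_def by simp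
qed

text \<open>\<open>j div 2 ^ l\<close> is the coarse cell containing the fine cell \<open>j\<close>.
  Writing both integrals on the finer grid makes integrals of different levels comparable cell by
  cell.\<close>

lemma dyadic_integral_refine:
  "dyadic_integral n H M t \<omega> = dyadic_integral (n + l) (\<lambda>j. H (j div 2 ^ l)) M t \<omega>"
proof (induction l)
  case (Suc l)
  obtain N where "t * 2 ^ (n + l) \<le> real N" using real_arch_simple by blast
  then have N: "t \<le> real N / 2 ^ (n + l)" by (simp add: field_simps)
  then have N2: "t \<le> real (2 * N) / 2 ^ Suc (n + l)" by simp
  have S: "(\<Sum>k<2 * N. f k) = (\<Sum>k<N. f (2 * k) + f (Suc (2 * k)))" for f :: "nat \<Rightarrow> real"
    by (induction N) auto
  have "(2 * k) div 2 ^ Suc l = k div 2 ^ l" "Suc (2 * k) div 2 ^ Suc l = k div 2 ^ l" for k :: nat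
    by (auto simp: div_mult2_eq)
  then show ?case
    unfolding Suc.IH add_Suc_right dyadic_integral_eq[OF N] dyadic_integral_eq[OF N2] S
    by (simp only: distrib_left[symmetric] dyadic_incr_refine)
qed simp

lemma continuous_dyadic_integral:
  assumes "continuous_on {0..} (\<lambda>t. M t \<omega>)"
  shows "continuous_on {0..} (\<lambda>t. dyadic_integral n H M t \<omega>)"
proof (rule continuous_on_halflineI)
  fix T :: nat
  have m: "continuous_on {0..real T} (\<lambda>t. M (min c t) \<omega>)" if "0 \<le> c" for c
    by (rule continuous_on_compose2[OF assms]) (use that in \<open>auto intro!: continuous_intros\<close>)
  have "continuous_on {0..real T} (\<lambda>t. \<Sum>k<T * 2 ^ n. H k \<omega> * dyadic_incr M n k t \<omega>)"
    unfolding dyadic_incr_def by (intro continuous_intros m) auto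
  then show "continuous_on {0..real T} (\<lambda>t. dyadic_integral n H M t \<omega>)"
    by (rule continuous_on_eq) (auto intro!: dyadic_integral_eq[symmetric])
qed

text \<open>Left-point sums for the stochastic integral of \<open>M\<close> with respect to
  \<open>M\<close>.\<close>

definition self_integral :: "nat \<Rightarrow> (real \<Rightarrow> 'w \<Rightarrow> real) \<Rightarrow> real \<Rightarrow> 'w \<Rightarrow> real" where
  "self_integral n M = dyadic_integral n (\<lambda>k. M (real k / 2 ^ n)) M"

text \<open>Summation by parts from \<open>b^2 - a^2 = 2 * a * (b - a) + (b - a)^2\<close>. It
  trades square sums, whose convergence is wanted, for martingales, to which the maximal inequality
  applies.\<close>

lemma square_minus_self_integral:
  assumes "0 \<le> t" "t \<le> real N / 2 ^ n"
  shows "(M t \<omega>)\<^sup>2 - (M 0 \<omega>)\<^sup>2 - 2 * self_integral n M t \<omega> = (\<Sum>k<N. (dyadic_incr M n k t \<omega>)\<^sup>2)"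
proof -
  let ?q = "\<lambda>k. (M (min (real k / 2 ^ n) t) \<omega>)\<^sup>2"
  have "?q (Suc k) - ?q k = 2 * (M (real k / 2 ^ n) \<omega> * dyadic_incr M n k t \<omega>) + (dyadic_incr M n k t \<omega>)\<^sup>2" for k
  \<comment> \<open>In a cell beyond \<open>t\<close> the integrand
    \<open>M (real k / 2 ^ n)\<close> is not the stopped value, but the increment it multiplies is
    zero.\<close>
  proof (cases "t \<le> real k / 2 ^ n")
    case True
    then show ?thesis
      using dyadic_incr_0[OF True, of M \<omega>] unfolding dyadic_incr_def by simp
  next
    case False
    then have "min (real k / 2 ^ n) t = real k / 2 ^ n" by simp
    then show ?thesis unfolding dyadic_incr_def by (simp add: power2_eq_square algebra_simps)
  qed
  then have "(\<Sum>k<N. ?q (Suc k) - ?q k) = 2 * self_integral n M t \<omega> + (\<Sum>k<N. (dyadic_incr M n k t \<omega>)\<^sup>2)"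
    unfolding self_integral_def dyadic_integral_eq[OF assms(2)] by (simp add: sum.distrib sum_distrib_left)
  moreover have "(\<Sum>k<N. ?q (Suc k) - ?q k) = (M t \<omega>)\<^sup>2 - (M 0 \<omega>)\<^sup>2"
    using assms by (subst sum_lessThan_telescope[where f="?q"]) simp
  ultimately show ?thesis by simp
qed

context
  fixes M :: "real \<Rightarrow> 'w \<Rightarrow> real" and K :: real
  assumes M: "martingale P F M"
    and K: "\<And>t \<omega>. 0 \<le> t \<Longrightarrow> \<omega> \<in> space P \<Longrightarrow> \<bar>M t \<omega>\<bar> \<le> K"
    and c: "\<And>\<omega>. \<omega> \<in> space P \<Longrightarrow> continuous_on {0..} (\<lambda>t. M t \<omega>)"
begin

text \<open>On the finer grid the difference integrates \<open>H j\<close>, the value of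
  \<open>M\<close> at the start of the coarse cell minus that at the start of the fine cell, which
  is at most the oscillation at scale \<open>n\<close>. The isometry and
  \<open>vanishing_times_square_sum\<close> give a bound uniform in the refinement
  \<open>l\<close>.\<close>

lemma self_integral_Cauchy:
  assumes e: "0 < \<epsilon>"
  shows "\<exists>n0. \<forall>n\<ge>n0. \<forall>l. (\<integral>\<omega>. (self_integral n M (real T) \<omega> - self_integral (n + l) M (real T) \<omega>)\<^sup>2 \<partial>P) \<le> \<epsilon>"
proof -
  have osc: "oscillation M T n \<in> borel_measurable P" for n
    by (rule measurable_oscillation[OF martingale_measurable[OF M] K])
  have osc_b: "0 \<le> oscillation M T n \<omega>" "oscillation M T n \<omega> \<le> 2 * K" if "\<omega> \<in> space P" for n \<omega>
    using oscillation_nonneg[of M \<omega> K] oscillation_le[of M \<omega> K] K that by auto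
  have "\<exists>n0. \<forall>n\<ge>n0. \<forall>u N. incseq u \<and> 0 \<le> u 0 \<longrightarrow>
      (\<integral>\<omega>. (oscillation M T n \<omega>)\<^sup>2 * square_sum M u N \<omega> \<partial>P) \<le> \<epsilon>"
  proof (rule vanishing_times_square_sum[OF M K _ _ _ e])
    show "(\<lambda>\<omega>. (oscillation M T n \<omega>)\<^sup>2) \<in> borel_measurable P" for n using osc by measurable
    show "\<bar>(oscillation M T n \<omega>)\<^sup>2\<bar> \<le> (2 * K)\<^sup>2" if "\<omega> \<in> space P" for n \<omega>
      using power_mono[OF osc_b(2)[OF that, of n] osc_b(1)[OF that, of n], of 2] by simp
    show "AE \<omega> in P. (\<lambda>n. (oscillation M T n \<omega>)\<^sup>2) \<longlonglongrightarrow> 0"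
    proof (rule AE_I2)
      fix \<omega> assume w: "\<omega> \<in> space P"
      have "(\<lambda>n. oscillation M T n \<omega>) \<longlonglongrightarrow> 0" by (rule oscillation_tendsto_0[where M=M and \<omega>=\<omega>, OF K[OF _ w] c[OF w]])
      from tendsto_power[OF this, of 2] show "(\<lambda>n. (oscillation M T n \<omega>)\<^sup>2) \<longlonglongrightarrow> 0" by simp
    qed
  qed
  then obtain n0 where n0: "\<And>n u N. n \<ge> n0 \<Longrightarrow> incseq u \<Longrightarrow> 0 \<le> u 0 \<Longrightarrow>
      (\<integral>\<omega>. (oscillation M T n \<omega>)\<^sup>2 * square_sum M u N \<omega> \<partial>P) \<le> \<epsilon>" by blast
  show ?thesis
  proof (intro exI allI impI)
    fix n l assume n: "n \<ge> n0"
    let ?m = "n + l"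
    define u where "u k = real k / 2 ^ ?m" for k :: nat
    define N where "N = T * 2 ^ ?m"
    have u: "incseq u" "0 \<le> u 0" by (auto simp: u_def incseq_def divide_right_mono)
    define H where "H j \<omega> = M (real (j div 2 ^ l) / 2 ^ n) \<omega> - M (real j / 2 ^ ?m) \<omega>" for j \<omega>
    have le: "real (j div 2 ^ l) / 2 ^ n \<le> real j / 2 ^ ?m" "real j / 2 ^ ?m \<le> real (j div 2 ^ l) / 2 ^ n + 1 / 2 ^ n" for j
    proof -
      have "j div 2 ^ l * 2 ^ l \<le> j" "j \<le> j div 2 ^ l * 2 ^ l + 2 ^ l"
        using div_mult_mod_eq[of j "2 ^ l"] mod_less_divisor[of "2 ^ l" j, OF zero_less_power[OF zero_less_numeral]]
        by linarith+
      then have "real (j div 2 ^ l * 2 ^ l) \<le> real j" "real j \<le> real (j div 2 ^ l * 2 ^ l + 2 ^ l)"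
        by (simp_all only: of_nat_le_iff)
      then show "real (j div 2 ^ l) / 2 ^ n \<le> real j / 2 ^ ?m" "real j / 2 ^ ?m \<le> real (j div 2 ^ l) / 2 ^ n + 1 / 2 ^ n"
        by (simp_all add: field_simps power_add)
    qed
    have HF: "H j \<in> borel_measurable (F (real j / 2 ^ ?m))" for j
      unfolding H_def using le by (intro borel_measurable_diff measurable_F_mono[OF martingale_adapted[OF M]]) auto
    have Hb: "\<bar>H j \<omega>\<bar> \<le> 2 * K" if w: "\<omega> \<in> space P" for j \<omega>
    proof -
      have "\<bar>M (real (j div 2 ^ l) / 2 ^ n) \<omega>\<bar> \<le> K" "\<bar>M (real j / 2 ^ ?m) \<omega>\<bar> \<le> K" using K w by auto
      then show ?thesis unfolding H_def by linarith
    qed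
    have Ho: "\<bar>H j \<omega>\<bar> \<le> oscillation M T n \<omega>" if w: "\<omega> \<in> space P" and j: "j < N" for j \<omega>
    proof -
      have "real j \<le> real N" using j by simp
      then have jT: "real j / 2 ^ ?m \<le> real T" by (simp add: N_def field_simps)
      then have "(real (j div 2 ^ l) / 2 ^ n, real j / 2 ^ ?m) \<in> rational_pairs T n"
        using le[of j] by (auto simp: rational_pairs_def intro!: Rats_divide)
      from oscillation_ge[where M=M and \<omega>=\<omega>, OF K[OF _ w] this] show ?thesis by (simp add: H_def)
    qed
    have TN: "real T \<le> real N / 2 ^ ?m" by (simp add: N_def)
    have incr: "dyadic_incr M ?m k (real T) \<omega> = M (real (Suc k) / 2 ^ ?m) \<omega> - M (real k / 2 ^ ?m) \<omega>" if "k < N" for k \<omega>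
    proof -
      have "real (Suc k) \<le> real N" using that by simp
      then have 1: "real (Suc k) / 2 ^ ?m \<le> real T" by (simp add: N_def field_simps)
      have 2: "real k / 2 ^ ?m \<le> real (Suc k) / 2 ^ ?m" by (intro divide_right_mono) auto
      show ?thesis unfolding dyadic_incr_def
        by (simp only: min_absorb1[OF 1] min_absorb1[OF order_trans[OF 2 1]])
    qed
    have "self_integral n M (real T) \<omega> - self_integral ?m M (real T) \<omega>
      = (\<Sum>k<N. H k \<omega> * (M (real (Suc k) / 2 ^ ?m) \<omega> - M (real k / 2 ^ ?m) \<omega>))" for \<omega>
      unfolding self_integral_def dyadic_integral_refine[of n _ _ _ _ l] dyadic_integral_eq[OF TN]
      by (simp add: incr H_def left_diff_distrib sum_subtractf del: of_nat_Suc)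
    then have "(\<integral>\<omega>. (self_integral n M (real T) \<omega> - self_integral ?m M (real T) \<omega>)\<^sup>2 \<partial>P)
      = (\<integral>\<omega>. (\<Sum>k<N. H k \<omega> * (M (real (Suc k) / 2 ^ ?m) \<omega> - M (real k / 2 ^ ?m) \<omega>))\<^sup>2 \<partial>P)" by simp
    also have "\<dots> = (\<integral>\<omega>. (\<Sum>k<N. (H k \<omega> * (M (real (Suc k) / 2 ^ ?m) \<omega> - M (real k / 2 ^ ?m) \<omega>))\<^sup>2) \<partial>P)"
      by (rule dyadic_isometry[OF M K HF Hb])
    also have "\<dots> \<le> (\<integral>\<omega>. (oscillation M T n \<omega>)\<^sup>2 * square_sum M u N \<omega> \<partial>P)"
    proof (rule integral_mono)
      have [measurable]: "M (real k / 2 ^ ?m) \<in> borel_measurable P" for k using martingale_measurable[OF M] by simp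
      have [measurable]: "H k \<in> borel_measurable P" for k using measurable_F[OF HF] .
      have Sm: "square_sum M u N \<in> borel_measurable P"
        using measurable_F[OF square_sum_second_moment(2)[OF M, where K=K]] K u by auto
      have Sb: "\<bar>square_sum M u N \<omega>\<bar> \<le> real N * (4 * K\<^sup>2)" if "\<omega> \<in> space P" for \<omega>
        using square_sum_second_moment(3)[OF M, where K=K] K u that by auto
      show "integrable P (\<lambda>\<omega>. (oscillation M T n \<omega>)\<^sup>2 * square_sum M u N \<omega>)"
      proof (rule integrable_bounded_mult[OF integrable_bounded[OF Sm Sb]])
        show "(\<lambda>\<omega>. (oscillation M T n \<omega>)\<^sup>2) \<in> borel_measurable P" using osc by measurable
        show "\<bar>(oscillation M T n \<omega>)\<^sup>2\<bar> \<le> (2 * K)\<^sup>2" if "\<omega> \<in> space P" for \<omega>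
          using power_mono[OF osc_b(2)[OF that, of n] osc_b(1)[OF that, of n], of 2] by simp
      qed
      show pw: "(\<Sum>k<N. (H k \<omega> * (M (real (Suc k) / 2 ^ ?m) \<omega> - M (real k / 2 ^ ?m) \<omega>))\<^sup>2)
         \<le> (oscillation M T n \<omega>)\<^sup>2 * square_sum M u N \<omega>" if w: "\<omega> \<in> space P" for \<omega>
        unfolding square_sum_def u_def sum_distrib_left power_mult_distrib
      proof (intro sum_mono mult_right_mono)
        fix k assume "k \<in> {..<N}"
        then have "\<bar>H k \<omega>\<bar> \<le> \<bar>oscillation M T n \<omega>\<bar>" using Ho[OF w, of k] osc_b(1)[OF w, of n] by simp
        then show "(H k \<omega>)\<^sup>2 \<le> (oscillation M T n \<omega>)\<^sup>2" by (simp add: abs_le_square_iff)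
      qed simp
      show "integrable P (\<lambda>\<omega>. \<Sum>k<N. (H k \<omega> * (M (real (Suc k) / 2 ^ ?m) \<omega> - M (real k / 2 ^ ?m) \<omega>))\<^sup>2)"
      proof (rule integrable_bounded)
        fix \<omega> assume w: "\<omega> \<in> space P"
        have "(oscillation M T n \<omega>)\<^sup>2 * square_sum M u N \<omega> \<le> (2 * K)\<^sup>2 * (real N * (4 * K\<^sup>2))"
          using abs_le_D1[OF Sb[OF w]] osc_b[OF w, of n]
          by (intro mult_mono power_mono) (auto simp: square_sum_def sum_nonneg)
        then show "\<bar>\<Sum>k<N. (H k \<omega> * (M (real (Suc k) / 2 ^ ?m) \<omega> - M (real k / 2 ^ ?m) \<omega>))\<^sup>2\<bar>
          \<le> (2 * K)\<^sup>2 * (real N * (4 * K\<^sup>2))"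
          using pw[OF w] by (subst abs_of_nonneg) (auto intro: sum_nonneg)
      qed measurable
    qed
    also have "\<dots> \<le> \<epsilon>" by (rule n0[OF n u])
    finally show "(\<integral>\<omega>. (self_integral n M (real T) \<omega> - self_integral (n + l) M (real T) \<omega>)\<^sup>2 \<partial>P) \<le> \<epsilon>" .
  qed
qed

lemma martingale_self_integral: "martingale P F (self_integral n M)"
  unfolding self_integral_def
  by (rule martingale_dyadic_integral[OF M, where C="\<lambda>_. K"])
     (use K martingale_adapted[OF M] in auto)

lemma self_integral_bounded:
  assumes "0 \<le> t" "\<omega> \<in> space P" "t \<le> real N / 2 ^ n"
  shows "\<bar>self_integral n M t \<omega>\<bar> \<le> real N * (K * (2 * K))"
proof -
  have b: "\<bar>M (real k / 2 ^ n) \<omega> * dyadic_incr M n k t \<omega>\<bar> \<le> K * (2 * K)" for k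
  proof -
    have "\<bar>M (min (real (Suc k) / 2 ^ n) t) \<omega>\<bar> \<le> K" "\<bar>M (min (real k / 2 ^ n) t) \<omega>\<bar> \<le> K"
      using K assms(1,2) by auto
    then have "\<bar>dyadic_incr M n k t \<omega>\<bar> \<le> 2 * K" unfolding dyadic_incr_def by linarith
    moreover have "\<bar>M (real k / 2 ^ n) \<omega>\<bar> \<le> K" using K assms(2) by auto
    ultimately show ?thesis unfolding abs_mult by (intro mult_mono') auto
  qed
  have "\<bar>self_integral n M t \<omega>\<bar> \<le> (\<Sum>k<N. \<bar>M (real k / 2 ^ n) \<omega> * dyadic_incr M n k t \<omega>\<bar>)"
    unfolding self_integral_def dyadic_integral_eq[OF assms(3)] by (rule sum_abs)
  also have "\<dots> \<le> real N * (K * (2 * K))"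
    using sum_bounded_above[of "{..<N}" "\<lambda>k. \<bar>M (real k / 2 ^ n) \<omega> * dyadic_incr M n k t \<omega>\<bar>" "K * (2 * K)"] b by simp
  finally show ?thesis .
qed

text \<open>\<open>A\<close> is \<open>M^2\<close> minus its initial value minus twice the limit of
  \<open>self_integral\<close>. Continuity comes from locally uniform convergence along a
  subsequence of levels, monotonicity from the square sums, which do not decrease along grid
  points.\<close>

theorem quadratic_variation_exists:
  obtains A where "\<And>t. 0 \<le> t \<Longrightarrow> A t \<in> borel_measurable (F t)"
    "martingale P F (\<lambda>t \<omega>. (M t \<omega>)\<^sup>2 - A t \<omega>)"
    "AE \<omega> in P. A 0 \<omega> = 0 \<and> continuous_on {0..} (\<lambda>t. A t \<omega>) \<and> mono_on {0..} (\<lambda>t. A t \<omega>)"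
proof -
  \<comment> \<open>The L1 distance at time \<open>k\<close> becomes at most
    \<open>(1 / 4) ^ k\<close>. The maximal inequality at threshold \<open>(1 / 2) ^ k\<close> then
    leaves an exceptional set of measure at most \<open>(1 / 2) ^ k\<close>, and both thresholds and
    measures are summable.\<close>
  have "\<exists>n0. \<forall>n\<ge>n0. \<forall>l. (\<integral>\<omega>. (self_integral n M (real T) \<omega> - self_integral (n + l) M (real T) \<omega>)\<^sup>2 \<partial>P) \<le> ((1 / 4) ^ T)\<^sup>2" for T
    by (rule self_integral_Cauchy) simp
  then obtain N where N: "\<And>T n l. n \<ge> N T \<Longrightarrow>
      (\<integral>\<omega>. (self_integral n M (real T) \<omega> - self_integral (n + l) M (real T) \<omega>)\<^sup>2 \<partial>P) \<le> ((1 / 4) ^ T)\<^sup>2"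
    by metis
  \<comment> \<open>The maximum with \<open>i\<close> ensures \<open>r k \<ge> k\<close>, so every
    dyadic point eventually belongs to the grids used.\<close>
  define r where "r k = (\<Sum>i\<le>k. max i (N i))" for k :: nat
  have rN: "r k \<ge> max k (N k)" for k unfolding r_def by (rule member_le_sum) auto
  have rS: "r (Suc k) = r k + max (Suc k) (N (Suc k))" for k unfolding r_def by simp
  define W where "W k t \<omega> = self_integral (r (Suc k)) M t \<omega> - self_integral (r k) M t \<omega>" for k t \<omega>
  have W: "martingale P F (W k)" for k
    unfolding W_def by (intro martingale_diff martingale_self_integral)
  have cI: "continuous_on {0..} (\<lambda>t. self_integral n M t \<omega>)" if "\<omega> \<in> space P" for n \<omega>
    unfolding self_integral_def by (rule continuous_dyadic_integral[where M=M and \<omega>=\<omega>, OF c[OF that]])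
  have cW: "continuous_on {0..} (\<lambda>t. W k t \<omega>)" if "\<omega> \<in> space P" for k \<omega>
    unfolding W_def using cI[OF that] by (intro continuous_on_diff)
  have W1: "(\<integral>\<omega>. \<bar>W k (real k) \<omega>\<bar> \<partial>P) \<le> (1 / 4) ^ k" for k
  proof (rule integral_abs_le_square)
    show "(\<integral>\<omega>. (W k (real k) \<omega>)\<^sup>2 \<partial>P) \<le> ((1 / 4) ^ k)\<^sup>2"
      using N[of k "r k" "max (Suc k) (N (Suc k))"] rN[of k] unfolding W_def rS
      by (simp add: power2_commute)
    show "integrable P (W k (real k))" using martingale_integrable[OF W] by simp
    show "integrable P (\<lambda>\<omega>. (W k (real k) \<omega>)\<^sup>2)"
    proof (rule integrable_bounded)
      show "(\<lambda>\<omega>. (W k (real k) \<omega>)\<^sup>2) \<in> borel_measurable P" using martingale_measurable[OF W, of "real k"] by simp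
      fix \<omega> assume w: "\<omega> \<in> space P"
      let ?B = "real (k * 2 ^ r (Suc k)) * (K * (2 * K)) + real (k * 2 ^ r k) * (K * (2 * K))"
      have "\<bar>W k (real k) \<omega>\<bar> \<le> ?B"
        using self_integral_bounded[OF _ w, of "real k" "k * 2 ^ r (Suc k)" "r (Suc k)"]
          self_integral_bounded[OF _ w, of "real k" "k * 2 ^ r k" "r k"] unfolding W_def by simp
      then have "\<bar>W k (real k) \<omega>\<bar> \<le> \<bar>?B\<bar>" by linarith
      then show "\<bar>(W k (real k) \<omega>)\<^sup>2\<bar> \<le> ?B\<^sup>2" by (simp only: abs_le_square_iff abs_power2)
    qed
  qed simp
  have "\<exists>B. B \<in> sets P \<and> measure P B \<le> (1 / 2) ^ k \<and>
      (\<forall>\<omega>\<in>space P - B. \<forall>t. 0 \<le> t \<and> t \<le> real k \<longrightarrow> \<bar>W k t \<omega>\<bar> \<le> (1 / 2) ^ k)" for k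
  proof -
    obtain B where B: "B \<in> sets P" "measure P B \<le> (\<integral>\<omega>. \<bar>W k (real k) \<omega>\<bar> \<partial>P) / (1 / 2) ^ k"
      "\<And>\<omega> t. \<omega> \<in> space P - B \<Longrightarrow> 0 \<le> t \<Longrightarrow> t \<le> real k \<Longrightarrow> \<bar>W k t \<omega>\<bar> \<le> (1 / 2) ^ k"
      using martingale_maximal[OF W[of k] cW, of "(1 / 2) ^ k" k] by (metis zero_less_power half_gt_zero_iff zero_less_one)
    have "(\<integral>\<omega>. \<bar>W k (real k) \<omega>\<bar> \<partial>P) / (1 / 2) ^ k \<le> (1 / 4) ^ k / (1 / 2) ^ k"
      by (intro divide_right_mono W1) auto
    also have "\<dots> = (1 / 2) ^ k" by (simp add: power_divide[symmetric])
    finally show ?thesis using B by (intro exI[of _ B]) auto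
  qed
  then obtain B where B: "\<And>k. B k \<in> sets P" "\<And>k. measure P (B k) \<le> (1 / 2) ^ k"
    "\<And>k \<omega> t. \<omega> \<in> space P - B k \<Longrightarrow> 0 \<le> t \<Longrightarrow> t \<le> real k \<Longrightarrow> \<bar>W k t \<omega>\<bar> \<le> (1 / 2) ^ k"
    by metis
  have ae: "AE \<omega> in P. \<forall>\<^sub>F k in sequentially. \<omega> \<in> space P - B k"
  proof (rule borel_cantelli_AE1)
    show "summable (\<lambda>k. measure P (B k))"
      by (rule summable_comparison_test'[of "\<lambda>k. (1 / 2) ^ k" 0]) (use B(2) in \<open>auto intro: summable_geometric\<close>)
  qed (use B(1) in \<open>auto simp: emeasure_eq_measure\<close>)
  \<comment> \<open>\<open>lim\<close> is applied on every path, convergent or not, so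
    \<open>Z t\<close> is \<open>F t\<close>-measurable without adding null sets to the
    filtration.\<close>
  define Z where "Z t \<omega> = lim (\<lambda>k. self_integral (r k) M t \<omega>)" for t \<omega>
  have ZF: "Z t \<in> borel_measurable (F t)" if "0 \<le> t" for t
    unfolding Z_def using martingale_adapted[OF martingale_self_integral that] by measurable
  have good: "(\<forall>t\<ge>0. (\<lambda>k. self_integral (r k) M t \<omega>) \<longlonglongrightarrow> Z t \<omega>) \<and> continuous_on {0..} (\<lambda>t. Z t \<omega>)"
    if w: "\<omega> \<in> space P" "\<forall>\<^sub>F k in sequentially. \<omega> \<in> space P - B k" for \<omega>
  proof -
    obtain k0 where "\<And>k. k \<ge> k0 \<Longrightarrow> \<omega> \<in> space P - B k" using w(2) by (auto simp: eventually_sequentially)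
    then have "\<bar>self_integral (r (Suc k)) M t \<omega> - self_integral (r k) M t \<omega>\<bar> \<le> (1 / 2) ^ k"
      if "k \<ge> k0" "0 \<le> t" "t \<le> real k" for k t
      using B(3)[of \<omega> k t] that by (simp add: W_def)
    from uniform_telescoping[where f="\<lambda>k t. self_integral (r k) M t \<omega>", OF cI[OF w(1)] this]
    show ?thesis unfolding Z_def by blast
  qed
  \<comment> \<open>At a fixed time the same estimates serve, since \<open>W k t\<close> has no
    larger L1 norm than \<open>W k (real k)\<close> as soon as
    \<open>t \<le> real k\<close>.\<close>
  have L1: "integrable P (Z t) \<and> (\<lambda>k. \<integral>\<omega>. \<bar>self_integral (r k) M t \<omega> - Z t \<omega>\<bar> \<partial>P) \<longlonglongrightarrow> 0" if t: "0 \<le> t" for t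
  proof -
    obtain T :: nat where T: "t \<le> real T" using real_arch_simple by blast
    have le: "(\<integral>\<omega>. \<bar>W k t \<omega>\<bar> \<partial>P) \<le> (1 / 4) ^ k" if "k \<ge> T" for k
    proof -
      have "t \<le> real k" using T that by simp
      then have "(\<integral>\<omega>. \<bar>W k t \<omega>\<bar> \<partial>P) \<le> (\<integral>\<omega>. \<bar>W k (real k) \<omega>\<bar> \<partial>P)"
        using martingale_excess_mono[OF W t, of "real k" "space P" 0 k] sets.top[of "F t"]
        by (simp add: space_F cong: Bochner_Integration.integral_cong)
      then show ?thesis using W1[of k] by simp
    qed
    have "summable (\<lambda>k. \<integral>\<omega>. \<bar>W k t \<omega>\<bar> \<partial>P)"
      by (rule summable_comparison_test'[of "\<lambda>k. (1 / 4) ^ k" T])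
         (use le in \<open>auto intro!: summable_geometric simp: abs_of_nonneg integral_nonneg_AE\<close>)
    then have S: "summable (\<lambda>k. \<integral>\<omega>. \<bar>self_integral (r (Suc k)) M t \<omega> - self_integral (r k) M t \<omega>\<bar> \<partial>P)"
      by (simp add: W_def)
    show ?thesis
      using summable_L1_differences(2,3)[where Z="\<lambda>k. self_integral (r k) M t",
          OF martingale_integrable[OF martingale_self_integral t] S]
      unfolding Z_def[symmetric] by auto
  qed
  have Zm: "martingale P F Z"
    using L1 by (intro martingale_L1_limit[where M="\<lambda>k. self_integral (r k) M", OF martingale_self_integral ZF]) auto
  define A where "A t \<omega> = (M t \<omega>)\<^sup>2 - (M 0 \<omega>)\<^sup>2 - 2 * Z t \<omega>" for t \<omega>
  have M0F: "M 0 \<in> borel_measurable (F t)" if "0 \<le> t" for t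
    using measurable_F_mono[OF martingale_adapted[OF M order_refl] that] .
  show ?thesis
  proof (rule that[of A])
    show "A t \<in> borel_measurable (F t)" if "0 \<le> t" for t
      unfolding A_def using martingale_adapted[OF M that] M0F[OF that] ZF[OF that]
      by (intro borel_measurable_diff borel_measurable_times borel_measurable_power) auto
    have 0: "martingale P F (\<lambda>t \<omega>. (M 0 \<omega>)\<^sup>2)"
    proof (rule martingale_const)
      show "(\<lambda>\<omega>. (M 0 \<omega>)\<^sup>2) \<in> borel_measurable (F 0)" using M0F[of 0] by simp
      show "integrable P (\<lambda>\<omega>. (M 0 \<omega>)\<^sup>2)"
      proof (rule integrable_bounded)
        show "(\<lambda>\<omega>. (M 0 \<omega>)\<^sup>2) \<in> borel_measurable P" using measurable_F[OF M0F[of 0]] by simp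
        show "\<bar>(M 0 \<omega>)\<^sup>2\<bar> \<le> K\<^sup>2" if "\<omega> \<in> space P" for \<omega>
          using K[OF order_refl that] by (simp add: abs_le_square_iff[symmetric])
      qed
    qed
    have "martingale P F (\<lambda>t \<omega>. (M 0 \<omega>)\<^sup>2 + 2 * Z t \<omega>)"
      by (intro martingale_add 0 martingale_cmult Zm)
    moreover have "(\<lambda>t \<omega>. (M 0 \<omega>)\<^sup>2 + 2 * Z t \<omega>) = (\<lambda>t \<omega>. (M t \<omega>)\<^sup>2 - A t \<omega>)"
      by (auto simp: A_def)
    ultimately show "martingale P F (\<lambda>t \<omega>. (M t \<omega>)\<^sup>2 - A t \<omega>)" by simp
    show "AE \<omega> in P. A 0 \<omega> = 0 \<and> continuous_on {0..} (\<lambda>t. A t \<omega>) \<and> mono_on {0..} (\<lambda>t. A t \<omega>)"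
      using ae AE_space
    proof eventually_elim
      case (elim \<omega>)
      note g = good[OF elim(2,1)]
      have lim: "(\<lambda>k. self_integral (r k) M t \<omega>) \<longlonglongrightarrow> Z t \<omega>" if "0 \<le> t" for t using g that by auto
      have "self_integral n M 0 \<omega> = 0" for n by (simp add: self_integral_def dyadic_integral_def)
      with lim[of 0] have Z0: "Z 0 \<omega> = 0" by (simp add: LIMSEQ_const_iff)
      have cA: "continuous_on {0..} (\<lambda>t. A t \<omega>)"
        unfolding A_def using g c[OF elim(2)] by (intro continuous_intros) auto
      have Alim: "(\<lambda>k. (M t \<omega>)\<^sup>2 - (M 0 \<omega>)\<^sup>2 - 2 * self_integral (r k) M t \<omega>) \<longlonglongrightarrow> A t \<omega>" if "0 \<le> t" for t
        unfolding A_def by (intro tendsto_intros lim that)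
      \<comment> \<open>A square sum stopped between grid points need not be monotone, so the
        earlier time is taken dyadic: from level \<open>l\<close> on it is a grid point, and the sum
        up to it is a part of the sum up to \<open>t\<close>. Continuity of \<open>A\<close> extends
        the comparison to all earlier times.\<close>
      have dyadic: "A (real i / 2 ^ l) \<omega> \<le> A t \<omega>" if t: "real i / 2 ^ l \<le> t" for i l t
      proof (rule LIMSEQ_le[OF Alim Alim])
        have t0: "0 \<le> t" using t by (meson divide_nonneg_nonneg of_nat_0_le_iff order_trans zero_le_numeral zero_le_power)
        then show "0 \<le> t" .
        show "0 \<le> real i / 2 ^ l" by simp
        show "\<exists>N. \<forall>k\<ge>N. (M (real i / 2 ^ l) \<omega>)\<^sup>2 - (M 0 \<omega>)\<^sup>2 - 2 * self_integral (r k) M (real i / 2 ^ l) \<omega>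
            \<le> (M t \<omega>)\<^sup>2 - (M 0 \<omega>)\<^sup>2 - 2 * self_integral (r k) M t \<omega>"
        proof (intro exI allI impI)
          fix k assume "k \<ge> l"
          then have "r k \<ge> l" using rN[of k] by simp
          then obtain m where m: "r k = l + m" using le_Suc_ex by blast
          define j where "j = i * 2 ^ m"
          have ij: "real i / 2 ^ l = real j / 2 ^ r k" by (simp add: j_def m power_add)
          obtain N' where "t * 2 ^ r k \<le> real N'" using real_arch_simple by blast
          then have tN: "t \<le> real N' / 2 ^ r k" by (simp add: field_simps)
          with t have "real j / 2 ^ r k \<le> real N' / 2 ^ r k" unfolding ij by simp
          then have jN: "j \<le> N'" by (simp add: divide_le_cancel)
          have "(\<Sum>k'<j. (dyadic_incr M (r k) k' (real j / 2 ^ r k) \<omega>)\<^sup>2)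
            = (\<Sum>k'<j. (dyadic_incr M (r k) k' t \<omega>)\<^sup>2)"
          proof (intro sum.cong refl)
            fix k' assume "k' \<in> {..<j}"
            then have "real (Suc k') \<le> real j" by simp
            then have 1: "real (Suc k') / 2 ^ r k \<le> real j / 2 ^ r k" by (intro divide_right_mono) auto
            have 2: "real k' / 2 ^ r k \<le> real (Suc k') / 2 ^ r k" by (intro divide_right_mono) auto
            have 3: "real j / 2 ^ r k \<le> t" using t ij by simp
            have "dyadic_incr M (r k) k' s \<omega> = M (real (Suc k') / 2 ^ r k) \<omega> - M (real k' / 2 ^ r k) \<omega>"
              if "real j / 2 ^ r k \<le> s" for s
              unfolding dyadic_incr_def
              by (simp only: min_absorb1[OF order_trans[OF 1 that]] min_absorb1[OF order_trans[OF 2 order_trans[OF 1 that]]])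
            from this[OF order_refl] this[OF 3]
            show "(dyadic_incr M (r k) k' (real j / 2 ^ r k) \<omega>)\<^sup>2 = (dyadic_incr M (r k) k' t \<omega>)\<^sup>2" by simp
          qed
          also have "\<dots> \<le> (\<Sum>k'<N'. (dyadic_incr M (r k) k' t \<omega>)\<^sup>2)"
            using jN by (intro sum_mono2) auto
          finally show "(M (real i / 2 ^ l) \<omega>)\<^sup>2 - (M 0 \<omega>)\<^sup>2 - 2 * self_integral (r k) M (real i / 2 ^ l) \<omega>
            \<le> (M t \<omega>)\<^sup>2 - (M 0 \<omega>)\<^sup>2 - 2 * self_integral (r k) M t \<omega>"
            unfolding ij square_minus_self_integral[OF t0 tN]
            by (subst square_minus_self_integral[where N=j]) auto
        qed
      qed
      have "A s \<omega> \<le> A t \<omega>" if st: "0 \<le> s" "s \<le> t" for s t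
      proof -
        have "(\<lambda>l. A (dyadic_floor l s) \<omega>) \<longlonglongrightarrow> A s \<omega>"
          by (rule continuous_on_halfline_tendsto[OF cA st(1) dyadic_floor_tendsto[OF st(1)]])
             (rule dyadic_floor_bounds(3)[OF st(1)])
        moreover have "A (dyadic_floor l s) \<omega> \<le> A t \<omega>" for l
          using dyadic[of "nat \<lfloor>s * 2 ^ l\<rfloor>" l t] dyadic_floor_bounds(1)[OF st(1), of l] st
          by (simp add: dyadic_floor_def)
        ultimately show ?thesis by (intro LIMSEQ_le_const2) auto
      qed
      then show ?case using Z0 cA by (auto simp: A_def mono_on_def)
    qed
  qed
qed

end

end

section \<open>Trace-free second-order expansions\<close>

text \<open>Rounding up to a level \<open>l \<ge> n + 1\<close> makes both times rational and
  changes their distance by at most \<open>1 / 2 ^ (n + 1)\<close>, which is why the distance is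
  assumed half as large as scale \<open>n\<close> allows. The margin of \<open>1\<close> below the
  horizon leaves room for the rounding.\<close>

lemma oscillation_ge_real:
  assumes K: "\<And>t. 0 \<le> t \<Longrightarrow> \<bar>M t \<omega>\<bar> \<le> K" and c: "continuous_on {0..} (\<lambda>t. M t \<omega>)"
    and pq: "0 \<le> p" "p + 1 \<le> real T" "0 \<le> q" "q + 1 \<le> real T" "\<bar>p - q\<bar> \<le> 1 / 2 ^ Suc n"
  shows "\<bar>M p \<omega> - M q \<omega>\<bar> \<le> oscillation M T n \<omega>"
proof (rule LIMSEQ_le_const2)
  have nonneg: "0 \<le> dyadic_ceiling l r" if "0 \<le> r" for l r
    using dyadic_ceiling_bounds(1)[OF that, of l] that by simp
  show "(\<lambda>l. \<bar>M (dyadic_ceiling l p) \<omega> - M (dyadic_ceiling l q) \<omega>\<bar>) \<longlonglongrightarrow> \<bar>M p \<omega> - M q \<omega>\<bar>"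
    using pq nonneg
    by (intro tendsto_rabs tendsto_diff continuous_on_halfline_tendsto[OF c] dyadic_ceiling_tendsto) auto
  show "\<exists>N. \<forall>l\<ge>N. \<bar>M (dyadic_ceiling l p) \<omega> - M (dyadic_ceiling l q) \<omega>\<bar> \<le> oscillation M T n \<omega>"
  proof (intro exI allI impI)
    fix l assume l: "l \<ge> n + 1"
    then have "(2::real) ^ (n + 1) \<le> 2 ^ l" by (intro power_increasing) auto
    then have "1 / (2::real) ^ l \<le> 1 / 2 ^ (n + 1)" by (intro divide_left_mono) auto
    moreover have "1 / (2::real) ^ n = 1 / 2 ^ Suc n + 1 / 2 ^ (n + 1)" by (simp add: field_simps)
    ultimately have "\<bar>dyadic_ceiling l p - dyadic_ceiling l q\<bar> \<le> 1 / 2 ^ n"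
      using dyadic_ceiling_bounds[OF pq(1), of l] dyadic_ceiling_bounds[OF pq(3), of l] pq(5) by linarith
    moreover have "1 / (2::real) ^ l \<le> 1" by simp
    then have "dyadic_ceiling l p \<le> real T" "dyadic_ceiling l q \<le> real T"
      using dyadic_ceiling_bounds(2)[OF pq(1), of l] dyadic_ceiling_bounds(2)[OF pq(3), of l] pq by linarith+
    moreover have "dyadic_ceiling l r \<in> \<rat>" for r unfolding dyadic_ceiling_def by (intro Rats_divide) auto
    ultimately have "(dyadic_ceiling l p, dyadic_ceiling l q) \<in> rational_pairs T n"
      using nonneg pq by (auto simp: rational_pairs_def)
    from oscillation_ge[where M=M and \<omega>=\<omega>, OF K this]
    show "\<bar>M (dyadic_ceiling l p) \<omega> - M (dyadic_ceiling l q) \<omega>\<bar> \<le> oscillation M T n \<omega>" by simp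
  qed
qed

lemma borel_measurable_vecI:
  fixes f :: "'a \<Rightarrow> real ^ 'd"
  assumes "\<And>i. (\<lambda>x. f x $ i) \<in> borel_measurable M"
  shows "f \<in> borel_measurable M"
  unfolding borel_measurable_euclidean_space[of f]
  using assms by (auto simp: Basis_vec_def inner_axis)

context filtered_prob_space
begin

lemma martingale_increment_zero:
  assumes M: "martingale P F M" and st: "0 \<le> s" "s \<le> t" and H: "H \<in> borel_measurable (F s)"
    and C: "\<And>\<omega>. \<omega> \<in> space P \<Longrightarrow> \<bar>H \<omega>\<bar> \<le> C"
  shows "integrable P (\<lambda>\<omega>. H \<omega> * (M t \<omega> - M s \<omega>))" "(\<integral>\<omega>. H \<omega> * (M t \<omega> - M s \<omega>) \<partial>P) = 0"
proof -
  have t: "0 \<le> t" using st by simp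
  have i: "integrable P (\<lambda>\<omega>. H \<omega> * M r \<omega>)" if "0 \<le> r" for r
    by (rule integrable_bounded_mult[OF martingale_integrable[OF M that] measurable_F[OF H] C])
  show "integrable P (\<lambda>\<omega>. H \<omega> * (M t \<omega> - M s \<omega>))" using i[OF st(1)] i[OF t] by (simp add: right_diff_distrib)
  show "(\<integral>\<omega>. H \<omega> * (M t \<omega> - M s \<omega>) \<partial>P) = 0"
    using i[OF st(1)] i[OF t] martingale_mult_bounded[OF M st H C] by (simp add: right_diff_distrib)
qed

text \<open>Expanding the product of increments produces \<open>H * M s\<close> and
  \<open>H * N s\<close> as new weights known at time \<open>s\<close>. The process \<open>V\<close>
  is any compensator of the product, not only a bracket: below it is zero or the square of a
  reference coordinate.\<close>

lemma product_increment_zero: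
  assumes M: "martingale P F M" "martingale P F N"
    and MN: "martingale P F (\<lambda>t \<omega>. M t \<omega> * N t \<omega> - V t \<omega>)"
    and K: "\<And>t \<omega>. 0 \<le> t \<Longrightarrow> \<omega> \<in> space P \<Longrightarrow> \<bar>M t \<omega>\<bar> \<le> K" "\<And>t \<omega>. 0 \<le> t \<Longrightarrow> \<omega> \<in> space P \<Longrightarrow> \<bar>N t \<omega>\<bar> \<le> K"
    and st: "0 \<le> s" "s \<le> t" and H: "H \<in> borel_measurable (F s)"
    and C: "\<And>\<omega>. \<omega> \<in> space P \<Longrightarrow> \<bar>H \<omega>\<bar> \<le> C"
  shows "integrable P (\<lambda>\<omega>. H \<omega> * ((M t \<omega> - M s \<omega>) * (N t \<omega> - N s \<omega>) - (V t \<omega> - V s \<omega>)))"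
    "(\<integral>\<omega>. H \<omega> * ((M t \<omega> - M s \<omega>) * (N t \<omega> - N s \<omega>) - (V t \<omega> - V s \<omega>)) \<partial>P) = 0"
proof -
  have b: "\<bar>H \<omega> * M s \<omega>\<bar> \<le> C * K" "\<bar>H \<omega> * N s \<omega>\<bar> \<le> C * K" if "\<omega> \<in> space P" for \<omega>
    unfolding abs_mult using C[OF that] K(1)[OF st(1) that] K(2)[OF st(1) that] by (intro mult_mono'; simp)+
  have m: "(\<lambda>\<omega>. H \<omega> * Y s \<omega>) \<in> borel_measurable (F s)" if "martingale P F Y" for Y
    using H martingale_adapted[OF that st(1)] by simp
  note z0 = martingale_increment_zero[OF MN st H C]
  note z1 = martingale_increment_zero[OF M(2) st m[OF M(1)] b(1)]
  note z2 = martingale_increment_zero[OF M(1) st m[OF M(2)] b(2)]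
  have e: "H \<omega> * ((M t \<omega> - M s \<omega>) * (N t \<omega> - N s \<omega>) - (V t \<omega> - V s \<omega>))
    = H \<omega> * (M t \<omega> * N t \<omega> - V t \<omega> - (M s \<omega> * N s \<omega> - V s \<omega>)) - H \<omega> * M s \<omega> * (N t \<omega> - N s \<omega>)
      - H \<omega> * N s \<omega> * (M t \<omega> - M s \<omega>)" for \<omega>
    by (simp add: algebra_simps)
  show "integrable P (\<lambda>\<omega>. H \<omega> * ((M t \<omega> - M s \<omega>) * (N t \<omega> - N s \<omega>) - (V t \<omega> - V s \<omega>)))"
    unfolding e using z0(1) z1(1) z2(1) by (intro Bochner_Integration.integrable_diff) auto
  show "(\<integral>\<omega>. H \<omega> * ((M t \<omega> - M s \<omega>) * (N t \<omega> - N s \<omega>) - (V t \<omega> - V s \<omega>)) \<partial>P) = 0"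
    unfolding e using z0 z1 z2 by (simp add: Bochner_Integration.integrable_diff)
qed

text \<open>Ito's formula without a bracket: when the second-order coefficients have trace zero, only the
  martingales \<open>X\<^sub>i X\<^sub>j\<close> and \<open>X\<^sub>i\<^sup>2 - X\<^sub>c\<^sup>2\<close> enter the second-order term of the Taylor expansion
  along a partition, and its expectation vanishes.\<close>

lemma trace_free_martingale:
  fixes X :: "real \<Rightarrow> 'w \<Rightarrow> real ^ 'd" and f :: "real ^ 'd \<Rightarrow> real"
    and G :: "real ^ 'd \<Rightarrow> 'd \<Rightarrow> real" and H :: "real ^ 'd \<Rightarrow> 'd \<Rightarrow> 'd \<Rightarrow> real"
  assumes X: "\<And>i. martingale P F (\<lambda>t \<omega>. X t \<omega> $ i)"
    and XX: "\<And>i j. i \<noteq> j \<Longrightarrow> martingale P F (\<lambda>t \<omega>. X t \<omega> $ i * X t \<omega> $ j)"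
    and X2: "\<And>i. martingale P F (\<lambda>t \<omega>. (X t \<omega> $ i)\<^sup>2 - (X t \<omega> $ c)\<^sup>2)"
    and K: "\<And>i t \<omega>. 0 \<le> t \<Longrightarrow> \<omega> \<in> space P \<Longrightarrow> \<bar>X t \<omega> $ i\<bar> \<le> K"
    and cont: "\<And>i \<omega>. \<omega> \<in> space P \<Longrightarrow> continuous_on {0..} (\<lambda>t. X t \<omega> $ i)"
    and R: "AE \<omega> in P. \<forall>t\<ge>0. X t \<omega> \<in> R"
    and f: "f \<in> borel_measurable borel" "\<And>x. x \<in> R \<Longrightarrow> \<bar>f x\<bar> \<le> B"
    and G: "\<And>i. (\<lambda>x. G x i) \<in> borel_measurable borel" "\<And>i x. \<bar>G x i\<bar> \<le> B"
    and H: "\<And>i j. (\<lambda>x. H x i j) \<in> borel_measurable borel" "\<And>i j x. \<bar>H x i j\<bar> \<le> B"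
    and tr: "\<And>x. (\<Sum>i\<in>UNIV. H x i i) = 0"
    and C: "0 \<le> C"
    and taylor: "\<And>x y. x \<in> R \<Longrightarrow> y \<in> R \<Longrightarrow>
      \<bar>f y - f x - (\<Sum>i\<in>UNIV. G x i * (y $ i - x $ i))
        - (\<Sum>i\<in>UNIV. \<Sum>j\<in>UNIV. H x i j * ((y $ i - x $ i) * (y $ j - x $ j)))\<bar> \<le> C * norm (y - x) ^ 3"
  shows "martingale P F (\<lambda>t \<omega>. f (X t \<omega>))"
proof (rule martingaleI)
  have XF: "X t \<in> borel_measurable (F s)" if "0 \<le> t" "t \<le> s" for t s
    by (rule borel_measurable_vecI, rule measurable_F_mono[OF martingale_adapted[OF X that(1)] that(2)])
  show adf: "(\<lambda>\<omega>. f (X t \<omega>)) \<in> borel_measurable (F t)" if "0 \<le> t" for t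
    using measurable_compose[OF XF[OF that order_refl] f(1)] .
  show fi: "integrable P (\<lambda>\<omega>. f (X t \<omega>))" if t: "0 \<le> t" for t
    by (rule integrable_const_bound[where B=B])
       (use R f(2) t measurable_F[OF adf[OF t]] in \<open>auto elim!: eventually_mono\<close>)
  fix s t A assume st: "0 \<le> s" "s \<le> t" "A \<in> sets (F s)"
  have t: "0 \<le> t" using st by simp
  note AP = indicator_F[OF st(3)]
  define I where "I r = (\<integral>\<omega>. indicator A \<omega> * f (X r \<omega>) \<partial>P)" for r
  \<comment> \<open>The extra unit of time and, further on, the mesh \<open>1 / 2 ^ Suc n\<close>
    are what \<open>oscillation_ge_real\<close> asks for.\<close>
  obtain T :: nat where T: "t + 1 \<le> real T" using real_arch_simple by blast
  define g where "g n \<omega> = (\<Sum>i\<in>UNIV. oscillation (\<lambda>t \<omega>. X t \<omega> $ i) T n \<omega>)" for n \<omega>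
  let ?o = "\<lambda>i. oscillation (\<lambda>t \<omega>. X t \<omega> $ i) T"
  have om: "?o i n \<in> borel_measurable P" for i n
    by (rule measurable_oscillation[OF martingale_measurable[OF X] K])
  have gm: "g n \<in> borel_measurable P" for n unfolding g_def using om by (intro borel_measurable_sum) auto
  have ob: "0 \<le> ?o i n \<omega>" "?o i n \<omega> \<le> 2 * K" if "\<omega> \<in> space P" for i n \<omega>
    using oscillation_nonneg[where M="\<lambda>t \<omega>. X t \<omega> $ i" and \<omega>=\<omega> and K=K]
      oscillation_le[where M="\<lambda>t \<omega>. X t \<omega> $ i" and \<omega>=\<omega> and K=K] K that by auto
  have g0: "0 \<le> g n \<omega>" if "\<omega> \<in> space P" for n \<omega> unfolding g_def using ob[OF that] by (intro sum_nonneg) auto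
  have gb: "\<bar>g n \<omega>\<bar> \<le> real CARD('d) * (2 * K)" if "\<omega> \<in> space P" for n \<omega>
    using g0[OF that, of n] sum_bounded_above[of UNIV "\<lambda>i. ?o i n \<omega>" "2 * K"] ob[OF that] by (simp add: g_def)
  have glim: "AE \<omega> in P. (\<lambda>n. g n \<omega>) \<longlonglongrightarrow> 0"
  proof (rule AE_I2)
    fix \<omega> assume w: "\<omega> \<in> space P"
    have "(\<lambda>n. ?o i n \<omega>) \<longlonglongrightarrow> 0" for i
      by (rule oscillation_tendsto_0[where M="\<lambda>t \<omega>. X t \<omega> $ i" and \<omega>=\<omega>, OF K[OF _ w] cont[OF w]])
    then have "(\<lambda>n. g n \<omega>) \<longlonglongrightarrow> (\<Sum>i\<in>(UNIV::'d set). 0)" unfolding g_def by (intro tendsto_sum)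
    then show "(\<lambda>n. g n \<omega>) \<longlonglongrightarrow> 0" by simp
  qed
  \<comment> \<open>The Taylor error of a cell is cubic in the increment. One factor is at most
    \<open>g n\<close>, the sum of the coordinate oscillations, and the other two add up to square
    sums, so \<open>vanishing_times_square_sum\<close> applies to each coordinate.\<close>
  have small: "\<bar>I t - I s\<bar> \<le> C * (real CARD('d) * \<epsilon>)" if e: "0 < \<epsilon>" for \<epsilon>
  proof -
    have "\<forall>i. \<exists>n0. \<forall>n\<ge>n0. \<forall>u N. incseq u \<and> 0 \<le> u 0 \<longrightarrow>
        (\<integral>\<omega>. g n \<omega> * square_sum (\<lambda>t \<omega>. X t \<omega> $ i) u N \<omega> \<partial>P) \<le> \<epsilon>"
      by (intro allI vanishing_times_square_sum[OF X K gm gb glim e])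
    from choice[OF this] obtain n0 where n0: "\<And>i n u N. n \<ge> n0 i \<Longrightarrow> incseq u \<Longrightarrow> 0 \<le> u 0 \<Longrightarrow>
        (\<integral>\<omega>. g n \<omega> * square_sum (\<lambda>t \<omega>. X t \<omega> $ i) u N \<omega> \<partial>P) \<le> \<epsilon>"
      by blast
    define n where "n = Max (range n0)"
    have n: "n \<ge> n0 i" for i unfolding n_def by simp
    obtain N where N: "(t - s) * 2 ^ Suc n \<le> real N" using real_arch_simple by blast
    define u where "u k = min (s + real k / 2 ^ Suc n) t" for k :: nat
    have u: "incseq u" "u 0 = s" "u N = t"
    proof -
      show "incseq u" unfolding u_def incseq_def by (intro allI impI min.mono add_left_mono divide_right_mono) auto
      show "u 0 = s" using st by (simp add: u_def)
      have "t - s \<le> real N / 2 ^ Suc n" using N by (simp add: field_simps)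
      then show "u N = t" by (simp add: u_def)
    qed
    have u0: "0 \<le> u k" for k using incseqD[OF u(1), of 0 k] u(2) st by simp
    have us: "s \<le> u k" for k using incseqD[OF u(1), of 0 k] u(2) st by simp
    have ut: "u k \<le> t" for k by (simp add: u_def)
    have uS: "u k \<le> u (Suc k)" for k using incseqD[OF u(1), of k "Suc k"] by simp
    have uinc: "u (Suc k) - u k \<le> 1 / 2 ^ Suc n" for k
    proof -
      have "real (Suc k) / 2 ^ Suc n = real k / 2 ^ Suc n + 1 / 2 ^ Suc n" by (simp add: add_divide_distrib)
      moreover have "0 \<le> 1 / (2::real) ^ Suc n" by simp
      ultimately show ?thesis unfolding u_def by linarith
    qed
    define D where "D k i \<omega> = X (u (Suc k)) \<omega> $ i - X (u k) \<omega> $ i" for k i \<omega>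
    define A1 where "A1 k \<omega> = (\<Sum>i\<in>UNIV. G (X (u k) \<omega>) i * D k i \<omega>)" for k \<omega>
    define A2 where "A2 k \<omega> = (\<Sum>i\<in>UNIV. \<Sum>j\<in>UNIV. H (X (u k) \<omega>) i j * (D k i \<omega> * D k j \<omega>))" for k \<omega>
    define T3 where "T3 k \<omega> = f (X (u (Suc k)) \<omega>) - f (X (u k) \<omega>) - A1 k \<omega> - A2 k \<omega>" for k \<omega>
    have AF: "A \<in> sets (F (u k))" for k using st(3) sets_F_mono[OF us] by auto
    have HF: "(\<lambda>\<omega>. indicator A \<omega> * h (X (u k) \<omega>)) \<in> borel_measurable (F (u k))"
      if "h \<in> borel_measurable borel" for h :: "real ^ 'd \<Rightarrow> real" and k
      using measurable_compose[OF XF[OF u0 order_refl] that] AF by simp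
    have Hb: "\<bar>indicator A \<omega> * h (X (u k) \<omega>)\<bar> \<le> B" if "\<And>x. \<bar>h x\<bar> \<le> B" for h :: "real ^ 'd \<Rightarrow> real" and k \<omega>
      using that[of "X (u k) \<omega>"] by (auto split: split_indicator)
    have z1: "integrable P (\<lambda>\<omega>. indicator A \<omega> * A1 k \<omega>)" "(\<integral>\<omega>. indicator A \<omega> * A1 k \<omega> \<partial>P) = 0" for k
    proof -
      define W where "W i \<omega> = indicator A \<omega> * G (X (u k) \<omega>) i" for i \<omega>
      have WF: "W i \<in> borel_measurable (F (u k))" for i unfolding W_def[abs_def] by (rule HF[OF G(1)])
      have Wb: "\<bar>W i \<omega>\<bar> \<le> B" for i \<omega> unfolding W_def by (rule Hb) (rule G(2))
      note z = martingale_increment_zero[OF X u0 uS WF Wb, folded D_def]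
      have e: "indicator A \<omega> * A1 k \<omega> = (\<Sum>i\<in>UNIV. W i \<omega> * D k i \<omega>)" for \<omega>
        by (simp only: A1_def W_def sum_distrib_left mult.assoc)
      show "integrable P (\<lambda>\<omega>. indicator A \<omega> * A1 k \<omega>)"
        unfolding e by (intro Bochner_Integration.integrable_sum z(1))
      show "(\<integral>\<omega>. indicator A \<omega> * A1 k \<omega> \<partial>P) = 0"
        unfolding e by (subst Bochner_Integration.integral_sum) (simp_all only: z sum.neutral_const)
    qed
    have z2: "integrable P (\<lambda>\<omega>. indicator A \<omega> * A2 k \<omega>)" "(\<integral>\<omega>. indicator A \<omega> * A2 k \<omega> \<partial>P) = 0" for k
    proof -
      \<comment> \<open>From every diagonal product the same \<open>(D k c \<omega>)^2\<close> is
        subtracted. Since \<open>H\<close> has trace zero, this leaves the quadratic form unchanged,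
        while each \<open>E i j\<close> becomes a quantity whose weighted expectation
        vanishes.\<close>
      define E where "E i j \<omega> = (if i = j then (D k i \<omega>)\<^sup>2 - (D k c \<omega>)\<^sup>2 else D k i \<omega> * D k j \<omega>)" for i j \<omega>
      have z: "integrable P (\<lambda>\<omega>. indicator A \<omega> * H (X (u k) \<omega>) i j * E i j \<omega>) \<and>
          (\<integral>\<omega>. indicator A \<omega> * H (X (u k) \<omega>) i j * E i j \<omega> \<partial>P) = 0" for i j
      proof -
        define W where "W \<omega> = indicator A \<omega> * H (X (u k) \<omega>) i j" for \<omega>
        have WF: "W \<in> borel_measurable (F (u k))" unfolding W_def[abs_def] by (rule HF[OF H(1)])
        have Wb: "\<bar>W \<omega>\<bar> \<le> B" for \<omega> unfolding W_def by (rule Hb) (rule H(2))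
        show ?thesis
        proof (cases "i = j")
          case False
          have "martingale P F (\<lambda>t \<omega>. X t \<omega> $ i * X t \<omega> $ j - 0)" using XX[OF False] by simp
          from product_increment_zero[OF X X this K K u0 uS WF Wb]
          show ?thesis using False unfolding E_def D_def W_def by simp
        next
          case True
          let ?V = "\<lambda>t \<omega>. (X t \<omega> $ c)\<^sup>2"
          have 1: "martingale P F (\<lambda>t \<omega>. X t \<omega> $ i * X t \<omega> $ i - ?V t \<omega>)" using X2[of i] by (simp add: power2_eq_square)
          have 2: "martingale P F (\<lambda>t \<omega>. X t \<omega> $ c * X t \<omega> $ c - ?V t \<omega>)" using X2[of c] by (simp add: power2_eq_square)
          note z1 = product_increment_zero[OF X X 1 K K u0 uS WF Wb]
          note z2 = product_increment_zero[OF X X 2 K K u0 uS WF Wb]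
          have e: "indicator A \<omega> * H (X (u k) \<omega>) i j * E i j \<omega> =
             W \<omega> * ((X (u (Suc k)) \<omega> $ i - X (u k) \<omega> $ i) * (X (u (Suc k)) \<omega> $ i - X (u k) \<omega> $ i)
               - (?V (u (Suc k)) \<omega> - ?V (u k) \<omega>))
             - W \<omega> * ((X (u (Suc k)) \<omega> $ c - X (u k) \<omega> $ c) * (X (u (Suc k)) \<omega> $ c - X (u k) \<omega> $ c)
               - (?V (u (Suc k)) \<omega> - ?V (u k) \<omega>))" for \<omega>
            unfolding W_def E_def D_def using True by (simp add: algebra_simps power2_eq_square)
          show ?thesis
            unfolding e using z1 z2 by (simp add: Bochner_Integration.integrable_diff)
        qed
      qed
      have diag: "(\<Sum>j\<in>UNIV. h j * E i j \<omega>) = (\<Sum>j\<in>UNIV. h j * (D k i \<omega> * D k j \<omega>)) - h i * (D k c \<omega>)\<^sup>2" for h i \<omega>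
      proof -
        have "h j * E i j \<omega> = h j * (D k i \<omega> * D k j \<omega>) - (if j = i then h j * (D k c \<omega>)\<^sup>2 else 0)" for j
          unfolding E_def by (auto simp: power2_eq_square right_diff_distrib)
        then show ?thesis by (simp add: sum_subtractf sum.delta)
      qed
      have "A2 k \<omega> = (\<Sum>i\<in>UNIV. \<Sum>j\<in>UNIV. H (X (u k) \<omega>) i j * E i j \<omega>)" for \<omega>
        unfolding diag sum_subtractf A2_def using tr[of "X (u k) \<omega>"] by (simp add: sum_distrib_right[symmetric])
      then have e: "indicator A \<omega> * A2 k \<omega> = (\<Sum>i\<in>UNIV. \<Sum>j\<in>UNIV. indicator A \<omega> * H (X (u k) \<omega>) i j * E i j \<omega>)" for \<omega>
        by (simp only: sum_distrib_left mult.assoc)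
      show "integrable P (\<lambda>\<omega>. indicator A \<omega> * A2 k \<omega>)"
        unfolding e using z by (intro Bochner_Integration.integrable_sum) auto
      show "(\<integral>\<omega>. indicator A \<omega> * A2 k \<omega> \<partial>P) = 0"
        unfolding e using z
        by (subst Bochner_Integration.integral_sum, simp add: Bochner_Integration.integrable_sum)+
           (simp add: Bochner_Integration.integral_sum)
    qed
    have fI: "integrable P (\<lambda>\<omega>. indicator A \<omega> * f (X (u k) \<omega>))" for k
      by (rule integrable_indicator_mult[OF fi[OF u0] AP])
    have T3e: "indicator A \<omega> * T3 k \<omega> = indicator A \<omega> * f (X (u (Suc k)) \<omega>) - indicator A \<omega> * f (X (u k) \<omega>)
        - indicator A \<omega> * A1 k \<omega> - indicator A \<omega> * A2 k \<omega>" for k \<omega>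
      by (simp add: T3_def right_diff_distrib)
    have T3I: "integrable P (\<lambda>\<omega>. indicator A \<omega> * T3 k \<omega>)" for k
      unfolding T3e using fI z1(1) z2(1) by (intro Bochner_Integration.integrable_diff)
    have T3: "(\<integral>\<omega>. indicator A \<omega> * T3 k \<omega> \<partial>P) = I (u (Suc k)) - I (u k)" for k
      unfolding T3e I_def using fI[of k] fI[of "Suc k"] z1[of k] z2[of k]
      by (simp add: Bochner_Integration.integrable_diff)
    have "I t - I s = (\<Sum>k<N. I (u (Suc k)) - I (u k))"
      using sum_lessThan_telescope[of "\<lambda>k. I (u k)" N] u by simp
    also have "\<dots> = (\<integral>\<omega>. (\<Sum>k<N. indicator A \<omega> * T3 k \<omega>) \<partial>P)"
      using T3I by (subst Bochner_Integration.integral_sum) (auto simp: T3)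
    finally have It: "I t - I s = (\<integral>\<omega>. (\<Sum>k<N. indicator A \<omega> * T3 k \<omega>) \<partial>P)" .
    let ?S = "\<lambda>i. square_sum (\<lambda>t \<omega>. X t \<omega> $ i) u N"
    have SI: "integrable P (\<lambda>\<omega>. g n \<omega> * ?S i \<omega>)" for i
    proof -
      have Sm: "?S i \<in> borel_measurable P"
        using measurable_F[OF square_sum_second_moment(2)[OF X, where K=K]] K u u0[of 0] by auto
      have Sb: "\<bar>?S i \<omega>\<bar> \<le> real N * (4 * K\<^sup>2)" if "\<omega> \<in> space P" for \<omega>
        using square_sum_second_moment(3)[OF X, where K=K] K u u0[of 0] that by auto
      show ?thesis by (rule integrable_bounded_mult[OF integrable_bounded[OF Sm Sb] gm gb])
    qed
    have bound: "AE \<omega> in P. norm (\<Sum>k<N. indicator A \<omega> * T3 k \<omega>) \<le> C * (\<Sum>i\<in>UNIV. g n \<omega> * ?S i \<omega>)"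
      using R AE_space
    proof eventually_elim
      case (elim \<omega>)
      have step: "\<bar>indicator A \<omega> * T3 k \<omega>\<bar> \<le> C * (g n \<omega> * (\<Sum>i\<in>UNIV. (D k i \<omega>)\<^sup>2))" for k
      proof -
        let ?v = "X (u (Suc k)) \<omega> - X (u k) \<omega>"
        have "\<bar>indicator A \<omega> * T3 k \<omega>\<bar> \<le> \<bar>T3 k \<omega>\<bar>" by (auto split: split_indicator)
        also have "\<dots> \<le> C * norm ?v ^ 3"
          unfolding T3_def A1_def A2_def D_def by (rule taylor) (use elim(1) u0 in auto)
        also have "norm ?v ^ 3 = norm ?v * (norm ?v)\<^sup>2" by (simp add: power3_eq_cube power2_eq_square)
        also have "(norm ?v)\<^sup>2 = (\<Sum>i\<in>UNIV. (D k i \<omega>)\<^sup>2)"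
          unfolding power2_norm_eq_inner by (simp add: inner_vec_def D_def power2_eq_square)
        also have "norm ?v \<le> g n \<omega>"
        proof -
          have "norm ?v \<le> (\<Sum>i\<in>UNIV. \<bar>?v $ i\<bar>)" by (rule norm_le_l1_cart)
          also have "\<dots> \<le> g n \<omega>"
            unfolding g_def
          proof (rule sum_mono)
            fix i
            show "\<bar>?v $ i\<bar> \<le> ?o i n \<omega>"
              using oscillation_ge_real[where M="\<lambda>t \<omega>. X t \<omega> $ i" and \<omega>=\<omega> and K=K and p="u (Suc k)" and q="u k" and T=T and n=n]
                K[OF _ elim(2)] cont[OF elim(2)] u0 ut[of k] ut[of "Suc k"] T uinc[of k] uS[of k] by simp
          qed
          finally show ?thesis .
        qed
        finally show ?thesis using C by (simp add: mult_left_mono mult_right_mono sum_nonneg)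
      qed
      have "norm (\<Sum>k<N. indicator A \<omega> * T3 k \<omega>) \<le> (\<Sum>k<N. \<bar>indicator A \<omega> * T3 k \<omega>\<bar>)"
        unfolding real_norm_def by (rule sum_abs)
      also have "\<dots> \<le> (\<Sum>k<N. C * (g n \<omega> * (\<Sum>i\<in>UNIV. (D k i \<omega>)\<^sup>2)))" by (intro sum_mono step)
      also have "\<dots> = C * (\<Sum>i\<in>UNIV. g n \<omega> * ?S i \<omega>)"
        unfolding square_sum_def D_def sum_distrib_left[symmetric] by (subst sum.swap) simp
      finally show ?case .
    qed
    have "\<bar>I t - I s\<bar> \<le> (\<integral>\<omega>. norm (\<Sum>k<N. indicator A \<omega> * T3 k \<omega>) \<partial>P)"
      unfolding It using integral_norm_bound[of P "\<lambda>\<omega>. \<Sum>k<N. indicator A \<omega> * T3 k \<omega>"] by simp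
    also have "\<dots> \<le> (\<integral>\<omega>. C * (\<Sum>i\<in>UNIV. g n \<omega> * ?S i \<omega>) \<partial>P)"
      by (intro integral_mono_AE bound integrable_norm integrable_mult_right Bochner_Integration.integrable_sum T3I SI)
    also have "\<dots> = C * (\<Sum>i\<in>UNIV. \<integral>\<omega>. g n \<omega> * ?S i \<omega> \<partial>P)"
      using SI by (simp add: Bochner_Integration.integral_sum)
    also have "\<dots> \<le> C * (\<Sum>i\<in>(UNIV :: 'd set). \<epsilon>)"
      using u u0[of 0] by (intro mult_left_mono sum_mono n0 n C) auto
    finally show ?thesis by simp
  qed
  have "\<bar>I t - I s\<bar> \<le> 0"
  proof (rule field_le_epsilon)
    fix e :: real assume e: "0 < e"
    define \<epsilon> where "\<epsilon> = e / (C * real CARD('d) + 1)"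
    have p: "0 < C * real CARD('d) + 1" using C by (simp add: add_nonneg_pos)
    have "C * (real CARD('d) * \<epsilon>) \<le> e" unfolding \<epsilon>_def using p e by (simp add: field_simps)
    moreover have "0 < \<epsilon>" unfolding \<epsilon>_def using p e by simp
    ultimately show "\<bar>I t - I s\<bar> \<le> 0 + e" using small[of \<epsilon>] by simp
  qed
  then show "(\<integral>\<omega>. indicator A \<omega> * f (X t \<omega>) \<partial>P) = (\<integral>\<omega>. indicator A \<omega> * f (X s \<omega>) \<partial>P)"
    by (simp add: I_def)
qed

end

section \<open>Second-order expansion of Kelvin transforms\<close>

lemma powr_taylor_bound:
  fixes a \<alpha> :: real
  assumes a: "0 \<le> a" and \<alpha>: "0 < \<alpha>"
  obtains C where "0 \<le> C"
    "\<And>q q'. \<alpha> \<le> q \<Longrightarrow> \<alpha> \<le> q' \<Longrightarrow> \<bar>q' powr (-a) - q powr (-a) + a * q powr (-a - 1) * (q' - q)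
        - a * (a + 1) / 2 * q powr (-a - 2) * (q' - q)\<^sup>2\<bar> \<le> C * \<bar>q' - q\<bar> ^ 3"
proof
  \<comment> \<open>From Lagrange's remainder: the third derivative of the power decreases in
    absolute value, so on arguments above \<alpha> it is largest at \<alpha>; the \<open>6\<close>
    is \<open>fact 3\<close>.\<close>
  let ?C = "a * (a + 1) * (a + 2) / 6 * \<alpha> powr (-a - 3)"
  show "0 \<le> ?C" using a by simp
  fix q q' assume q: "\<alpha> \<le> q" "\<alpha> \<le> q'"
  show "\<bar>q' powr (-a) - q powr (-a) + a * q powr (-a - 1) * (q' - q)
        - a * (a + 1) / 2 * q powr (-a - 2) * (q' - q)\<^sup>2\<bar> \<le> ?C * \<bar>q' - q\<bar> ^ 3"
  proof (cases "q' = q")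
    case False
    define diff where "diff m t = (if m = 0 then t powr (-a) else if m = 1 then - a * t powr (-a - 1)
       else if m = 2 then a * (a + 1) * t powr (-a - 2) else - a * (a + 1) * (a + 2) * t powr (-a - 3))"
      for m :: nat and t :: real
    have D: "DERIV (diff m) t :> diff (Suc m) t" if "m < 3" "0 < t" for m t
    proof -
      have P: "DERIV (\<lambda>t. c * t powr e) t :> c * (e * t powr (e - 1))" for c e
        by (rule DERIV_cmult[OF has_real_derivative_powr[OF that(2)]])
      have "m = 0 \<or> m = 1 \<or> m = 2" using that(1) by linarith
      then consider "m = 0" | "m = 1" | "m = 2" by blast
      then show ?thesis
      proof cases
        case 1 then show ?thesis using P[of 1 "-a"] by (simp add: diff_def[abs_def])
      next
        case 2 then show ?thesis using P[of "-a" "-a - 1"]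
          by (simp add: diff_def[abs_def] algebra_simps)
      next
        case 3 then show ?thesis using P[of "a * (a + 1)" "-a - 2"]
          by (simp add: diff_def[abs_def] algebra_simps)
      qed
    qed
    have "\<exists>t. (if q' < q then q' < t \<and> t < q else q < t \<and> t < q') \<and>
      q' powr (-a) = (\<Sum>m<3. diff m q / fact m * (q' - q) ^ m) + diff 3 t / fact 3 * (q' - q) ^ 3"
    proof (rule Taylor[where a="min q q'" and b="max q q'"])
      show "diff 0 = (\<lambda>t. t powr (-a))" by (simp add: diff_def[abs_def])
      show "\<forall>m t. m < 3 \<and> min q q' \<le> t \<and> t \<le> max q q' \<longrightarrow> DERIV (diff m) t :> diff (Suc m) t"
        by (intro allI impI D) (use q \<alpha> in auto)
    qed (use False in auto)
    then obtain t where t': "if q' < q then q' < t \<and> t < q else q < t \<and> t < q'"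
      "q' powr (-a) = (\<Sum>m<3. diff m q / fact m * (q' - q) ^ m) + diff 3 t / fact 3 * (q' - q) ^ 3"
      by blast
    have "\<alpha> \<le> t" using t'(1) q by (auto split: if_splits)
    note t = this t'(2)
    have "q' powr (-a) - q powr (-a) + a * q powr (-a - 1) * (q' - q)
        - a * (a + 1) / 2 * q powr (-a - 2) * (q' - q)\<^sup>2 = diff 3 t / fact 3 * (q' - q) ^ 3"
      unfolding t(2) by (simp add: diff_def numeral_3_eq_3 lessThan_Suc power2_eq_square algebra_simps)
    also have "\<bar>\<dots>\<bar> = a * (a + 1) * (a + 2) / 6 * t powr (-a - 3) * \<bar>q' - q\<bar> ^ 3"
      using a by (simp add: diff_def abs_mult power_abs fact_numeral)
    also have "\<dots> \<le> ?C * \<bar>q' - q\<bar> ^ 3"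
      using a \<alpha> t(1) by (intro mult_right_mono mult_left_mono powr_mono2') auto
    finally show ?thesis .
  qed simp
qed

lemma sum_quadratic_forms:
  fixes x y v :: "real ^ 'd"
  shows "(\<Sum>i\<in>UNIV. \<Sum>j\<in>UNIV. (if i = j then A else 0) * (v $ i * v $ j)) = A * (norm v)\<^sup>2"
    and "(\<Sum>i\<in>UNIV. \<Sum>j\<in>UNIV. (c * x $ i * y $ j) * (v $ i * v $ j)) = c * (x \<bullet> v) * (y \<bullet> v)"
proof -
  have "(\<Sum>j\<in>UNIV. (if i = j then A else 0) * (v $ i * v $ j)) = A * (v $ i * v $ i)" for i
  proof -
    have "(\<Sum>j\<in>UNIV. (if i = j then A else 0) * (v $ i * v $ j)) = (\<Sum>j\<in>UNIV. if i = j then A * (v $ i * v $ j) else 0)"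
      by (intro sum.cong) auto
    then show ?thesis by (simp add: sum.delta')
  qed
  then show "(\<Sum>i\<in>UNIV. \<Sum>j\<in>UNIV. (if i = j then A else 0) * (v $ i * v $ j)) = A * (norm v)\<^sup>2"
    unfolding power2_norm_eq_inner inner_vec_def by (simp add: sum_distrib_left)
  show "(\<Sum>i\<in>UNIV. \<Sum>j\<in>UNIV. (c * x $ i * y $ j) * (v $ i * v $ j)) = c * (x \<bullet> v) * (y \<bullet> v)"
    unfolding inner_vec_def by (simp add: sum_product sum_distrib_left sum_distrib_right mult_ac)
qed

text \<open>Here \<open>p\<close> is a homogeneous harmonic polynomial of degree \<open>l \<le> 2\<close> with gradient \<open>dp\<close> and half
  Hessian \<open>S\<close>; the vanishing trace of \<open>H\<close> says that its Kelvin transform \<open>f\<close> is harmonic.\<close>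

lemma kelvin_taylor:
  fixes p :: "real ^ 'd \<Rightarrow> real" and dp :: "real ^ 'd \<Rightarrow> real ^ 'd" and S :: "'d \<Rightarrow> 'd \<Rightarrow> real"
  assumes p: "\<And>x v. p (x + v) = p x + dp x \<bullet> v + (\<Sum>i\<in>UNIV. \<Sum>j\<in>UNIV. S i j * (v $ i * v $ j))"
    and contp: "continuous_on UNIV p" and contl: "continuous_on UNIV dp"
    and hom: "\<And>x. x \<bullet> dp x = l * p x" and trS: "(\<Sum>i\<in>UNIV. S i i) = 0"
    and a: "a = real CARD('d) / 2 - 1 + l" "0 \<le> a"
    and \<rho>: "0 < \<rho>" and K: "0 \<le> K"
  defines "R \<equiv> {x :: real ^ 'd. \<rho> \<le> norm x \<and> norm x \<le> K}"
  defines "f \<equiv> \<lambda>x. p x * ((norm x)\<^sup>2) powr (-a)"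
  obtains G H C where
    "\<And>i. continuous_on R (\<lambda>x. G x i)" "\<And>i j. continuous_on R (\<lambda>x. H x i j)"
    "\<And>x. x \<in> R \<Longrightarrow> (\<Sum>i\<in>UNIV. H x i i) = 0" "0 \<le> C"
    "\<And>x y. x \<in> R \<Longrightarrow> y \<in> R \<Longrightarrow>
      \<bar>f y - f x - (\<Sum>i\<in>UNIV. G x i * (y $ i - x $ i))
        - (\<Sum>i\<in>UNIV. \<Sum>j\<in>UNIV. H x i j * ((y $ i - x $ i) * (y $ j - x $ j)))\<bar> \<le> C * norm (y - x) ^ 3"
proof -
  \<comment> \<open>Value, first and second derivative of \<open>q powr (-a)\<close> at
    \<open>q = (norm x)^2\<close>.\<close>
  define \<phi>0 where "\<phi>0 x = ((norm x)\<^sup>2) powr (-a)" for x :: "real ^ 'd"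
  define \<phi>1 where "\<phi>1 x = - a * ((norm x)\<^sup>2) powr (-a - 1)" for x :: "real ^ 'd"
  define \<phi>2 where "\<phi>2 x = a * (a + 1) * ((norm x)\<^sup>2) powr (-a - 2)" for x :: "real ^ 'd"
  \<comment> \<open>Read off by multiplying the expansion of \<open>p (x + v)\<close> with that of
    the radial factor, whose argument grows by \<open>2 * (x \<bullet> v) + (norm v)^2\<close>.
    \<open>H\<close> is not symmetrised, as only its quadratic form and its trace matter.\<close>
  define G where "G x i = 2 * p x * \<phi>1 x * x $ i + \<phi>0 x * dp x $ i" for x i
  define H where "H x i j = (if i = j then p x * \<phi>1 x else 0) + (2 * p x * \<phi>2 x) * x $ i * x $ j
     + (2 * \<phi>1 x) * x $ i * dp x $ j + \<phi>0 x * S i j" for x i j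
  have R0: "norm x \<noteq> 0" if "x \<in> R" for x using that \<rho> by (auto simp: R_def)
  have cphi: "continuous_on R \<phi>0" "continuous_on R \<phi>1" "continuous_on R \<phi>2"
    unfolding \<phi>0_def \<phi>1_def \<phi>2_def by (intro continuous_intros; use R0 in auto)+
  have cp: "continuous_on R p" and cl: "continuous_on R dp" using contp contl continuous_on_subset by blast+
  have compR: "compact R"
  proof -
    have "R = cball 0 K - ball 0 \<rho>" by (auto simp: R_def)
    then show ?thesis by (simp add: compact_diff)
  qed
  have bdd: "\<exists>B\<ge>0. \<forall>x\<in>R. norm (g x) \<le> B" if "continuous_on R g" for g :: "real ^ 'd \<Rightarrow> 'e::real_normed_vector"
  proof -
    have "bounded (g ` R)" by (rule compact_imp_bounded[OF compact_continuous_image[OF that compR]])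
    then obtain B where "\<forall>y\<in>g ` R. norm y \<le> B" by (auto simp: bounded_iff)
    then show ?thesis by (intro exI[of _ "max B 0"]) auto
  qed
  obtain Cp where Cp: "0 \<le> Cp" "\<And>x. x \<in> R \<Longrightarrow> \<bar>p x\<bar> \<le> Cp" using bdd[OF cp] by auto
  obtain Cl where Cl: "0 \<le> Cl" "\<And>x. x \<in> R \<Longrightarrow> norm (dp x) \<le> Cl" using bdd[OF cl] by auto
  obtain C1 where C1: "0 \<le> C1" "\<And>x. x \<in> R \<Longrightarrow> \<bar>\<phi>1 x\<bar> \<le> C1" using bdd[OF cphi(2)] by auto
  obtain C2 where C2: "0 \<le> C2" "\<And>x. x \<in> R \<Longrightarrow> \<bar>\<phi>2 x\<bar> \<le> C2" using bdd[OF cphi(3)] by auto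
  obtain C0 where C0: "0 \<le> C0" and taylor: "\<And>q q'. \<rho>\<^sup>2 \<le> q \<Longrightarrow> \<rho>\<^sup>2 \<le> q' \<Longrightarrow>
      \<bar>q' powr (-a) - q powr (-a) + a * q powr (-a - 1) * (q' - q)
        - a * (a + 1) / 2 * q powr (-a - 2) * (q' - q)\<^sup>2\<bar> \<le> C0 * \<bar>q' - q\<bar> ^ 3"
    using powr_taylor_bound[OF a(2), of "\<rho>\<^sup>2"] \<rho> by auto
  define CS where "CS = (\<Sum>i\<in>(UNIV::'d set). \<Sum>j\<in>(UNIV::'d set). \<bar>S i j\<bar>)"
  have CS0: "0 \<le> CS" unfolding CS_def by (intro sum_nonneg) auto
  define B where "B v = (\<Sum>i\<in>UNIV. \<Sum>j\<in>UNIV. S i j * (v $ i * v $ j))" for v :: "real ^ 'd"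
  have Bb: "\<bar>B v\<bar> \<le> CS * (norm v)\<^sup>2" for v
  proof -
    have "\<bar>B v\<bar> \<le> (\<Sum>i\<in>UNIV. \<Sum>j\<in>UNIV. \<bar>S i j * (v $ i * v $ j)\<bar>)"
      unfolding B_def by (rule order_trans[OF sum_abs sum_mono[OF sum_abs]])
    also have "\<dots> \<le> (\<Sum>i\<in>(UNIV::'d set). \<Sum>j\<in>(UNIV::'d set). \<bar>S i j\<bar> * (norm v)\<^sup>2)"
      by (intro sum_mono) (auto simp: abs_mult power2_eq_square intro!: mult_left_mono mult_mono component_le_norm_cart)
    finally show ?thesis by (simp add: CS_def sum_distrib_right)
  qed
  \<comment> \<open>\<open>CR\<close> belongs to the radial factor, and \<open>CC\<close> collects
    the four terms of \<open>main\<close>. Terms of order above three are reduced with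
    \<open>norm v \<le> 2 * K\<close>.\<close>
  define CR where "CR = C0 * (2 * K) ^ 3 + C2 / 2 * (4 * K + 2 * K)"
  define CC where "CC = Cp * CR + Cl * (C1 + 2 * C2 * K\<^sup>2) + CS * (2 * C1 * K) + CS * (C1 + 2 * C2 * K\<^sup>2) * (2 * K)"
  have CR0: "0 \<le> CR" unfolding CR_def using C0 C2 K by simp
  have CC0: "0 \<le> CC" unfolding CC_def using Cp Cl C1 C2 CS0 CR0 K by simp
  have G_sum: "(\<Sum>i\<in>UNIV. G x i * v $ i) = 2 * p x * \<phi>1 x * (x \<bullet> v) + \<phi>0 x * (dp x \<bullet> v)" for x v
    unfolding G_def inner_vec_def by (simp add: sum_distrib_left sum.distrib algebra_simps)
  have H_sum: "(\<Sum>i\<in>UNIV. \<Sum>j\<in>UNIV. H x i j * (v $ i * v $ j))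
    = p x * \<phi>1 x * (norm v)\<^sup>2 + 2 * p x * \<phi>2 x * (x \<bullet> v) * (x \<bullet> v) + 2 * \<phi>1 x * (x \<bullet> v) * (dp x \<bullet> v) + \<phi>0 x * B v" for x v
  proof -
    have "(\<Sum>i\<in>UNIV. \<Sum>j\<in>UNIV. \<phi>0 x * S i j * (v $ i * v $ j)) = \<phi>0 x * B v"
      unfolding B_def by (simp add: sum_distrib_left mult.assoc)
    then show ?thesis
      unfolding H_def distrib_right sum.distrib sum_quadratic_forms by simp
  qed
  show ?thesis
  proof (rule that[of G H CC])
    show "continuous_on R (\<lambda>x. G x i)" for i
      unfolding G_def by (intro continuous_intros cphi cp cl)
    show "continuous_on R (\<lambda>x. H x i j)" for i j
      unfolding H_def by (cases "i = j") (auto intro!: continuous_intros cphi cp cl)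
    show "(\<Sum>i\<in>UNIV. H x i i) = 0" if x: "x \<in> R" for x
    proof -
      define q where "q = (norm x)\<^sup>2"
      have q: "0 < q" using R0[OF x] by (simp add: q_def)
      have e: "-a - 1 = (-a - 2) + 1" by simp
      have phi1: "\<phi>1 x = - a * (q powr (-a - 2) * q)"
        using q unfolding \<phi>1_def q_def[symmetric] e powr_add by simp
      have xx: "(\<Sum>i\<in>UNIV. x $ i * x $ i) = q" by (simp add: q_def power2_norm_eq_inner inner_vec_def)
      have xl: "(\<Sum>i\<in>UNIV. x $ i * dp x $ i) = l * p x" using hom[of x] by (simp add: inner_vec_def)
      have "(\<Sum>i\<in>UNIV. H x i i) = real CARD('d) * (p x * \<phi>1 x) + 2 * p x * \<phi>2 x * q + 2 * \<phi>1 x * (l * p x) + \<phi>0 x * 0"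
        unfolding H_def sum.distrib xx[symmetric] xl[symmetric] trS[symmetric] sum_distrib_left
        by (simp add: mult.assoc)
      \<comment> \<open>Euler's identity \<open>hom\<close> has turned the mixed term into a
        multiple of \<open>p x\<close>; the last factor vanishes for exactly the exponent
        \<open>a\<close> fixed in the hypotheses.\<close>
      also have "real CARD('d) * (p x * \<phi>1 x) + 2 * p x * \<phi>2 x * q + 2 * \<phi>1 x * (l * p x) + \<phi>0 x * 0
        = 2 * a * p x * (q powr (-a - 2) * q) * (a + 1 - real CARD('d) / 2 - l)"
        by (simp add: \<phi>2_def phi1 q_def[symmetric] algebra_simps)
      also have "\<dots> = 0" using a(1) by simp
      finally show ?thesis .
    qed
    show "0 \<le> CC" by fact
    fix x y assume x: "x \<in> R" and y: "y \<in> R"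
    define v where "v = y - x"
    define n where "n = norm v"
    define s where "s = x \<bullet> v"
    define m where "m = dp x \<bullet> v"
    have yx: "y = x + v" by (simp add: v_def)
    have nK: "0 \<le> n" "n \<le> 2 * K" unfolding n_def v_def using norm_triangle_ineq4[of y x] x y by (auto simp: R_def)
    have sK: "\<bar>s\<bar> \<le> K * n"
      unfolding s_def n_def
      by (rule order_trans[OF Cauchy_Schwarz_ineq2 mult_right_mono]) (use x in \<open>auto simp: R_def\<close>)
    have mb: "\<bar>m\<bar> \<le> Cl * n"
      unfolding m_def n_def
      by (rule order_trans[OF Cauchy_Schwarz_ineq2 mult_right_mono[OF Cl(2)[OF x]]]) auto
    define \<delta> where "\<delta> = 2 * s + n\<^sup>2"
    have q: "(norm y)\<^sup>2 - (norm x)\<^sup>2 = \<delta>"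
      unfolding \<delta>_def s_def n_def yx power2_norm_eq_inner by (simp add: inner_simps inner_commute)
    have db: "\<bar>\<delta>\<bar> \<le> 2 * K * n"
    proof -
      have "\<delta> = (norm y - norm x) * (norm y + norm x)" unfolding q[symmetric] by (simp add: power2_eq_square algebra_simps)
      also have "\<bar>\<dots>\<bar> = \<bar>norm y - norm x\<bar> * (norm y + norm x)" by (simp add: abs_mult)
      also have "\<dots> \<le> n * (2 * K)"
        unfolding n_def v_def using x y norm_triangle_ineq3[of y x] by (intro mult_mono) (auto simp: R_def)
      finally show ?thesis by (simp add: mult_ac)
    qed
    define R0 where "R0 = \<phi>0 y - \<phi>0 x - \<phi>1 x * \<delta> - \<phi>2 x / 2 * \<delta>\<^sup>2"
    have R0: "\<bar>R0\<bar> \<le> C0 * (2 * K) ^ 3 * n ^ 3"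
    proof -
      have "\<bar>R0\<bar> \<le> C0 * \<bar>\<delta>\<bar> ^ 3"
        using taylor[of "(norm x)\<^sup>2" "(norm y)\<^sup>2"] x y \<rho>
        unfolding R0_def \<phi>0_def \<phi>1_def \<phi>2_def q by (simp add: R_def)
      also have "\<dots> \<le> C0 * (2 * K * n) ^ 3" using db C0 by (intro mult_left_mono power_mono) auto
      finally show ?thesis by (simp add: power_mult_distrib)
    qed
    \<comment> \<open>In the square of \<open>\<delta> = 2 * s + n^2\<close> only
      \<open>4 * s^2\<close> is of second order in \<open>v\<close>; the rest joins the
      remainder.\<close>
    define R1 where "R1 = R0 + \<phi>2 x / 2 * (4 * s + n\<^sup>2) * n\<^sup>2"
    have R1: "\<bar>R1\<bar> \<le> CR * n ^ 3"
    proof -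
      have "\<bar>\<phi>2 x / 2 * (4 * s + n\<^sup>2) * n\<^sup>2\<bar> = \<bar>\<phi>2 x\<bar> / 2 * \<bar>4 * s + n\<^sup>2\<bar> * n\<^sup>2" by (simp add: abs_mult)
      also have "\<dots> \<le> C2 / 2 * ((4 * K + 2 * K) * n) * n\<^sup>2"
      proof (intro mult_right_mono mult_mono divide_right_mono C2(2)[OF x])
        have "n\<^sup>2 \<le> 2 * (K * n)" using nK mult_right_mono[of n "2 * K" n] by (simp add: power2_eq_square)
        moreover have "0 \<le> n\<^sup>2" by simp
        ultimately have "\<bar>4 * s + n\<^sup>2\<bar> \<le> 6 * (K * n)" using sK by linarith
        then show "\<bar>4 * s + n\<^sup>2\<bar> \<le> (4 * K + 2 * K) * n" by simp
      qed (use C2 in auto)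
      finally show ?thesis using R0 unfolding R1_def CR_def by (simp add: power2_eq_square power3_eq_cube algebra_simps)
    qed
    define b where "b = \<phi>1 x * n\<^sup>2 + 2 * \<phi>2 x * s\<^sup>2"
    have bb: "\<bar>b\<bar> \<le> (C1 + 2 * C2 * K\<^sup>2) * n\<^sup>2"
    proof -
      have "s\<^sup>2 \<le> (K * n)\<^sup>2" using sK by (meson abs_le_square_iff abs_ge_self order_trans)
      then have "\<bar>2 * \<phi>2 x * s\<^sup>2\<bar> \<le> 2 * C2 * (K * n)\<^sup>2"
        using C2(2)[OF x] C2(1) by (simp add: abs_mult mult_mono)
      moreover have "\<bar>\<phi>1 x * n\<^sup>2\<bar> \<le> C1 * n\<^sup>2" using C1(2)[OF x] by (simp add: abs_mult mult_right_mono)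
      ultimately show ?thesis unfolding b_def by (simp add: power_mult_distrib algebra_simps)
    qed
    have phiy: "\<phi>0 y = \<phi>0 x + 2 * \<phi>1 x * s + b + R1"
      unfolding R1_def R0_def b_def \<delta>_def by (simp add: power2_eq_square algebra_simps)
    have py: "p y = p x + m + B v" unfolding yx m_def B_def by (rule p)
    have main: "f y - f x - (\<Sum>i\<in>UNIV. G x i * (y $ i - x $ i))
        - (\<Sum>i\<in>UNIV. \<Sum>j\<in>UNIV. H x i j * ((y $ i - x $ i) * (y $ j - x $ j)))
      = p y * R1 + m * b + 2 * B v * \<phi>1 x * s + B v * b"
    proof -
      have comp: "y $ i - x $ i = v $ i" for i by (simp add: v_def)
      have fx: "f x = p x * \<phi>0 x" "f y = p y * \<phi>0 y" by (auto simp: f_def \<phi>0_def)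
      show ?thesis
        unfolding comp G_sum H_sum fx phiy py s_def[symmetric] m_def[symmetric] n_def[symmetric]
        unfolding b_def by (simp add: power2_eq_square algebra_simps)
    qed
    have n3: "n ^ 3 = n * n\<^sup>2" by (simp add: power2_eq_square power3_eq_cube)
    have 1: "\<bar>p y * R1\<bar> \<le> Cp * CR * n ^ 3"
      using mult_mono[OF Cp(2)[OF y] R1] Cp(1) by (simp add: abs_mult mult.assoc)
    have 2: "\<bar>m * b\<bar> \<le> Cl * (C1 + 2 * C2 * K\<^sup>2) * n ^ 3"
      using mult_mono[OF mb bb] Cl(1) nK(1) unfolding n3 by (simp add: abs_mult mult_ac)
    have 3: "\<bar>2 * B v * \<phi>1 x * s\<bar> \<le> CS * (2 * C1 * K) * n ^ 3"
    proof -
      have "\<bar>B v\<bar> * (\<bar>\<phi>1 x\<bar> * \<bar>s\<bar>) \<le> (CS * n\<^sup>2) * (C1 * (K * n))"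
        using Bb[of v] C1(2)[OF x] sK C1(1) CS0 unfolding n_def by (intro mult_mono) auto
      then show ?thesis unfolding n3 by (simp add: abs_mult mult_ac)
    qed
    have 4: "\<bar>B v * b\<bar> \<le> CS * (C1 + 2 * C2 * K\<^sup>2) * (2 * K) * n ^ 3"
    proof -
      have "\<bar>B v\<bar> * \<bar>b\<bar> \<le> (CS * n\<^sup>2) * ((C1 + 2 * C2 * K\<^sup>2) * n\<^sup>2)"
        using Bb[of v] bb CS0 unfolding n_def by (intro mult_mono) auto
      also have "\<dots> = (CS * (C1 + 2 * C2 * K\<^sup>2) * n ^ 3) * n" unfolding n3 by (simp add: power2_eq_square mult_ac)
      also have "\<dots> \<le> (CS * (C1 + 2 * C2 * K\<^sup>2) * n ^ 3) * (2 * K)"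
        using nK CS0 C1(1) C2(1) by (intro mult_left_mono) auto
      finally show ?thesis by (simp only: abs_mult mult_ac)
    qed
    show "\<bar>f y - f x - (\<Sum>i\<in>UNIV. G x i * (y $ i - x $ i))
        - (\<Sum>i\<in>UNIV. \<Sum>j\<in>UNIV. H x i j * ((y $ i - x $ i) * (y $ j - x $ j)))\<bar> \<le> CC * norm (y - x) ^ 3"
      unfolding main CC_def distrib_right v_def[symmetric] n_def[symmetric]
      using 1 2 3 4 by linarith
  qed
qed

section \<open>Path space\<close>

lemma paths_extensional: "paths \<subseteq> extensional {0..}"
  by (auto simp: paths_def)

lemma space_path_space: "space path_space = paths"
  using paths_extensional by (auto simp: path_space_def space_restrict_space space_PiM PiE_def)

lemma measurable_coordinate: "0 \<le> s \<Longrightarrow> (\<lambda>\<omega>. \<omega> s) \<in> measurable path_space borel"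
  unfolding path_space_def
  by (intro measurable_restrict_space1 measurable_component_singleton) auto

lemma measurable_path_spaceI:
  assumes "\<And>x. x \<in> space N \<Longrightarrow> f x \<in> paths" "\<And>s. 0 \<le> s \<Longrightarrow> (\<lambda>x. f x s) \<in> measurable N borel"
  shows "f \<in> measurable N path_space"
  unfolding path_space_def
proof (rule measurable_restrict_space2)
  show "f \<in> space N \<rightarrow> paths" using assms by auto
  show "f \<in> measurable N (PiM {0..} (\<lambda>_. borel))"
    by (rule measurable_PiM_single') (use assms paths_extensional in \<open>auto simp: PiE_def\<close>)
qed

lemma space_coord_filtration: "space (coord_filtration t) = paths"
  unfolding coord_filtration_def by (rule space_measure_of) auto

lemma sets_coord_filtration:
  "sets (coord_filtration t) = sigma_sets paths {(\<lambda>\<omega>. \<omega> s) -` B \<inter> paths | s B. s \<in> {0..t} \<and> B \<in> sets borel}"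
  unfolding coord_filtration_def by (rule sets_measure_of) auto

lemma measurable_coord_filtration:
  assumes "0 \<le> s" "s \<le> t"
  shows "(\<lambda>\<omega>. \<omega> s) \<in> measurable (coord_filtration t) borel"
proof (rule measurableI)
  fix B :: "'a set" assume "B \<in> sets borel"
  then show "(\<lambda>\<omega>. \<omega> s) -` B \<inter> space (coord_filtration t) \<in> sets (coord_filtration t)"
    unfolding space_coord_filtration sets_coord_filtration using assms by (intro sigma_sets.Basic) auto
qed auto

lemma sets_coord_filtration_subset: "sets (coord_filtration t) \<subseteq> sets path_space"
  unfolding sets_coord_filtration
proof (rule sets.sigma_sets_subset[of _ path_space, unfolded space_path_space], safe)
  fix s B assume "s \<in> {0..t}" and B: "B \<in> sets (borel :: 'a measure)"
  then show "(\<lambda>\<omega>. \<omega> s) -` B \<inter> paths \<in> sets path_space"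
    using measurable_sets[OF measurable_coordinate B, of s] by (simp add: space_path_space)
qed

lemma filtered_prob_space_coord_filtration:
  assumes "prob_space P" "sets P = sets path_space"
  shows "filtered_prob_space P coord_filtration"
proof (intro filtered_prob_space.intro filtered_prob_space_axioms.intro assms(1))
  show "space (coord_filtration t) = space P" for t
    using sets_eq_imp_space_eq[OF assms(2)] by (simp add: space_coord_filtration space_path_space)
  show "sets (coord_filtration t) \<subseteq> sets P" for t
    using sets_coord_filtration_subset assms(2) by auto
  show "sets (coord_filtration s) \<subseteq> sets (coord_filtration t)" if "s \<le> t" for s t
    unfolding sets_coord_filtration by (rule sigma_sets_mono') (use that in fastforce)
qed

text \<open>By continuity, evaluation at a random time is the limit of evaluations at its dyadic
  roundings, each of which selects among countably many coordinates.\<close>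

lemma measurable_path_eval:
  fixes S :: "(real \<Rightarrow> 'a::metric_space) \<Rightarrow> real"
  assumes S: "S \<in> borel_measurable path_space" and S0: "\<And>\<omega>. \<omega> \<in> paths \<Longrightarrow> 0 \<le> S \<omega>"
  shows "(\<lambda>\<omega>. \<omega> (S \<omega>)) \<in> borel_measurable path_space"
proof (rule borel_measurable_LIMSEQ_metric)
  fix m :: nat
  have "(\<lambda>\<omega>. nat \<lceil>S \<omega> * 2 ^ m\<rceil>) \<in> measurable path_space (count_space UNIV)"
    using S by measurable
  then show "(\<lambda>\<omega>. \<omega> (dyadic_ceiling m (S \<omega>))) \<in> borel_measurable path_space"
    unfolding dyadic_ceiling_def
    by (rule measurable_compose_countable[where f="\<lambda>k \<omega>. \<omega> (real k / 2 ^ m)", rotated])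
       (auto intro!: measurable_coordinate)
next
  fix \<omega> :: "real \<Rightarrow> 'a" assume "\<omega> \<in> space path_space"
  then have w: "\<omega> \<in> paths" by (simp add: space_path_space)
  show "(\<lambda>m. \<omega> (dyadic_ceiling m (S \<omega>))) \<longlonglongrightarrow> \<omega> (S \<omega>)"
  proof (rule continuous_on_halfline_tendsto[OF _ S0[OF w] dyadic_ceiling_tendsto[OF S0[OF w]]])
    show "continuous_on {0..} \<omega>" using w by (simp add: paths_def)
    show "0 \<le> dyadic_ceiling n (S \<omega>)" for n by (simp add: dyadic_ceiling_def)
  qed
qed

subsection \<open>Exit times\<close>

text \<open>\<open>K\<close> is both the level of the norm and a cap on the time. The cap keeps the
  time finite on paths that never leave the ball.\<close>

definition exit_time :: "real \<Rightarrow> (real \<Rightarrow> 'a::real_normed_vector) \<Rightarrow> real" where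
  "exit_time K \<omega> = Inf (insert K {r. 0 \<le> r \<and> K \<le> norm (\<omega> r)})"

lemma exit_time_le_iff:
  assumes w: "\<omega> \<in> paths" and K: "0 \<le> K"
  shows "exit_time K \<omega> \<le> t \<longleftrightarrow> K \<le> t \<or> (\<exists>r. 0 \<le> r \<and> r \<le> t \<and> K \<le> norm (\<omega> r))"
proof -
  let ?E = "{r. 0 \<le> r \<and> K \<le> norm (\<omega> r)}"
  have c: "continuous_on {0..} \<omega>" using w by (simp add: paths_def)
  have "closed ({0..} \<inter> (\<lambda>r. norm (\<omega> r)) -` {K..})"
    by (intro continuous_closed_preimage continuous_on_norm c) auto
  moreover have "{0..} \<inter> (\<lambda>r. norm (\<omega> r)) -` {K..} = ?E" by auto
  ultimately have cl: "closed (insert K ?E)" by (simp add: closed_insert)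
  have bd: "bdd_below (insert K ?E)" using K by (intro bdd_belowI[of _ 0]) auto
  have inE: "exit_time K \<omega> \<in> insert K ?E"
    unfolding exit_time_def by (rule closed_contains_Inf[OF _ bd cl]) auto
  have lower: "exit_time K \<omega> \<le> r" if "r \<in> insert K ?E" for r
    unfolding exit_time_def by (rule cInf_lower[OF that bd])
  show ?thesis using inE lower by (auto intro: order_trans)
qed

lemma exit_time_bounds:
  assumes w: "\<omega> \<in> paths" and K: "0 \<le> K"
  shows "0 \<le> exit_time K \<omega>"
    and "norm (\<omega> 0) \<le> K \<Longrightarrow> 0 \<le> r \<Longrightarrow> r \<le> exit_time K \<omega> \<Longrightarrow> norm (\<omega> r) \<le> K"
proof -
  show "0 \<le> exit_time K \<omega>"
  proof (rule ccontr)
    assume "\<not> 0 \<le> exit_time K \<omega>"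
    then obtain t where "exit_time K \<omega> \<le> t" "t < 0" using dense[of "exit_time K \<omega>" 0] by (auto intro: less_imp_le)
    then show False using exit_time_le_iff[OF w K, of t] K by auto
  qed
  assume 0: "norm (\<omega> 0) \<le> K" and r: "0 \<le> r" "r \<le> exit_time K \<omega>"
  have c: "continuous_on {0..} \<omega>" using w by (simp add: paths_def)
  have below: "norm (\<omega> s) \<le> K" if "0 \<le> s" "s < r" for s
    using exit_time_le_iff[OF w K, of s] that r(2) by force
  show "norm (\<omega> r) \<le> K"
  proof (cases "r = 0")
    case False
    define u where "u n = r * (1 - inverse (real (Suc n)))" for n
    have u: "0 \<le> u n" "u n < r" for n
      using r(1) False by (auto simp: u_def field_simps)
    have "u \<longlonglongrightarrow> r * (1 - 0)"
      unfolding u_def by (intro tendsto_intros LIMSEQ_inverse_real_of_nat)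
    then have "(\<lambda>n. \<omega> (u n)) \<longlonglongrightarrow> \<omega> r"
      using u by (intro continuous_on_halfline_tendsto[OF c r(1)]) auto
    then have "(\<lambda>n. norm (\<omega> (u n))) \<longlonglongrightarrow> norm (\<omega> r)" by (rule tendsto_norm)
    then show ?thesis using below[OF u] by (intro LIMSEQ_le_const2) auto
  qed (use 0 in simp)
qed

lemma exit_time_eventually:
  assumes w: "\<omega> \<in> paths"
  shows "\<forall>\<^sub>F n in sequentially. t \<le> exit_time (real n) \<omega>"
proof -
  have c: "continuous_on {0..t} \<omega>"
    using w continuous_on_subset[of "{0..}" \<omega> "{0..t}"] by (simp add: paths_def)
  have "bounded (\<omega> ` {0..t})" by (rule compact_imp_bounded[OF compact_continuous_image[OF c compact_Icc]])
  then obtain B where "\<forall>r\<in>{0..t}. norm (\<omega> r) \<le> B" by (auto simp: bounded_iff)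
  then have B: "norm (\<omega> r) \<le> B" if "0 \<le> r" "r \<le> t" for r using that by simp
  obtain N :: nat where N: "max B t < real N" using reals_Archimedean2 by blast
  show ?thesis
  proof (intro eventually_sequentiallyI[of N])
    fix n assume "N \<le> n"
    then have n: "B < real n" "t < real n" using N by auto
    show "t \<le> exit_time (real n) \<omega>"
    proof (rule ccontr)
      assume "\<not> t \<le> exit_time (real n) \<omega>"
      then have "exit_time (real n) \<omega> \<le> t" by simp
      then show False using exit_time_le_iff[OF w, of "real n" t] n B by force
    qed
  qed
qed

text \<open>Paths are continuous and the target \<open>K \<le> norm (\<omega> r)\<close> is closed,
  so reaching it by time \<open>t\<close> means that rational times in \<open>{0..t}\<close> bring
  the norm above every \<open>K - 1 / real (Suc m)\<close>. Hence the raw filtration decides the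
  event at time \<open>t\<close>.\<close>

lemma stopping_time_exit_time:
  assumes K: "0 \<le> K"
  shows "stopping_time coord_filtration (exit_time K :: (real \<Rightarrow> 'a::real_normed_vector) \<Rightarrow> real)"
proof (rule stopping_timeI)
  fix t :: real
  let ?F = "coord_filtration t :: (real \<Rightarrow> 'a) measure"
  have Q: "countable (\<rat> \<inter> {0..t})" by (rule countable_subset[OF _ countable_rat]) auto
  define E where "E = {\<omega> \<in> space ?F. \<forall>m::nat. \<exists>q\<in>\<rat> \<inter> {0..t}. K - 1 / real (Suc m) < norm (\<omega> q)}"
  have nm: "(\<lambda>\<omega>. norm (\<omega> q)) \<in> borel_measurable ?F" if "q \<in> \<rat> \<inter> {0..t}" for q
    using measurable_compose[OF measurable_coord_filtration[of q t] borel_measurable_norm] that by auto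
  have E: "E \<in> sets ?F"
    unfolding E_def
    by (intro sets.sets_Collect_countable_All sets.sets_Collect_countable_Ex' Q borel_measurable_less nm) auto
  have "{\<omega> \<in> space ?F. exit_time K \<omega> \<le> t} = (if K \<le> t then space ?F else E)"
  proof (cases "K \<le> t")
    case True
    then show ?thesis using exit_time_le_iff[OF _ K] by (auto simp: space_coord_filtration)
  next
    case False
    have eq: "(\<exists>r. 0 \<le> r \<and> r \<le> t \<and> K \<le> norm (\<omega> r)) \<longleftrightarrow> (\<forall>m::nat. \<exists>q\<in>\<rat> \<inter> {0..t}. K - 1 / real (Suc m) < norm (\<omega> q))"
      if w: "\<omega> \<in> paths" for \<omega> :: "real \<Rightarrow> 'a"
    proof
      have c: "continuous_on {0..} \<omega>" using w by (simp add: paths_def)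
      {
        assume "\<exists>r. 0 \<le> r \<and> r \<le> t \<and> K \<le> norm (\<omega> r)"
        then obtain r where r: "0 \<le> r" "r \<le> t" "K \<le> norm (\<omega> r)" by auto
        show "\<forall>m::nat. \<exists>q\<in>\<rat> \<inter> {0..t}. K - 1 / real (Suc m) < norm (\<omega> q)"
        proof
          fix m :: nat
          have "(\<lambda>l. norm (\<omega> (dyadic_floor l r))) \<longlonglongrightarrow> norm (\<omega> r)"
            using dyadic_floor_bounds(3)[OF r(1)]
            by (intro tendsto_norm continuous_on_halfline_tendsto[OF c r(1) dyadic_floor_tendsto[OF r(1)]])
          moreover have "K - 1 / real (Suc m) < norm (\<omega> r)" using r(3) by (simp add: less_le_trans[OF _ r(3)])
          ultimately have "\<forall>\<^sub>F l in sequentially. K - 1 / real (Suc m) < norm (\<omega> (dyadic_floor l r))"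
            by (intro order_tendstoD)
          then obtain l where l: "K - 1 / real (Suc m) < norm (\<omega> (dyadic_floor l r))"
            by (auto simp: eventually_sequentially)
          have "dyadic_floor l r \<in> \<rat>" unfolding dyadic_floor_def by (intro Rats_divide) auto
          then show "\<exists>q\<in>\<rat> \<inter> {0..t}. K - 1 / real (Suc m) < norm (\<omega> q)"
            using l dyadic_floor_bounds[OF r(1), of l] r(2) by (intro bexI[of _ "dyadic_floor l r"]) auto
        qed
      }
      {
        assume a: "\<forall>m::nat. \<exists>q\<in>\<rat> \<inter> {0..t}. K - 1 / real (Suc m) < norm (\<omega> q)"
        then have ne: "{0..t} \<noteq> {}" by auto
        obtain r where r: "r \<in> {0..t}" "\<And>q. q \<in> {0..t} \<Longrightarrow> norm (\<omega> q) \<le> norm (\<omega> r)"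
          using continuous_attains_sup[OF compact_Icc ne, of "\<lambda>r. norm (\<omega> r)"]
            continuous_on_norm[OF continuous_on_subset[OF c, of "{0..t}"]] by auto
        have le: "K - 1 / real (Suc m) \<le> norm (\<omega> r)" for m
          using a r(2) by (meson IntD2 less_imp_le order_trans)
        have "(\<lambda>m. K - 1 / real (Suc m)) \<longlonglongrightarrow> K - 0"
          by (intro tendsto_intros LIMSEQ_Suc[OF lim_1_over_n])
        then have "K \<le> norm (\<omega> r)" using le by (intro LIMSEQ_le_const2[of "\<lambda>m. K - 1 / real (Suc m)"]) auto
        then show "\<exists>r. 0 \<le> r \<and> r \<le> t \<and> K \<le> norm (\<omega> r)" using r(1) by auto
      }
    qed
    have "exit_time K \<omega> \<le> t \<longleftrightarrow> (\<forall>m::nat. \<exists>q\<in>\<rat> \<inter> {0..t}. K - 1 / real (Suc m) < norm (\<omega> q))"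
      if w: "\<omega> \<in> paths" for \<omega> :: "real \<Rightarrow> 'a"
      using exit_time_le_iff[OF w K, of t] False eq[OF w] by blast
    then have "{\<omega> \<in> paths. exit_time K \<omega> \<le> t}
      = {\<omega> \<in> paths. \<forall>m::nat. \<exists>q\<in>\<rat> \<inter> {0..t}. K - 1 / real (Suc m) < norm ((\<omega> :: real \<Rightarrow> 'a) q)}"
      by blast
    then show ?thesis using False unfolding E_def space_coord_filtration by simp
  qed
  then show "Measurable.pred ?F (\<lambda>\<omega>. exit_time K \<omega> \<le> t)"
    unfolding pred_def using E by auto
qed

subsection \<open>Inversion\<close>

text \<open>The formula sends the origin to itself, so there is no exceptional point.\<close>

lemma inversion_involution: "inversion (inversion x) = x"
proof (cases "x = 0")
  case False
  then show ?thesis by (simp add: inversion_def power2_eq_square field_simps)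
qed (simp add: inversion_def)

lemma norm_inversion: "norm (inversion x) = inverse (norm x)"
  by (cases "x = 0") (auto simp: inversion_def power2_eq_square)

lemma inversion_eq_0_iff: "inversion x = 0 \<longleftrightarrow> x = 0"
  by (auto simp: inversion_def)

lemma continuous_on_inversion: "continuous_on (- {0}) inversion"
  unfolding inversion_def by (intro continuous_intros) auto

lemma borel_measurable_inversion: "inversion \<in> borel_measurable (borel :: (real ^ 'd) measure)"
  unfolding inversion_def[abs_def] by measurable

lemma path_inversion_apply: "\<forall>t\<ge>0. \<omega> t \<noteq> 0 \<Longrightarrow> 0 \<le> t \<Longrightarrow> path_inversion \<omega> t = inversion (\<omega> t)"
  by (simp add: path_inversion_def)

lemma path_inversion_paths:
  assumes "\<omega> \<in> paths"
  shows "path_inversion \<omega> \<in> paths"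
proof (cases "\<forall>t\<ge>0. \<omega> t \<noteq> 0")
  case True
  have c: "continuous_on {0..} \<omega>" using assms by (simp add: paths_def)
  have "continuous_on {0..} (\<lambda>t. inversion (\<omega> t))"
    by (rule continuous_on_compose2[OF continuous_on_inversion c]) (use True in auto)
  then have "continuous_on {0..} (restrict (\<lambda>t. inversion (\<omega> t)) {0..})"
    by (rule continuous_on_eq) auto
  then show ?thesis using True by (simp add: path_inversion_def paths_def)
next
  case False
  then have "path_inversion \<omega> = \<omega>" unfolding path_inversion_def by (rule if_not_P)
  then show ?thesis using assms by simp
qed

text \<open>Nonvanishing paths stay nonvanishing and all others are fixed, so the two branches do
  not mix. Statements about the inverted path therefore translate back without loss.\<close>

lemma path_inversion_involution:
  assumes "\<omega> \<in> paths"
  shows "path_inversion (path_inversion \<omega>) = \<omega>"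
proof (cases "\<forall>t\<ge>0. \<omega> t \<noteq> 0")
  case True
  then have nz: "\<forall>t\<ge>0. path_inversion \<omega> t \<noteq> 0"
    by (simp add: path_inversion_apply inversion_eq_0_iff)
  have e: "path_inversion (path_inversion \<omega>) = restrict (\<lambda>t. inversion (path_inversion \<omega> t)) {0..}"
    unfolding path_inversion_def[of "path_inversion \<omega>"] by (rule if_P[OF nz])
  show ?thesis
  proof
    fix t
    show "path_inversion (path_inversion \<omega>) t = \<omega> t"
    proof (cases "0 \<le> t")
      case True
      then show ?thesis using \<open>\<forall>t\<ge>0. \<omega> t \<noteq> 0\<close> by (simp add: e path_inversion_apply inversion_involution)
    next
      case False
      then show ?thesis
        unfolding e using assms extensional_arb[of \<omega> "{0..}" t] by (simp add: paths_def)
    qed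
  qed
next
  case False
  then have "path_inversion \<omega> = \<omega>" unfolding path_inversion_def by (rule if_not_P)
  then show ?thesis by simp
qed

text \<open>The condition ranges over uncountably many times; on \<open>{0..real n}\<close> a
  nonvanishing continuous path is bounded away from zero, and a positive lower bound can be tested
  at rational times.\<close>

lemma sets_nonvanishing: "{\<omega> \<in> paths. \<forall>t\<ge>0. \<omega> t \<noteq> 0} \<in> sets (path_space :: (real \<Rightarrow> 'a::real_normed_vector) measure)"
proof -
  let ?M = "path_space :: (real \<Rightarrow> 'a) measure"
  have Q: "countable (\<rat> \<inter> {0..real n})" for n by (rule countable_subset[OF _ countable_rat]) auto
  define E where "E = {\<omega> \<in> space ?M. \<forall>n::nat. \<exists>m::nat. \<forall>q\<in>\<rat> \<inter> {0..real n}. 1 / real (Suc m) \<le> norm (\<omega> q)}"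
  have nm: "(\<lambda>\<omega>. norm (\<omega> q)) \<in> borel_measurable ?M" if "q \<in> \<rat> \<inter> {0..real n}" for q n
    using measurable_compose[OF measurable_coordinate[of q] borel_measurable_norm] that by auto
  have "E \<in> sets ?M"
    unfolding E_def
    by (intro sets.sets_Collect_countable_All sets.sets_Collect_countable_Ex sets.sets_Collect_countable_All'
        Q borel_measurable_le nm) auto
  also have "E = {\<omega> \<in> paths. \<forall>t\<ge>0. \<omega> t \<noteq> 0}"
  proof (intro set_eqI iffI)
    fix \<omega> assume "\<omega> \<in> E"
    then have w: "\<omega> \<in> paths" and b: "\<And>n. \<exists>m::nat. \<forall>q\<in>\<rat> \<inter> {0..real n}. 1 / real (Suc m) \<le> norm (\<omega> q)"
      by (auto simp: E_def space_path_space)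
    have c: "continuous_on {0..} \<omega>" using w by (simp add: paths_def)
    have "\<omega> t \<noteq> 0" if t: "0 \<le> t" for t
    proof -
      obtain n :: nat where n: "t \<le> real n" using real_arch_simple by blast
      obtain m :: nat where m: "\<And>q. q \<in> \<rat> \<inter> {0..real n} \<Longrightarrow> 1 / real (Suc m) \<le> norm (\<omega> q)" using b[of n] by blast
      have "(\<lambda>l. norm (\<omega> (dyadic_floor l t))) \<longlonglongrightarrow> norm (\<omega> t)"
        using dyadic_floor_bounds(3)[OF t]
        by (intro tendsto_norm continuous_on_halfline_tendsto[OF c t dyadic_floor_tendsto[OF t]])
      moreover have "1 / real (Suc m) \<le> norm (\<omega> (dyadic_floor l t))" for l
      proof (rule m)
        have "dyadic_floor l t \<in> \<rat>" unfolding dyadic_floor_def by (intro Rats_divide) auto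
        then show "dyadic_floor l t \<in> \<rat> \<inter> {0..real n}" using dyadic_floor_bounds[OF t, of l] n by auto
      qed
      ultimately have "1 / real (Suc m) \<le> norm (\<omega> t)" by (intro LIMSEQ_le_const) auto
      moreover have "0 < 1 / real (Suc m)" by simp
      ultimately show ?thesis by auto
    qed
    then show "\<omega> \<in> {\<omega> \<in> paths. \<forall>t\<ge>0. \<omega> t \<noteq> 0}" using w by auto
  next
    fix \<omega> assume "\<omega> \<in> {\<omega> \<in> paths. \<forall>t\<ge>0. \<omega> t \<noteq> (0::'a)}"
    then have w: "\<omega> \<in> paths" and nz: "\<And>t. 0 \<le> t \<Longrightarrow> \<omega> t \<noteq> 0" by auto
    have c: "continuous_on {0..} \<omega>" using w by (simp add: paths_def)
    have "\<exists>m::nat. \<forall>q\<in>\<rat> \<inter> {0..real n}. 1 / real (Suc m) \<le> norm (\<omega> q)" for n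
    proof -
      obtain r where r: "r \<in> {0..real n}" "\<And>q. q \<in> {0..real n} \<Longrightarrow> norm (\<omega> r) \<le> norm (\<omega> q)"
        using continuous_attains_inf[OF compact_Icc, of 0 "real n" "\<lambda>r. norm (\<omega> r)"]
          continuous_on_norm[OF continuous_on_subset[OF c, of "{0..real n}"]] by auto
      have "0 < norm (\<omega> r)" using nz[of r] r(1) by auto
      then obtain m where "inverse (real (Suc m)) < norm (\<omega> r)" using reals_Archimedean by blast
      then have "1 / real (Suc m) \<le> norm (\<omega> q)" if "q \<in> \<rat> \<inter> {0..real n}" for q
        using r(2)[of q] that by (simp add: inverse_eq_divide)
      then show ?thesis by blast
    qed
    then show "\<omega> \<in> E" using w by (auto simp: E_def space_path_space)
  qed
  finally show ?thesis .
qed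

lemma measurable_path_inversion:
  "path_inversion \<in> measurable path_space (path_space :: (real \<Rightarrow> real ^ 'd) measure)"
proof (rule measurable_path_spaceI)
  show "path_inversion \<omega> \<in> paths" if "\<omega> \<in> space path_space" for \<omega> :: "real \<Rightarrow> real ^ 'd"
    using path_inversion_paths that by (simp add: space_path_space)
  fix s :: real assume s: "0 \<le> s"
  let ?M = "path_space :: (real \<Rightarrow> real ^ 'd) measure"
  have p: "Measurable.pred ?M (\<lambda>\<omega>. \<forall>t\<ge>0. \<omega> t \<noteq> 0)"
    unfolding pred_def space_path_space by (rule sets_nonvanishing)
  have "(\<lambda>\<omega>. if \<forall>t\<ge>0. \<omega> t \<noteq> 0 then inversion (\<omega> s) else \<omega> s) \<in> measurable ?M borel"
    by (rule measurable_If[OF measurable_compose[OF measurable_coordinate[OF s] borel_measurable_inversion]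
          measurable_coordinate[OF s]]) (use p in \<open>simp add: pred_def\<close>)
  moreover have "(\<lambda>\<omega> :: real \<Rightarrow> real ^ 'd. path_inversion \<omega> s) = (\<lambda>\<omega>. if \<forall>t\<ge>0. \<omega> t \<noteq> 0 then inversion (\<omega> s) else \<omega> s)"
    using s by (intro ext) (auto simp: path_inversion_def)
  ultimately show "(\<lambda>\<omega>. path_inversion \<omega> s) \<in> measurable ?M borel" by simp
qed

text \<open>Whether a path vanishes is not known at time \<open>t\<close>, so \<open>path_inversion\<close> is adapted only up to
  the set of paths through the origin.\<close>

lemma path_inversion_filtration:
  fixes A :: "(real \<Rightarrow> real ^ 'd) set"
  assumes "A \<in> sets (coord_filtration t)"
  shows "\<exists>A'\<in>sets (coord_filtration t). \<forall>\<omega>\<in>paths. (\<forall>t\<ge>0. \<omega> t \<noteq> 0) \<longrightarrow> (path_inversion \<omega> \<in> A \<longleftrightarrow> \<omega> \<in> A')"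
  using assms unfolding sets_coord_filtration
proof (induction rule: sigma_sets.induct)
  case (Basic A)
  then obtain s B where sB: "A = (\<lambda>\<omega>. \<omega> s) -` B \<inter> paths" "s \<in> {0..t}" "B \<in> sets borel" by auto
  have "inversion -` B \<in> sets (borel :: (real ^ 'd) measure)"
    using measurable_sets[OF borel_measurable_inversion sB(3)] by simp
  then show ?case
    using sB by (intro bexI[of _ "(\<lambda>\<omega>. \<omega> s) -` (inversion -` B) \<inter> paths"] sigma_sets.Basic)
      (auto simp: path_inversion_apply path_inversion_paths)
next
  case Empty
  show ?case by (rule bexI[OF _ sigma_sets.Empty]) auto
next
  case (Compl A)
  then obtain A' where "A' \<in> sigma_sets paths {(\<lambda>\<omega>. \<omega> s) -` B \<inter> paths |s B. s \<in> {0..t} \<and> B \<in> sets borel}"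
    "\<forall>\<omega>\<in>paths. (\<forall>t\<ge>0. \<omega> t \<noteq> 0) \<longrightarrow> (path_inversion \<omega> \<in> A \<longleftrightarrow> \<omega> \<in> A')" by auto
  then show ?case
    by (intro bexI[of _ "paths - A'"] sigma_sets.Compl) (auto simp: path_inversion_paths)
next
  case (Union A)
  then have "\<forall>i. \<exists>A'. A' \<in> sigma_sets paths {(\<lambda>\<omega>. \<omega> s) -` B \<inter> paths |s B. s \<in> {0..t} \<and> B \<in> sets borel} \<and>
    (\<forall>\<omega>\<in>paths. (\<forall>t\<ge>0. \<omega> t \<noteq> 0) \<longrightarrow> (path_inversion \<omega> \<in> A i \<longleftrightarrow> \<omega> \<in> A'))" by blast
  from choice[OF this] obtain A' where
    "\<And>i::nat. A' i \<in> sigma_sets paths {(\<lambda>\<omega>. \<omega> s) -` B \<inter> paths |s B. s \<in> {0..t} \<and> B \<in> sets borel}"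
    "\<And>i. \<forall>\<omega>\<in>paths. (\<forall>t\<ge>0. \<omega> t \<noteq> 0) \<longrightarrow> (path_inversion \<omega> \<in> A i \<longleftrightarrow> \<omega> \<in> A' i)" by blast
  then show ?case by (intro bexI[of _ "\<Union>i. A' i"] sigma_sets.Union) auto
qed

section \<open>Kelvin transforms of a conformal local martingale\<close>

context filtered_prob_space
begin

text \<open>Every path is continuous here, not only almost every one, so the approximating integrals
  converge everywhere and the stopped process itself is adapted. The sum in
  \<open>dyadic_integral\<close> contains only cells that begin before \<open>t\<close>, whence its
  integrands are known at \<open>t\<close>.\<close>

lemma stopped_adapted:
  fixes M :: "real \<Rightarrow> 'w \<Rightarrow> real"
  assumes M: "\<And>t. 0 \<le> t \<Longrightarrow> M t \<in> borel_measurable (F t)"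
    and c: "\<And>\<omega>. \<omega> \<in> space P \<Longrightarrow> continuous_on {0..} (\<lambda>t. M t \<omega>)"
    and S: "stopping_time F S" and S0: "\<And>\<omega>. \<omega> \<in> space P \<Longrightarrow> 0 \<le> S \<omega>" and t: "0 \<le> t"
  shows "(\<lambda>\<omega>. M (min t (S \<omega>)) \<omega>) \<in> borel_measurable (F t)"
proof -
  define H where "H m k \<omega> = (of_bool (real k / 2 ^ m < S \<omega>) :: real)" for m k :: nat and \<omega>
  have H: "H m k \<in> borel_measurable (F (real k / 2 ^ m))" for m k
    using stopping_timeD2[OF S, of "real k / 2 ^ m"] unfolding H_def by measurable
  have MF: "M r \<in> borel_measurable (F t)" if "0 \<le> r" "r \<le> t" for r
    using measurable_F_mono[OF M[OF that(1)] that(2)] .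
  have m: "(\<lambda>\<omega>. M 0 \<omega> + dyadic_integral m (H m) M t \<omega>) \<in> borel_measurable (F t)" for m
    unfolding dyadic_integral_def dyadic_incr_def
  proof (intro borel_measurable_add borel_measurable_sum borel_measurable_times borel_measurable_diff MF)
    fix k assume "k \<in> {..<nat \<lceil>t * 2 ^ m\<rceil>}"
    then have "int k < \<lceil>t * 2 ^ m\<rceil>" by auto
    then have "real k < t * 2 ^ m" by (simp add: less_ceiling_iff)
    then show "H m k \<in> borel_measurable (F t)"
      by (intro measurable_F_mono[OF H]) (simp add: field_simps)
  qed (use t in auto)
  show ?thesis
  proof (rule borel_measurable_LIMSEQ_real[OF _ m])
    fix \<omega> assume "\<omega> \<in> space (F t)"
    then have w: "\<omega> \<in> space P" by (simp add: space_F)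
    have "(\<lambda>m. min (dyadic_ceiling m (S \<omega>)) t) \<longlonglongrightarrow> min (S \<omega>) t"
      by (intro tendsto_min dyadic_ceiling_tendsto tendsto_const S0 w)
    moreover have "0 \<le> min (dyadic_ceiling m (S \<omega>)) t" for m using t by (simp add: dyadic_ceiling_def)
    ultimately have "(\<lambda>m. M (min (dyadic_ceiling m (S \<omega>)) t) \<omega>) \<longlonglongrightarrow> M (min (S \<omega>) t) \<omega>"
      using S0[OF w] t by (intro continuous_on_halfline_tendsto[OF c[OF w]]) auto
    then show "(\<lambda>m. M 0 \<omega> + dyadic_integral m (H m) M t \<omega>) \<longlonglongrightarrow> M (min t (S \<omega>)) \<omega>"
      using dyadic_integral_stopping[of S \<omega> t M, OF S0[OF w] t] by (simp add: H_def[abs_def] min.commute)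
  qed
qed

lemma local_martingale_of_martingale:
  assumes M: "martingale P F M"
  shows "local_martingale P F M"
  unfolding local_martingale_def
proof (intro conjI allI impI exI[of _ "\<lambda>n \<omega>. real n"])
  show "M t \<in> borel_measurable (F t)" if "0 \<le> t" for t using martingale_adapted[OF M that] .
  show "AE \<omega> in P. incseq real \<and> filterlim (\<lambda>n. real n) at_top sequentially"
    by (auto simp: incseq_def filterlim_real_sequentially)
  fix n
  have 1: "martingale P F (\<lambda>t \<omega>. 1 * (M (min (real n) t) \<omega> - M (min 0 t) \<omega>))"
    by (rule martingale_increment[OF M, where C=1]) auto
  show "martingale P F (\<lambda>t \<omega>. M (min t (real n)) \<omega> - M 0 \<omega>)"
  proof (rule martingale_cong_AE[OF 1])
    show "(\<lambda>\<omega>. M (min t (real n)) \<omega> - M 0 \<omega>) \<in> borel_measurable (F t)" if t: "0 \<le> t" for t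
      using martingale_adapted[OF 1 t] t by (simp add: min.commute)
  qed (simp add: min.commute)
qed (auto simp: stopping_time_const)

text \<open>\<open>U n\<close> is the minimum of finitely many localizing times. The martingale
  property is stated at some later time \<open>T\<close> and not at \<open>U n\<close>: stopping
  once more requires continuous paths, which enter in \<open>localized_martingale\<close>.\<close>

lemma common_localization:
  fixes M :: "'z::finite \<Rightarrow> real \<Rightarrow> 'w \<Rightarrow> real"
  assumes M: "\<And>z. local_martingale P F (M z)"
  obtains U :: "nat \<Rightarrow> 'w \<Rightarrow> real" where "\<And>n. stopping_time F (U n)" "\<And>n \<omega>. \<omega> \<in> space P \<Longrightarrow> 0 \<le> U n \<omega>"
    "AE \<omega> in P. \<forall>t. \<forall>\<^sub>F n in sequentially. t \<le> U n \<omega>"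
    "\<And>z n. \<exists>T. (\<forall>\<omega>\<in>space P. U n \<omega> \<le> T \<omega>) \<and> martingale P F (\<lambda>t \<omega>. M z (min t (T \<omega>)) \<omega> - M z 0 \<omega>)"
proof -
  have "\<forall>z. \<exists>T :: nat \<Rightarrow> 'w \<Rightarrow> real.
        (\<forall>n. stopping_time F (T n) \<and> (\<forall>\<omega>\<in>space P. 0 \<le> T n \<omega>)) \<and>
        (AE \<omega> in P. incseq (\<lambda>n. T n \<omega>) \<and> filterlim (\<lambda>n. T n \<omega>) at_top sequentially) \<and>
        (\<forall>n. martingale P F (\<lambda>t \<omega>. M z (min t (T n \<omega>)) \<omega> - M z 0 \<omega>))"
    using M unfolding local_martingale_def by blast
  from choice[OF this] obtain T where
    T: "\<And>z n. stopping_time F (T z n)" "\<And>z n \<omega>. \<omega> \<in> space P \<Longrightarrow> 0 \<le> T z n \<omega>"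
    "\<And>z. AE \<omega> in P. incseq (\<lambda>n. T z n \<omega>) \<and> filterlim (\<lambda>n. T z n \<omega>) at_top sequentially"
    "\<And>z n. martingale P F (\<lambda>t \<omega>. M z (min t (T z n \<omega>)) \<omega> - M z 0 \<omega>)" by blast
  define U where "U n \<omega> = Min (range (\<lambda>z. T z n \<omega>))" for n \<omega>
  show ?thesis
  proof (rule that[of U])
    show "stopping_time F (U n)" for n
    proof (rule stopping_timeI)
      fix t
      have "U n \<omega> \<le> t \<longleftrightarrow> (\<exists>z\<in>UNIV. T z n \<omega> \<le> t)" for \<omega>
        unfolding U_def by (subst Min_le_iff) auto
      then show "Measurable.pred (F t) (\<lambda>\<omega>. U n \<omega> \<le> t)"
        using pred_intros_finite(4)[where I=UNIV and M="F t" and P="\<lambda>\<omega> z. T z n \<omega> \<le> t"] stopping_timeD[OF T(1)] by simp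
    qed
    show "0 \<le> U n \<omega>" if "\<omega> \<in> space P" for n \<omega>
      unfolding U_def using T(2)[OF that] by (subst Min_ge_iff) auto
    have "AE \<omega> in P. \<forall>z. filterlim (\<lambda>n. T z n \<omega>) at_top sequentially"
      using T(3) by (subst AE_all_countable) (auto elim: eventually_mono)
    then show "AE \<omega> in P. \<forall>t. \<forall>\<^sub>F n in sequentially. t \<le> U n \<omega>"
    proof eventually_elim
      case (elim \<omega>)
      then have "\<forall>\<^sub>F n in sequentially. \<forall>z. t \<le> T z n \<omega>" for t
        by (intro eventually_all_finite) (auto simp: filterlim_at_top)
      then show ?case unfolding U_def by (subst Min_ge_iff) auto
    qed
    show "\<exists>T'. (\<forall>\<omega>\<in>space P. U n \<omega> \<le> T' \<omega>) \<and> martingale P F (\<lambda>t \<omega>. M z (min t (T' \<omega>)) \<omega> - M z 0 \<omega>)" for z n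
      by (intro exI[of _ "T z n"] conjI ballI T(4)) (auto simp: U_def)
  qed
qed

text \<open>Optional stopping at \<open>S \<le> T\<close>. The definition of a local martingale
  subtracts \<open>M 0\<close>; its value is almost surely the constant \<open>c\<close>, which can
  be added back as a martingale.\<close>

lemma localized_martingale:
  assumes M: "martingale P F (\<lambda>t \<omega>. M (min t (T \<omega>)) \<omega> - M 0 \<omega>)"
    and S: "stopping_time F S" and ST: "\<And>\<omega>. \<omega> \<in> space P \<Longrightarrow> 0 \<le> S \<omega> \<and> S \<omega> \<le> T \<omega>"
    and cont: "AE \<omega> in P. M 0 \<omega> = c \<and> continuous_on {0..} (\<lambda>t. M t \<omega>)"
  obtains Z where "martingale P F Z" "\<And>t. 0 \<le> t \<Longrightarrow> AE \<omega> in P. Z t \<omega> = M (min t (S \<omega>)) \<omega>"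
proof -
  have "AE \<omega> in P. continuous_on {0..} (\<lambda>t. M (min t (T \<omega>)) \<omega> - M 0 \<omega>)"
    using cont AE_space
  proof eventually_elim
    case (elim \<omega>)
    then have c: "continuous_on {0..} (\<lambda>t. M t \<omega>)" by simp
    have "0 \<le> T \<omega>" using ST[OF elim(2)] by linarith
    then have "continuous_on {0..} (\<lambda>t. M (min t (T \<omega>)) \<omega>)"
      by (intro continuous_on_compose2[OF c] continuous_intros) auto
    then show ?case by (intro continuous_intros)
  qed
  then obtain Z where Z: "martingale P F Z"
    "\<And>t. 0 \<le> t \<Longrightarrow> AE \<omega> in P. Z t \<omega> = M (min (min t (S \<omega>)) (T \<omega>)) \<omega> - M 0 \<omega>"
    using stopped_martingale[OF M S] ST by blast
  show ?thesis
  proof (rule that[of "\<lambda>t \<omega>. Z t \<omega> + c"])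
    show "martingale P F (\<lambda>t \<omega>. Z t \<omega> + c)"
      by (rule martingale_add[OF Z(1) martingale_const]) auto
    show "AE \<omega> in P. Z t \<omega> + c = M (min t (S \<omega>)) \<omega>" if t: "0 \<le> t" for t
      using Z(2)[OF t] cont AE_space
    proof eventually_elim
      case (elim \<omega>)
      have "min (min t (S \<omega>)) (T \<omega>) = min t (S \<omega>)" using ST[OF elim(3)] by auto
      then show ?case using elim(1,2) by simp
    qed
  qed
qed

end

text \<open>The power \<open>2 - d\<close> of the norm, harmonic off the origin, written through the
  squared norm because \<open>kelvin_taylor\<close> expands in that variable.\<close>

definition kappa :: "real ^ 'd \<Rightarrow> real" where
  "kappa x = ((norm x)\<^sup>2) powr (1 - real CARD('d) / 2)"

section \<open>Conformal local martingales that avoid a ball around the origin\<close>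

locale exterior_process = prob_space P
  for P :: "(real \<Rightarrow> real ^ 'd) measure" +
  fixes x\<^sub>0 :: "real ^ 'd" and \<rho> :: real
  assumes dim: "CARD('d) > 2"
    and sets_P: "sets P = sets path_space"
    and start: "AE \<omega> in P. \<omega> 0 = x\<^sub>0"
    and conformal: "conformal_local_martingale P coord_filtration (\<lambda>t \<omega>. \<omega> t)"
    and rho: "0 < \<rho>"
    and away: "AE \<omega> in P. \<forall>t\<ge>0. \<rho> \<le> norm (\<omega> t)"
begin

sublocale filtered_prob_space P coord_filtration
  by (rule filtered_prob_space_coord_filtration[OF prob_space_axioms sets_P])

lemma space_P: "space P = paths"
  using sets_eq_imp_space_eq[OF sets_P] by (simp add: space_path_space)

lemma path_continuous: "\<omega> \<in> space P \<Longrightarrow> continuous_on {0..} \<omega>"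
  by (simp add: space_P paths_def)

lemma component_continuous: "\<omega> \<in> space P \<Longrightarrow> continuous_on {0..} (\<lambda>t. \<omega> t $ i)"
  using path_continuous by (intro continuous_on_component) auto

lemma component_adapted: "0 \<le> t \<Longrightarrow> (\<lambda>\<omega>. \<omega> t $ i) \<in> borel_measurable (coord_filtration t)"
  by (rule measurable_compose[OF measurable_coord_filtration borel_measurable_continuous_onI])
    (auto intro: continuous_intros)

lemma norm_start: "\<rho> \<le> norm x\<^sub>0"
proof -
  have "AE \<omega> in P. \<rho> \<le> norm x\<^sub>0" using start away by eventually_elim auto
  then show ?thesis by simp
qed

lemma kappa_le: "\<rho> \<le> norm x \<Longrightarrow> kappa x \<le> (\<rho>\<^sup>2) powr (1 - real CARD('d) / 2)" for x :: "real ^ 'd"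
  unfolding kappa_def using rho dim by (intro powr_mono2') auto

text \<open>In these combinations the bracket cancels: it is zero for distinct coordinates and the
  same for every coordinate with itself. Staying below \<open>exit_time\<close> will keep the
  coordinates bounded as well.\<close>

lemma stopped_components:
  obtains \<sigma> :: "nat \<Rightarrow> (real \<Rightarrow> real ^ 'd) \<Rightarrow> real" where
    "\<And>n. stopping_time coord_filtration (\<sigma> n)" "\<And>n \<omega>. \<omega> \<in> space P \<Longrightarrow> 0 \<le> \<sigma> n \<omega>"
    "\<And>n \<omega>. \<omega> \<in> space P \<Longrightarrow> \<sigma> n \<omega> \<le> exit_time (real n) \<omega>"
    "AE \<omega> in P. \<forall>t. \<forall>\<^sub>F n in sequentially. t \<le> \<sigma> n \<omega>"
    "\<And>n i. \<exists>Z. martingale P coord_filtration Z \<and> (\<forall>t\<ge>0. AE \<omega> in P. Z t \<omega> = \<omega> (min t (\<sigma> n \<omega>)) $ i)"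
    "\<And>n i j. i \<noteq> j \<Longrightarrow> \<exists>Z. martingale P coord_filtration Z \<and>
       (\<forall>t\<ge>0. AE \<omega> in P. Z t \<omega> = \<omega> (min t (\<sigma> n \<omega>)) $ i * \<omega> (min t (\<sigma> n \<omega>)) $ j)"
    "\<And>n i j. \<exists>Z. martingale P coord_filtration Z \<and>
       (\<forall>t\<ge>0. AE \<omega> in P. Z t \<omega> = (\<omega> (min t (\<sigma> n \<omega>)) $ i)\<^sup>2 - (\<omega> (min t (\<sigma> n \<omega>)) $ j)\<^sup>2)"
proof -
  let ?F = "coord_filtration :: real \<Rightarrow> (real \<Rightarrow> real ^ 'd) measure"
  obtain A where A: "\<And>i j. is_bracket P ?F (\<lambda>t \<omega>. \<omega> t $ i) (\<lambda>t \<omega>. \<omega> t $ j) (\<lambda>t \<omega>. if i = j then A t \<omega> else 0)"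
    using conformal unfolding conformal_local_martingale_def by blast
  \<comment> \<open>The sum type puts coordinates and compensated products into one finite family,
    so that \<open>common_localization\<close> yields a single sequence of times.\<close>
  define M where "M z t \<omega> = (case z of Inl i \<Rightarrow> \<omega> t $ i
      | Inr (i, j) \<Rightarrow> \<omega> t $ i * \<omega> t $ j - (if i = j then A t \<omega> else 0))"
    for z :: "'d + 'd \<times> 'd" and t and \<omega> :: "real \<Rightarrow> real ^ 'd"
  have lm: "local_martingale P ?F (M z)" for z
  proof (cases z)
    case (Inl i)
    then have "M z = (\<lambda>t \<omega>. \<omega> t $ i)" by (intro ext) (simp add: M_def)
    then show ?thesis using conformal unfolding conformal_local_martingale_def by simp
  next
    case (Inr ij)
    obtain i j where "ij = (i, j)" by (cases ij)
    with Inr have "M z = (\<lambda>t \<omega>. \<omega> t $ i * \<omega> t $ j - (if i = j then A t \<omega> else 0))" by (intro ext) (simp add: M_def)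
    then show ?thesis using A[of i j] unfolding is_bracket_def by simp
  qed
  \<comment> \<open>Any diagonal pair of indices gives the path properties of the common bracket
    \<open>A\<close>; \<open>undefined\<close> is an arbitrary index.\<close>
  have A0: "AE \<omega> in P. A 0 \<omega> = 0 \<and> continuous_on {0..} (\<lambda>t. A t \<omega>)"
    using A[of undefined undefined] unfolding is_bracket_def by (auto elim: eventually_mono)
  have Mc: "\<exists>c. AE \<omega> in P. M z 0 \<omega> = c \<and> continuous_on {0..} (\<lambda>t. M z t \<omega>)" for z
  proof (cases z)
    case (Inl i)
    have "AE \<omega> in P. M z 0 \<omega> = x\<^sub>0 $ i \<and> continuous_on {0..} (\<lambda>t. M z t \<omega>)"
      using start AE_space by eventually_elim (auto simp: M_def Inl component_continuous)
    then show ?thesis by blast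
  next
    case (Inr ij)
    obtain i j where ij: "ij = (i, j)" by (cases ij)
    have "AE \<omega> in P. M z 0 \<omega> = x\<^sub>0 $ i * x\<^sub>0 $ j \<and> continuous_on {0..} (\<lambda>t. M z t \<omega>)"
      using start A0 AE_space
      by eventually_elim (auto simp: M_def Inr ij intro!: continuous_intros component_continuous)
    then show ?thesis by blast
  qed
  obtain U :: "nat \<Rightarrow> (real \<Rightarrow> real ^ 'd) \<Rightarrow> real" where U: "\<And>n. stopping_time ?F (U n)" "\<And>n \<omega>. \<omega> \<in> space P \<Longrightarrow> 0 \<le> U n \<omega>"
    "AE \<omega> in P. \<forall>t. \<forall>\<^sub>F n in sequentially. t \<le> U n \<omega>"
    "\<And>z n. \<exists>T. (\<forall>\<omega>\<in>space P. U n \<omega> \<le> T \<omega>) \<and> martingale P ?F (\<lambda>t \<omega>. M z (min t (T \<omega>)) \<omega> - M z 0 \<omega>)"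
    by (rule common_localization[where M=M, OF lm]) (rule that)
  define \<sigma> where "\<sigma> n \<omega> = min (U n \<omega>) (exit_time (real n) \<omega>)" for n \<omega>
  have st: "stopping_time ?F (\<sigma> n)" for n
    unfolding \<sigma>_def by (intro stopping_time_min U(1) stopping_time_exit_time) auto
  have s0: "0 \<le> \<sigma> n \<omega>" if "\<omega> \<in> space P" for n \<omega>
    unfolding \<sigma>_def using U(2)[OF that] exit_time_bounds(1)[of \<omega> "real n"] that by (auto simp: space_P)
  have Z: "\<exists>Z. martingale P ?F Z \<and> (\<forall>t\<ge>0. AE \<omega> in P. Z t \<omega> = M z (min t (\<sigma> n \<omega>)) \<omega>)" for z n
  proof -
    obtain T where T: "\<And>\<omega>. \<omega> \<in> space P \<Longrightarrow> U n \<omega> \<le> T \<omega>" "martingale P ?F (\<lambda>t \<omega>. M z (min t (T \<omega>)) \<omega> - M z 0 \<omega>)"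
      using U(4) by blast
    obtain c where c: "AE \<omega> in P. M z 0 \<omega> = c \<and> continuous_on {0..} (\<lambda>t. M z t \<omega>)" using Mc by blast
    have "0 \<le> \<sigma> n \<omega> \<and> \<sigma> n \<omega> \<le> T \<omega>" if "\<omega> \<in> space P" for \<omega>
      using s0[OF that] T(1)[OF that] by (simp add: \<sigma>_def min.coboundedI1)
    from localized_martingale[OF T(2) st this c] show ?thesis by blast
  qed
  show ?thesis
  proof (rule that[of \<sigma>])
    show "stopping_time ?F (\<sigma> n)" for n by (rule st)
    show "0 \<le> \<sigma> n \<omega>" if "\<omega> \<in> space P" for n \<omega> by (rule s0[OF that])
    show "\<sigma> n \<omega> \<le> exit_time (real n) \<omega>" for n \<omega> by (simp add: \<sigma>_def)
    show "AE \<omega> in P. \<forall>t. \<forall>\<^sub>F n in sequentially. t \<le> \<sigma> n \<omega>"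
      using U(3) AE_space
    proof eventually_elim
      case (elim \<omega>)
      have "\<omega> \<in> paths" using elim(2) by (simp add: space_P)
      then have "\<forall>\<^sub>F n in sequentially. t \<le> U n \<omega> \<and> t \<le> exit_time (real n) \<omega>" for t
        using elim(1) exit_time_eventually[of \<omega> t] by (intro eventually_conj) simp_all
      then show ?case by (simp add: \<sigma>_def)
    qed
    show "\<exists>Z. martingale P ?F Z \<and> (\<forall>t\<ge>0. AE \<omega> in P. Z t \<omega> = \<omega> (min t (\<sigma> n \<omega>)) $ i)" for n i
      using Z[of "Inl i" n] by (simp add: M_def)
    show "\<exists>Z. martingale P ?F Z \<and> (\<forall>t\<ge>0. AE \<omega> in P. Z t \<omega> = \<omega> (min t (\<sigma> n \<omega>)) $ i * \<omega> (min t (\<sigma> n \<omega>)) $ j)"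
      if "i \<noteq> j" for n i j
      using Z[of "Inr (i, j)" n] that by (simp add: M_def)
    show "\<exists>Z. martingale P ?F Z \<and> (\<forall>t\<ge>0. AE \<omega> in P. Z t \<omega> = (\<omega> (min t (\<sigma> n \<omega>)) $ i)\<^sup>2 - (\<omega> (min t (\<sigma> n \<omega>)) $ j)\<^sup>2)" for n i j
    proof -
      obtain Y where Y: "martingale P ?F Y" "\<And>t. 0 \<le> t \<Longrightarrow> AE \<omega> in P. Y t \<omega> = M (Inr (i, i)) (min t (\<sigma> n \<omega>)) \<omega>"
        using Z by blast
      obtain W where W: "martingale P ?F W" "\<And>t. 0 \<le> t \<Longrightarrow> AE \<omega> in P. W t \<omega> = M (Inr (j, j)) (min t (\<sigma> n \<omega>)) \<omega>"
        using Z by blast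
      show ?thesis
      proof (intro exI conjI allI impI)
        show "martingale P ?F (\<lambda>t \<omega>. Y t \<omega> - W t \<omega>)" by (rule martingale_diff[OF Y(1) W(1)])
        show "AE \<omega> in P. Y t \<omega> - W t \<omega> = (\<omega> (min t (\<sigma> n \<omega>)) $ i)\<^sup>2 - (\<omega> (min t (\<sigma> n \<omega>)) $ j)\<^sup>2" if "0 \<le> t" for t
          using Y(2)[OF that] W(2)[OF that] by eventually_elim (simp add: M_def power2_eq_square)
      qed
    qed
  qed
qed

text \<open>Outside the ball of radius \<rho> the inverted point has norm at most
  \<open>inverse \<rho>\<close>, so the transform is bounded there although the path need not be.
  Stopping bounds the coordinates, \<open>trace_free_martingale\<close> applies, and dominated
  convergence removes the stopping.\<close>

lemma kelvin_martingale:
  fixes p :: "real ^ 'd \<Rightarrow> real" and dp :: "real ^ 'd \<Rightarrow> real ^ 'd" and S :: "'d \<Rightarrow> 'd \<Rightarrow> real" and l :: nat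
  assumes p: "\<And>x v. p (x + v) = p x + dp x \<bullet> v + (\<Sum>i\<in>UNIV. \<Sum>j\<in>UNIV. S i j * (v $ i * v $ j))"
    and contp: "continuous_on UNIV p" and contl: "continuous_on UNIV dp"
    and hom: "\<And>x. x \<bullet> dp x = real l * p x" "\<And>r x. p (r *\<^sub>R x) = r ^ l * p x"
    and trS: "(\<Sum>i\<in>UNIV. S i i) = 0"
  shows "martingale P coord_filtration (\<lambda>t \<omega>. kappa (\<omega> t) * p (inversion (\<omega> t)))"
proof -
  let ?F = "coord_filtration :: real \<Rightarrow> (real \<Rightarrow> real ^ 'd) measure"
  define a where "a = real CARD('d) / 2 - 1 + real l"
  define f where "f x = p x * ((norm x)\<^sup>2) powr (-a)" for x :: "real ^ 'd"
  define h where "h x = kappa x * p (inversion x)" for x :: "real ^ 'd"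
  have a0: "0 \<le> a" using dim by (simp add: a_def)
  have pm: "p \<in> borel_measurable borel" by (rule borel_measurable_continuous_onI[OF contp])
  have fm: "f \<in> borel_measurable borel" unfolding f_def[abs_def] using pm by measurable
  have hm: "h \<in> borel_measurable borel"
    unfolding h_def[abs_def] kappa_def using measurable_compose[OF borel_measurable_inversion pm] by measurable
  \<comment> \<open>Homogeneity moves the factor \<open>inverse ((norm x)^2) ^ l\<close> out of
    \<open>p\<close>. \<open>f\<close> has the polynomial in \<open>x\<close> and is suited to
    Taylor expansion, \<open>h\<close> is the form of the claim; the two agree off the
    origin.\<close>
  have fh: "f x = h x" if "x \<noteq> 0" for x
  proof -
    have q: "0 < (norm x)\<^sup>2" using that by simp
    have "- a = 1 - real CARD('d) / 2 + (- real l)" by (simp add: a_def)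
    then have "((norm x)\<^sup>2) powr (-a) = kappa x * inverse ((norm x)\<^sup>2) ^ l"
      using q by (simp only: powr_add kappa_def) (simp add: powr_minus powr_realpow power_inverse)
    then show ?thesis unfolding f_def h_def inversion_def hom(2) by (simp add: divide_inverse)
  qed
  obtain Bp where Bp: "0 \<le> Bp" "\<And>y. norm y \<le> inverse \<rho> \<Longrightarrow> \<bar>p y\<bar> \<le> Bp"
  proof -
    have "bounded (p ` cball 0 (inverse \<rho>))"
      by (intro compact_imp_bounded compact_continuous_image continuous_on_subset[OF contp]) auto
    then obtain B where "\<forall>y\<in>p ` cball 0 (inverse \<rho>). norm y \<le> B" by (auto simp: bounded_iff)
    then have "\<bar>p y\<bar> \<le> max B 0" if "norm y \<le> inverse \<rho>" for y using that by (auto simp: le_max_iff_disj)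
    then show ?thesis using that[of "max B 0"] by simp
  qed
  define Bf where "Bf = (\<rho>\<^sup>2) powr (1 - real CARD('d) / 2) * Bp"
  have hb: "\<bar>h x\<bar> \<le> Bf" if x: "\<rho> \<le> norm x" for x
  proof -
    have "norm (inversion x) \<le> inverse \<rho>" unfolding norm_inversion using x rho by (intro le_imp_inverse_le)
    then show ?thesis
      unfolding h_def Bf_def abs_mult using kappa_le[OF x] Bp by (intro mult_mono) (auto simp: kappa_def)
  qed
  have fb: "\<bar>f x\<bar> \<le> Bf" if x: "\<rho> \<le> norm x" for x
  proof -
    have "x \<noteq> 0" using x rho by auto
    then show ?thesis using hb[OF x] fh by simp
  qed
  obtain \<sigma> :: "nat \<Rightarrow> (real \<Rightarrow> real ^ 'd) \<Rightarrow> real" where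
    \<sigma>: "\<And>n. stopping_time ?F (\<sigma> n)" "\<And>n \<omega>. \<omega> \<in> space P \<Longrightarrow> 0 \<le> \<sigma> n \<omega>"
    "\<And>n \<omega>. \<omega> \<in> space P \<Longrightarrow> \<sigma> n \<omega> \<le> exit_time (real n) \<omega>"
    "AE \<omega> in P. \<forall>t. \<forall>\<^sub>F n in sequentially. t \<le> \<sigma> n \<omega>" and
    Z1: "\<And>n i. \<exists>Z. martingale P ?F Z \<and> (\<forall>t\<ge>0. AE \<omega> in P. Z t \<omega> = \<omega> (min t (\<sigma> n \<omega>)) $ i)" and
    Z2: "\<And>n i j. i \<noteq> j \<Longrightarrow> \<exists>Z. martingale P ?F Z \<and>
       (\<forall>t\<ge>0. AE \<omega> in P. Z t \<omega> = \<omega> (min t (\<sigma> n \<omega>)) $ i * \<omega> (min t (\<sigma> n \<omega>)) $ j)" and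
    Z3: "\<And>n i j. \<exists>Z. martingale P ?F Z \<and>
       (\<forall>t\<ge>0. AE \<omega> in P. Z t \<omega> = (\<omega> (min t (\<sigma> n \<omega>)) $ i)\<^sup>2 - (\<omega> (min t (\<sigma> n \<omega>)) $ j)\<^sup>2)"
    using stopped_components by blast
  \<comment> \<open>Once \<open>norm x\<^sub>0 \<le> real n\<close>, clipping changes the stopped
    path only on a null set; it gives the bound on every path that
    \<open>trace_free_martingale\<close> requires.\<close>
  define X :: "nat \<Rightarrow> real \<Rightarrow> (real \<Rightarrow> real ^ 'd) \<Rightarrow> real ^ 'd"
    where "X n t \<omega> = (\<chi> i. max (- real n) (min (real n) (\<omega> (min t (\<sigma> n \<omega>)) $ i)))" for n t \<omega>
  have XF: "(\<lambda>\<omega>. X n t \<omega> $ i) \<in> borel_measurable (?F t)" if "0 \<le> t" for n t i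
    using stopped_adapted[of "\<lambda>t \<omega>. \<omega> t $ i" "\<sigma> n" t, OF component_adapted component_continuous \<sigma>(1,2) that]
    unfolding X_def by simp
  have Xc: "continuous_on {0..} (\<lambda>t. X n t \<omega> $ i)" if w: "\<omega> \<in> space P" for n \<omega> i
  proof -
    have "continuous_on {0..} (\<lambda>t. \<omega> (min t (\<sigma> n \<omega>)) $ i)"
      by (rule continuous_on_compose2[OF component_continuous[OF w]])
         (use \<sigma>(2)[OF w] in \<open>auto intro!: continuous_intros\<close>)
    then show ?thesis unfolding X_def by (auto intro!: continuous_intros)
  qed
  have Xb: "\<bar>X n t \<omega> $ i\<bar> \<le> real n" for n t \<omega> i by (simp add: X_def)
  have Xeq: "AE \<omega> in P. \<forall>t\<ge>0. X n t \<omega> = \<omega> (min t (\<sigma> n \<omega>)) \<and> \<rho> \<le> norm (X n t \<omega>) \<and> norm (X n t \<omega>) \<le> real n"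
    if n: "norm x\<^sub>0 \<le> real n" for n
    using start away AE_space
  proof eventually_elim
    case (elim \<omega>)
    show ?case
    proof (intro allI impI)
      fix t :: real assume t: "0 \<le> t"
      let ?r = "min t (\<sigma> n \<omega>)"
      have r: "0 \<le> ?r" "?r \<le> exit_time (real n) \<omega>" using t \<sigma>(2,3)[OF elim(3), of n] by auto
      have le: "norm (\<omega> ?r) \<le> real n"
        using exit_time_bounds(2)[of \<omega> "real n" ?r] r elim n by (simp add: space_P)
      have "max (- real n) (min (real n) (\<omega> ?r $ i)) = \<omega> ?r $ i" for i
        using order_trans[OF component_le_norm_cart le, of i] by auto
      then have "X n t \<omega> = \<omega> ?r" by (simp add: X_def vec_eq_iff)
      then show "X n t \<omega> = \<omega> ?r \<and> \<rho> \<le> norm (X n t \<omega>) \<and> norm (X n t \<omega>) \<le> real n"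
        using le elim(2) r(1) by auto
    qed
  qed
  have fX: "martingale P ?F (\<lambda>t \<omega>. f (X n t \<omega>))" if n: "norm x\<^sub>0 \<le> real n" for n
  proof -
    define R where "R = {x :: real ^ 'd. \<rho> \<le> norm x \<and> norm x \<le> real n}"
    obtain G H C where G: "\<And>i. continuous_on R (\<lambda>x. G x i)" and H: "\<And>i j. continuous_on R (\<lambda>x. H x i j)"
      and tr: "\<And>x. x \<in> R \<Longrightarrow> (\<Sum>i\<in>UNIV. H x i i) = 0" and C: "0 \<le> C"
      and taylor: "\<And>x y. x \<in> R \<Longrightarrow> y \<in> R \<Longrightarrow>
        \<bar>f y - f x - (\<Sum>i\<in>UNIV. G x i * (y $ i - x $ i))
          - (\<Sum>i\<in>UNIV. \<Sum>j\<in>UNIV. H x i j * ((y $ i - x $ i) * (y $ j - x $ j)))\<bar> \<le> C * norm (y - x) ^ 3"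
      using kelvin_taylor[OF p contp contl hom(1) trS a_def a0 rho of_nat_0_le_iff[of n], folded R_def f_def] by blast
    have clR: "closed R"
    proof -
      have "R = cball 0 (real n) - ball 0 \<rho>" by (auto simp: R_def)
      then show ?thesis by (simp add: closed_Diff)
    qed
    have compR: "compact R"
      using clR by (rule compact_eq_bounded_closed[THEN iffD2, OF conjI, rotated])
        (auto simp: R_def bounded_iff)
    have bdd: "\<exists>B. \<forall>x\<in>R. \<bar>g x\<bar> \<le> B" if "continuous_on R g" for g :: "real ^ 'd \<Rightarrow> real"
    proof -
      have "bounded (g ` R)" by (rule compact_imp_bounded[OF compact_continuous_image[OF that compR]])
      then show ?thesis by (auto simp: bounded_iff)
    qed
    obtain B1 where B1: "\<And>i x. x \<in> R \<Longrightarrow> \<bar>G x i\<bar> \<le> B1 i" using bdd[OF G] by metis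
    have "\<forall>ij. \<exists>B. \<forall>x\<in>R. \<bar>H x (fst ij) (snd ij)\<bar> \<le> B" using bdd[OF H] by blast
    from choice[OF this] obtain B2 where B2: "\<And>i j x. x \<in> R \<Longrightarrow> \<bar>H x i j\<bar> \<le> B2 (i, j)" by fastforce
    define B where "B = Bf + (\<Sum>i\<in>UNIV. \<bar>B1 i\<bar>) + (\<Sum>ij\<in>UNIV. \<bar>B2 ij\<bar>)"
    have Bf0: "0 \<le> Bf" unfolding Bf_def using Bp by simp
    have BB: "Bf \<le> B" "\<bar>B1 i\<bar> \<le> B" "\<bar>B2 ij\<bar> \<le> B" "0 \<le> B" for i ij
    proof -
      have 1: "0 \<le> (\<Sum>i\<in>UNIV. \<bar>B1 i\<bar>)" "0 \<le> (\<Sum>ij\<in>UNIV. \<bar>B2 ij\<bar>)" by (auto intro: sum_nonneg)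
      have "\<bar>B1 i\<bar> \<le> (\<Sum>i\<in>UNIV. \<bar>B1 i\<bar>)" by (rule member_le_sum) auto
      moreover have "\<bar>B2 ij\<bar> \<le> (\<Sum>ij\<in>UNIV. \<bar>B2 ij\<bar>)" by (rule member_le_sum) auto
      ultimately show "Bf \<le> B" "\<bar>B1 i\<bar> \<le> B" "\<bar>B2 ij\<bar> \<le> B" "0 \<le> B" unfolding B_def using 1 Bf0 by linarith+
    qed
    \<comment> \<open>Cut off outside \<open>R\<close>, the coefficients become bounded on the whole
      space, and \<open>H'\<close> has trace zero everywhere; they are Borel because
      \<open>R\<close> is closed.\<close>
    define G' where "G' x i = (if x \<in> R then G x i else 0)" for x i
    define H' where "H' x i j = (if x \<in> R then H x i j else 0)" for x i j
    have cutm: "(\<lambda>x. if x \<in> R then g x else 0) \<in> borel_measurable borel" if "continuous_on R g" for g :: "real ^ 'd \<Rightarrow> real"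
      by (rule borel_measurable_continuous_on_if[OF _ that]) (use clR in auto)
    have mart: "martingale P ?F (\<lambda>t \<omega>. \<phi> (X n t \<omega>))"
      if \<phi>: "\<And>t. 0 \<le> t \<Longrightarrow> (\<lambda>\<omega>. \<phi> (X n t \<omega>)) \<in> borel_measurable (?F t)"
        and Z: "\<exists>Z. martingale P ?F Z \<and> (\<forall>t\<ge>0. AE \<omega> in P. Z t \<omega> = \<phi> (\<omega> (min t (\<sigma> n \<omega>))))"
      for \<phi> :: "real ^ 'd \<Rightarrow> real"
    proof -
      obtain Z where Z: "martingale P ?F Z" "\<And>t. 0 \<le> t \<Longrightarrow> AE \<omega> in P. Z t \<omega> = \<phi> (\<omega> (min t (\<sigma> n \<omega>)))"
        using Z by blast
      show ?thesis
      proof (rule martingale_cong_AE[OF Z(1) \<phi>])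
        show "AE \<omega> in P. \<phi> (X n t \<omega>) = Z t \<omega>" if "0 \<le> t" for t
          using Xeq[OF n] Z(2)[OF that] by eventually_elim (use that in auto)
      qed
    qed
    show ?thesis
    proof (rule trace_free_martingale[where X="X n" and R=R and G=G' and H=H' and B=B and C=C and K="real n" and c=undefined])
      show "martingale P ?F (\<lambda>t \<omega>. X n t \<omega> $ i)" for i
        by (rule mart[of "\<lambda>x. x $ i", OF XF Z1])
      show "martingale P ?F (\<lambda>t \<omega>. X n t \<omega> $ i * X n t \<omega> $ j)" if "i \<noteq> j" for i j
        by (rule mart[of "\<lambda>x. x $ i * x $ j", OF _ Z2[OF that]]) (intro borel_measurable_times XF)
      show "martingale P ?F (\<lambda>t \<omega>. (X n t \<omega> $ i)\<^sup>2 - (X n t \<omega> $ undefined)\<^sup>2)" for i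
        by (rule mart[of "\<lambda>x. (x $ i)\<^sup>2 - (x $ undefined)\<^sup>2", OF _ Z3])
           (intro borel_measurable_diff borel_measurable_power XF)
      show "AE \<omega> in P. \<forall>t\<ge>0. X n t \<omega> \<in> R" using Xeq[OF n] by eventually_elim (auto simp: R_def)
      show "\<bar>f x\<bar> \<le> B" if "x \<in> R" for x using fb[of x] BB(1) that by (auto simp: R_def)
      show "(\<lambda>x. G' x i) \<in> borel_measurable borel" for i unfolding G'_def by (rule cutm[OF G])
      show "\<bar>G' x i\<bar> \<le> B" for x i using B1[of x i] BB(2)[of i] BB(4) by (auto simp: G'_def)
      show "(\<lambda>x. H' x i j) \<in> borel_measurable borel" for i j unfolding H'_def by (rule cutm[OF H])
      show "\<bar>H' x i j\<bar> \<le> B" for x i j using B2[of x i j] BB(3)[of "(i, j)"] BB(4) by (auto simp: H'_def)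
      show "(\<Sum>i\<in>UNIV. H' x i i) = 0" for x
        using tr[of x] by (cases "x \<in> R") (simp_all add: H'_def)
      show "\<bar>f y - f x - (\<Sum>i\<in>UNIV. G' x i * (y $ i - x $ i))
          - (\<Sum>i\<in>UNIV. \<Sum>j\<in>UNIV. H' x i j * ((y $ i - x $ i) * (y $ j - x $ j)))\<bar> \<le> C * norm (y - x) ^ 3"
        if "x \<in> R" "y \<in> R" for x y
        using taylor[OF that] that by (simp add: G'_def H'_def)
    qed (auto simp: Xc Xb fm C)
  qed
  \<comment> \<open>From \<open>n0\<close> on the start lies in the ball of radius \<open>n\<close>,
    as \<open>exit_time_bounds\<close> needs; hence the shift \<open>n + n0\<close> in the
    limit.\<close>
  obtain n0 :: nat where n0: "norm x\<^sub>0 \<le> real n0" using real_arch_simple by blast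
  have hF: "(\<lambda>\<omega>. h (\<omega> t)) \<in> borel_measurable (?F t)" if "0 \<le> t" for t
    by (rule measurable_compose[OF measurable_coord_filtration hm]) (use that in auto)
  have aeb: "AE \<omega> in P. \<bar>h (\<omega> t)\<bar> \<le> Bf" if "0 \<le> t" for t
    using away by eventually_elim (use hb that in auto)
  have "martingale P ?F (\<lambda>t \<omega>. h (\<omega> t))"
  proof (rule martingale_L1_limit[where M="\<lambda>n t \<omega>. f (X (n + n0) t \<omega>)"])
    show "martingale P ?F (\<lambda>t \<omega>. f (X (n + n0) t \<omega>))" for n by (rule fX) (use n0 in simp)
    show "integrable P (\<lambda>\<omega>. h (\<omega> t))" if "0 \<le> t" for t
      by (rule integrable_const_bound[where B=Bf]) (use aeb[OF that] measurable_F[OF hF[OF that]] in auto)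
    show "(\<lambda>n. \<integral>\<omega>. \<bar>f (X (n + n0) t \<omega>) - h (\<omega> t)\<bar> \<partial>P) \<longlonglongrightarrow> 0" if t: "0 \<le> t" for t
    proof -
      have "(\<lambda>n. \<integral>\<omega>. \<bar>f (X (n + n0) t \<omega>) - h (\<omega> t)\<bar> \<partial>P) \<longlonglongrightarrow> (\<integral>\<omega>. 0 \<partial>P)"
      proof (rule integral_dominated_convergence[where w="\<lambda>_. 2 * Bf"])
        have fXm: "(\<lambda>\<omega>. f (X (n + n0) t \<omega>)) \<in> borel_measurable P" for n
          using martingale_measurable[OF fX[of "n + n0"] t] n0 by simp
        then show "(\<lambda>\<omega>. \<bar>f (X (n + n0) t \<omega>) - h (\<omega> t)\<bar>) \<in> borel_measurable P" for n
          using measurable_F[OF hF[OF t]] by simp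
        have all: "AE \<omega> in P. \<forall>n. \<forall>t\<ge>0. X (n + n0) t \<omega> = \<omega> (min t (\<sigma> (n + n0) \<omega>)) \<and> \<rho> \<le> norm (X (n + n0) t \<omega>)"
          unfolding AE_all_countable
        proof
          fix n
          have "norm x\<^sub>0 \<le> real (n + n0)" using n0 by simp
          from Xeq[OF this] show "AE \<omega> in P. \<forall>t\<ge>0. X (n + n0) t \<omega> = \<omega> (min t (\<sigma> (n + n0) \<omega>)) \<and> \<rho> \<le> norm (X (n + n0) t \<omega>)"
            by eventually_elim auto
        qed
        show "AE \<omega> in P. (\<lambda>n. \<bar>f (X (n + n0) t \<omega>) - h (\<omega> t)\<bar>) \<longlonglongrightarrow> 0"
          using all away \<sigma>(4)
        proof eventually_elim
          case (elim \<omega>)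
          have "\<forall>\<^sub>F n in sequentially. t \<le> \<sigma> (n + n0) \<omega>"
            using elim(3) sequentially_offset[of "\<lambda>n. t \<le> \<sigma> n \<omega>" n0] by auto
          then have "\<forall>\<^sub>F n in sequentially. \<bar>f (X (n + n0) t \<omega>) - h (\<omega> t)\<bar> = 0"
          proof eventually_elim
            case (elim n)
            have "X (n + n0) t \<omega> = \<omega> t" using \<open>\<forall>n. \<forall>t\<ge>0. _\<close> t elim by (simp add: min_absorb1)
            moreover have "\<omega> t \<noteq> 0" using \<open>\<forall>t\<ge>0. \<rho> \<le> norm (\<omega> t)\<close> t rho by fastforce
            ultimately show ?case using fh by simp
          qed
          then show ?case by (rule tendsto_eventually)
        qed
        show "AE \<omega> in P. norm \<bar>f (X (n + n0) t \<omega>) - h (\<omega> t)\<bar> \<le> 2 * Bf" for n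
          using all aeb[OF t]
        proof eventually_elim
          case (elim \<omega>)
          then have "\<bar>f (X (n + n0) t \<omega>)\<bar> \<le> Bf" using fb t by blast
          then show ?case using elim(2) by simp
        qed
      qed auto
      then show ?thesis by simp
    qed
  qed (use hF in auto)
  then show ?thesis by (simp add: h_def)
qed

lemma sum_delta_pair:
  fixes g :: "'d \<Rightarrow> 'd \<Rightarrow> real"
  shows "(\<Sum>a\<in>UNIV. \<Sum>b\<in>UNIV. (if a = i \<and> b = j then 1 else 0) * g a b) = g i j"
proof -
  have "(\<Sum>b\<in>UNIV. (if a = i \<and> b = j then 1 else 0) * g a b) = (if a = i then g i j else 0)" for a
  proof -
    have "(\<Sum>b\<in>UNIV. (if a = i \<and> b = j then 1 else 0) * g a b) = (\<Sum>b\<in>UNIV. if b = j then (if a = i then g i j else 0) else 0)"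
      by (intro sum.cong) auto
    then show ?thesis by simp
  qed
  then show ?thesis by simp
qed

text \<open>The harmonic polynomials \<open>1\<close>, \<open>x_i\<close>, \<open>x_i * x_j\<close>
  and \<open>x_i^2 - x_j^2\<close>, of degrees 0, 1, 2 and 2. The half Hessian of
  \<open>x_i * x_j\<close> is given by the single entry \<open>(i, j)\<close>: only its quadratic
  form and trace matter, and the trace vanishes as \<open>i \<noteq> j\<close>.\<close>

lemma kappa_martingales:
  shows kappa_martingale: "martingale P coord_filtration (\<lambda>t \<omega>. kappa (\<omega> t))"
    and "martingale P coord_filtration (\<lambda>t \<omega>. kappa (\<omega> t) * inversion (\<omega> t) $ i)"
    and "i \<noteq> j \<Longrightarrow> martingale P coord_filtration (\<lambda>t \<omega>. kappa (\<omega> t) * (inversion (\<omega> t) $ i * inversion (\<omega> t) $ j))"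
    and "martingale P coord_filtration (\<lambda>t \<omega>. kappa (\<omega> t) * ((inversion (\<omega> t) $ i)\<^sup>2 - (inversion (\<omega> t) $ j)\<^sup>2))"
proof -
  show "martingale P coord_filtration (\<lambda>t \<omega>. kappa (\<omega> t))"
    using kelvin_martingale[of "\<lambda>_. 1" "\<lambda>_. 0" "\<lambda>_ _. 0" 0] by simp
  show "martingale P coord_filtration (\<lambda>t \<omega>. kappa (\<omega> t) * inversion (\<omega> t) $ i)"
    by (rule kelvin_martingale[where p="\<lambda>x. x $ i" and dp="\<lambda>_. axis i 1" and S="\<lambda>_ _. 0" and l=1])
       (auto simp: inner_axis inner_axis' intro!: continuous_intros)
  have pij: "(x $ i + v $ i) * (x $ j + v $ j) = x $ i * x $ j + (x $ j *\<^sub>R axis i 1 + x $ i *\<^sub>R axis j 1) \<bullet> v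
     + (\<Sum>a\<in>UNIV. \<Sum>b\<in>UNIV. (if a = i \<and> b = j then 1 else 0) * (v $ a * v $ b))" for x v :: "real ^ 'd"
    unfolding sum_delta_pair by (simp add: inner_simps inner_axis inner_axis' algebra_simps)
  show "martingale P coord_filtration (\<lambda>t \<omega>. kappa (\<omega> t) * (inversion (\<omega> t) $ i * inversion (\<omega> t) $ j))" if ij: "i \<noteq> j"
    by (rule kelvin_martingale[where p="\<lambda>x. x $ i * x $ j" and dp="\<lambda>x. x $ j *\<^sub>R axis i 1 + x $ i *\<^sub>R axis j 1"
          and S="\<lambda>a b. if a = i \<and> b = j then 1 else 0" and l=2])
       (use ij in \<open>auto simp: pij inner_simps inner_axis inner_axis' power2_eq_square intro!: continuous_intros sum.neutral\<close>)
  have p: "(x $ i + v $ i)\<^sup>2 - (x $ j + v $ j)\<^sup>2 = (x $ i)\<^sup>2 - (x $ j)\<^sup>2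
     + ((2 * x $ i) *\<^sub>R axis i 1 - (2 * x $ j) *\<^sub>R axis j 1) \<bullet> v
     + (\<Sum>a\<in>UNIV. \<Sum>b\<in>UNIV. ((if a = i \<and> b = i then 1 else 0) - (if a = j \<and> b = j then 1 else 0)) * (v $ a * v $ b))" for x v :: "real ^ 'd"
    unfolding left_diff_distrib sum_subtractf sum_delta_pair
    by (simp add: inner_simps inner_axis inner_axis' power2_eq_square algebra_simps)
  show "martingale P coord_filtration (\<lambda>t \<omega>. kappa (\<omega> t) * ((inversion (\<omega> t) $ i)\<^sup>2 - (inversion (\<omega> t) $ j)\<^sup>2))"
  proof (rule kelvin_martingale[where p="\<lambda>x. (x $ i)\<^sup>2 - (x $ j)\<^sup>2"
        and dp="\<lambda>x. (2 * x $ i) *\<^sub>R axis i 1 - (2 * x $ j) *\<^sub>R axis j 1"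
        and S="\<lambda>a b. (if a = i \<and> b = i then 1 else 0) - (if a = j \<and> b = j then 1 else 0)" and l=2], goal_cases)
    case (1 x v) show ?case unfolding vector_add_component by (rule p)
  next
    case (4 x) show ?case by (simp add: inner_simps inner_axis power2_eq_square algebra_simps)
  next
    case (5 r x) show ?case by (simp add: power_mult_distrib right_diff_distrib)
  qed (auto simp: sum_subtractf intro!: continuous_intros)
qed

end

section \<open>The Kelvin-transformed measure\<close>

lemma mono_on_locally_bounded_variation:
  assumes "mono_on {0..} f"
  shows "locally_bounded_variation f"
  unfolding locally_bounded_variation_def
proof (intro allI impI exI)
  fix t :: real and n :: nat and s assume "0 \<le> t" and s: "incseq s \<and> range s \<subseteq> {0..t}"
  have s0: "0 \<le> s k" "s k \<le> t" for k using s by (auto simp: image_subset_iff)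
  have "\<bar>f (s (Suc k)) - f (s k)\<bar> = f (s (Suc k)) - f (s k)" for k
    using monotone_onD[OF assms, of "s k" "s (Suc k)"] s0 incseqD[of s k "Suc k"] s by simp
  then have "(\<Sum>k<n. \<bar>f (s (Suc k)) - f (s k)\<bar>) = f (s n) - f (s 0)"
    by (simp add: sum_lessThan_telescope[where f="\<lambda>k. f (s k)"])
  also have "\<dots> \<le> f t - f 0"
    using monotone_onD[OF assms, of "s n" t] monotone_onD[OF assms, of 0 "s 0"] s0 \<open>0 \<le> t\<close> by (auto intro: diff_mono)
  finally show "(\<Sum>k<n. \<bar>f (s (Suc k)) - f (s k)\<bar>) \<le> f t - f 0" .
qed

lemma kappa_mult_power:
  fixes x :: "real ^ 'd"
  assumes "x \<noteq> 0" "CARD('d) > 2"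
  shows "kappa x * norm x ^ (CARD('d) - 2) = 1"
proof -
  have n: "0 < norm x" using assms by simp
  have "kappa x = norm x powr (2 * (1 - real CARD('d) / 2))"
    unfolding kappa_def using n by (subst powr_powr[symmetric]) simp
  moreover have "norm x ^ (CARD('d) - 2) = norm x powr (real CARD('d) - 2)"
    using n assms(2) by (subst powr_realpow[symmetric]) (auto simp: of_nat_diff)
  ultimately show ?thesis using n by (simp add: powr_add[symmetric] right_diff_distrib)
qed

text \<open>Valid at the origin as well: with \<open>inverse 0 = 0\<close> and the positive exponent
  \<open>CARD('d) - 2\<close> both sides are zero there.\<close>

lemma norm_powi_inversion:
  fixes x y :: "real ^ 'd"
  assumes "CARD('d) > 2"
  shows "norm y powi (2 - int CARD('d)) = inverse (norm y) ^ (CARD('d) - 2)"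
    and "norm (inversion x) powi (2 - int CARD('d)) = norm x ^ (CARD('d) - 2)"
proof -
  have "nat (- (2 - int CARD('d))) = CARD('d) - 2" "\<not> 0 \<le> 2 - int CARD('d)" using assms by auto
  then have 1: "norm z powi (2 - int CARD('d)) = inverse (norm z) ^ (CARD('d) - 2)" for z :: "real ^ 'd"
    by (simp add: power_int_def)
  show "norm y powi (2 - int CARD('d)) = inverse (norm y) ^ (CARD('d) - 2)" by (rule 1)
  show "norm (inversion x) powi (2 - int CARD('d)) = norm x ^ (CARD('d) - 2)"
    unfolding 1[of "inversion x"] by (simp add: norm_inversion)
qed

context filtered_prob_space
begin

text \<open>The hypothesis \<open>eq\<close> says that \<open>Y\<close> is the conditional
  expectation of \<open>Z\<close>, so weights known at time \<open>t\<close> can be pulled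
  out.\<close>

lemma closed_mult:
  fixes Z Y W :: "'w \<Rightarrow> real"
  assumes Z: "integrable P Z" and Y: "integrable P Y" "Y \<in> borel_measurable (F t)"
    and eq: "\<And>A. A \<in> sets (F t) \<Longrightarrow> (\<integral>\<omega>. indicator A \<omega> * Z \<omega> \<partial>P) = (\<integral>\<omega>. indicator A \<omega> * Y \<omega> \<partial>P)"
    and W: "W \<in> borel_measurable (F t)" "integrable P (\<lambda>\<omega>. W \<omega> * Z \<omega>)"
  shows "(\<integral>\<omega>. W \<omega> * Z \<omega> \<partial>P) = (\<integral>\<omega>. W \<omega> * Y \<omega> \<partial>P)"
proof -
  interpret S: sigma_finite_subalgebra P "F t" by (rule sigma_finite_subalgebra_F)
  note [measurable] = borel_measurable_integrable[OF Z] borel_measurable_integrable[OF Y(1)] measurable_F[OF W(1)]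
  have ae: "AE \<omega> in P. real_cond_exp P (F t) Z \<omega> = Y \<omega>"
    by (rule S.real_cond_exp_charact[OF _ Z Y]) (use eq in \<open>simp add: set_lebesgue_integral_def\<close>)
  have "(\<integral>\<omega>. W \<omega> * Z \<omega> \<partial>P) = (\<integral>\<omega>. W \<omega> * real_cond_exp P (F t) Z \<omega> \<partial>P)"
    using S.real_cond_exp_intg(2)[OF W(2,1)] by simp
  also have "\<dots> = (\<integral>\<omega>. W \<omega> * Y \<omega> \<partial>P)"
    by (rule integral_cong_AE) (use ae in \<open>auto elim: eventually_mono\<close>)
  finally show ?thesis .
qed

end

context exterior_process
begin

definition kappa_bound :: real where "kappa_bound = (\<rho>\<^sup>2) powr (1 - real CARD('d) / 2)"

lemma kappa_nonneg: "0 \<le> kappa x"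
  by (simp add: kappa_def)

lemma kappa_measurable: "kappa \<in> borel_measurable borel"
  unfolding kappa_def[abs_def] by measurable

lemma kappa_path_le: "AE \<omega> in P. \<forall>t\<ge>0. kappa (\<omega> t) \<le> kappa_bound"
  using away by eventually_elim (auto simp: kappa_bound_def intro: kappa_le)

text \<open>The bound on \<open>kappa\<close> along the path holds only almost surely, so the
  martingale is capped at \<open>kappa_bound\<close> before it is closed, and its limit is clipped
  again; the result has the bounds on every path.\<close>

lemma limit_density_exists:
  obtains Z where "Z \<in> borel_measurable P" "\<And>\<omega>. 0 \<le> Z \<omega>" "\<And>\<omega>. Z \<omega> \<le> kappa_bound"
    "\<And>t A. 0 \<le> t \<Longrightarrow> A \<in> sets (coord_filtration t) \<Longrightarrow>
       (\<integral>\<omega>. indicator A \<omega> * Z \<omega> \<partial>P) = (\<integral>\<omega>. indicator A \<omega> * kappa (\<omega> t) \<partial>P)"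
proof -
  let ?F = "coord_filtration :: real \<Rightarrow> (real \<Rightarrow> real ^ 'd) measure"
  have kb0: "0 \<le> kappa_bound" by (simp add: kappa_bound_def)
  define M where "M t \<omega> = min kappa_bound (kappa (\<omega> t))" for t and \<omega> :: "real \<Rightarrow> real ^ 'd"
  have MF: "M t \<in> borel_measurable (?F t)" if "0 \<le> t" for t
    using martingale_adapted[OF kappa_martingale that] unfolding M_def[abs_def] by measurable
  have Meq: "AE \<omega> in P. M t \<omega> = kappa (\<omega> t)" if "0 \<le> t" for t
    using kappa_path_le by eventually_elim (use that in \<open>auto simp: M_def\<close>)
  have M: "martingale P ?F M" by (rule martingale_cong_AE[OF kappa_martingale MF Meq])
  have Mb: "0 \<le> M t \<omega>" "M t \<omega> \<le> kappa_bound" for t \<omega> using kb0 kappa_nonneg by (auto simp: M_def)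
  have Mb': "\<bar>M t \<omega>\<bar> \<le> kappa_bound" for t \<omega> using Mb[of t \<omega>] by simp
  obtain Z and r :: "nat \<Rightarrow> real" where Z: "Z \<in> borel_measurable P" "integrable P Z"
    "AE \<omega> in P. (\<lambda>n. M (r n) \<omega>) \<longlonglongrightarrow> Z \<omega>"
    "\<And>t A. 0 \<le> t \<Longrightarrow> A \<in> sets (?F t) \<Longrightarrow> (\<integral>\<omega>. indicator A \<omega> * Z \<omega> \<partial>P) = (\<integral>\<omega>. indicator A \<omega> * M t \<omega> \<partial>P)"
    by (rule bounded_martingale_closed[OF M Mb']) (rule that)
  have Zb: "AE \<omega> in P. 0 \<le> Z \<omega> \<and> Z \<omega> \<le> kappa_bound"
    using Z(3)
  proof eventually_elim
    case (elim \<omega>)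
    show ?case
      using LIMSEQ_le_const[OF elim, of 0] LIMSEQ_le_const2[OF elim, of kappa_bound] Mb by auto
  qed
  show ?thesis
  proof (rule that[of "\<lambda>\<omega>. max 0 (min kappa_bound (Z \<omega>))"])
    show "(\<lambda>\<omega>. max 0 (min kappa_bound (Z \<omega>))) \<in> borel_measurable P" using Z(1) by measurable
    fix t :: real and A assume t: "0 \<le> t" and A: "A \<in> sets (?F t)"
    note [measurable] = Z(1) indicator_F[OF A] measurable_F[OF MF[OF t]] martingale_measurable[OF kappa_martingale t]
    have "(\<integral>\<omega>. indicator A \<omega> * max 0 (min kappa_bound (Z \<omega>)) \<partial>P) = (\<integral>\<omega>. indicator A \<omega> * Z \<omega> \<partial>P)"
    proof (rule integral_cong_AE)
      show "AE \<omega> in P. indicator A \<omega> * max 0 (min kappa_bound (Z \<omega>)) = indicator A \<omega> * Z \<omega>"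
        using Zb by eventually_elim auto
    qed measurable
    also have "\<dots> = (\<integral>\<omega>. indicator A \<omega> * M t \<omega> \<partial>P)" by (rule Z(4)[OF t A])
    also have "\<dots> = (\<integral>\<omega>. indicator A \<omega> * kappa (\<omega> t) \<partial>P)"
      by (rule integral_cong_AE) (use Meq[OF t] in \<open>auto elim!: eventually_mono\<close>)
    finally show "(\<integral>\<omega>. indicator A \<omega> * max 0 (min kappa_bound (Z \<omega>)) \<partial>P) = (\<integral>\<omega>. indicator A \<omega> * kappa (\<omega> t) \<partial>P)" .
  qed (use kb0 in auto)
qed

end

section \<open>Change of measure and the law of the inverted path\<close>

locale exterior_density = exterior_process P x\<^sub>0 \<rho>
  for P :: "(real \<Rightarrow> real ^ 'd) measure" and x\<^sub>0 \<rho> +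
  fixes Z :: "(real \<Rightarrow> real ^ 'd) \<Rightarrow> real"
  assumes Z_measurable: "Z \<in> borel_measurable P"
    and Z_nonneg: "0 \<le> Z \<omega>" and Z_le: "Z \<omega> \<le> kappa_bound"
    and Z_closed: "0 \<le> t \<Longrightarrow> A \<in> sets (coord_filtration t) \<Longrightarrow>
       (\<integral>\<omega>. indicator A \<omega> * Z \<omega> \<partial>P) = (\<integral>\<omega>. indicator A \<omega> * kappa (\<omega> t) \<partial>P)"
begin

lemma Z_integrable: "integrable P Z"
  by (rule integrable_bounded[OF Z_measurable, where C=kappa_bound]) (use Z_nonneg Z_le in auto)

lemma integrable_mult_Z:
  assumes "W \<in> borel_measurable P" "AE \<omega> in P. \<bar>W \<omega>\<bar> \<le> C"
  shows "integrable P (\<lambda>\<omega>. W \<omega> * Z \<omega>)"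
proof (rule integrable_const_bound[where B="C * kappa_bound"])
  show "AE \<omega> in P. norm (W \<omega> * Z \<omega>) \<le> C * kappa_bound"
    using assms(2)
  proof eventually_elim
    case (elim \<omega>)
    then show ?case using Z_nonneg[of \<omega>] Z_le[of \<omega>] by (simp add: abs_mult mult_mono')
  qed
  show "(\<lambda>\<omega>. W \<omega> * Z \<omega>) \<in> borel_measurable P" using assms(1) Z_measurable by measurable
qed

lemma integral_mult_Z:
  assumes t: "0 \<le> t" and W: "W \<in> borel_measurable (coord_filtration t)" "AE \<omega> in P. \<bar>W \<omega>\<bar> \<le> C"
  shows "(\<integral>\<omega>. W \<omega> * Z \<omega> \<partial>P) = (\<integral>\<omega>. W \<omega> * kappa (\<omega> t) \<partial>P)"
  by (rule closed_mult[OF Z_integrable martingale_integrable[OF kappa_martingale t]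
        martingale_adapted[OF kappa_martingale t] Z_closed[OF t] W(1) integrable_mult_Z[OF measurable_F[OF W(1)] W(2)]])

lemma kappa_start: "0 < kappa x\<^sub>0"
  using norm_start rho by (auto simp: kappa_def)

lemma integral_Z: "(\<integral>\<omega>. Z \<omega> \<partial>P) = kappa x\<^sub>0"
proof -
  have "(\<integral>\<omega>. Z \<omega> \<partial>P) = (\<integral>\<omega>. kappa (\<omega> 0) \<partial>P)"
    using integral_mult_Z[of 0 "\<lambda>_. 1" 1] by simp
  also have "\<dots> = (\<integral>\<omega>. kappa x\<^sub>0 \<partial>P)"
    by (rule integral_cong_AE)
       (use start martingale_measurable[OF kappa_martingale, of 0] in \<open>auto elim!: eventually_mono\<close>)
  finally show ?thesis by (simp add: prob_space)
qed

definition kelvin_measure :: "(real \<Rightarrow> real ^ 'd) measure" where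
  "kelvin_measure = distr (density P (\<lambda>\<omega>. ennreal (Z \<omega> / kappa x\<^sub>0))) path_space path_inversion"

lemma sets_kelvin_measure: "sets kelvin_measure = sets path_space"
  by (simp add: kelvin_measure_def)

lemma measurable_P_eq: "measurable P N = measurable path_space N"
  by (rule measurable_cong_sets[OF sets_P refl])

lemma path_inversion_measurable_P: "path_inversion \<in> measurable P path_space"
  unfolding measurable_P_eq by (rule measurable_path_inversion)

lemma
  fixes g :: "(real \<Rightarrow> real ^ 'd) \<Rightarrow> real"
  assumes g: "g \<in> borel_measurable path_space"
  shows integral_kelvin_measure:
      "(\<integral>\<omega>. g \<omega> \<partial>kelvin_measure) = (\<integral>\<omega>. g (path_inversion \<omega>) * Z \<omega> \<partial>P) / kappa x\<^sub>0"
    and integrable_kelvin_measure: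
      "integrable P (\<lambda>\<omega>. g (path_inversion \<omega>) * Z \<omega>) \<Longrightarrow> integrable kelvin_measure g"
proof -
  let ?D = "density P (\<lambda>\<omega>. ennreal (Z \<omega> / kappa x\<^sub>0))"
  have J: "path_inversion \<in> measurable ?D path_space" using path_inversion_measurable_P by simp
  have gJ: "(\<lambda>\<omega>. g (path_inversion \<omega>)) \<in> borel_measurable P"
    by (rule measurable_compose[OF path_inversion_measurable_P g])
  have d: "(\<lambda>\<omega>. Z \<omega> / kappa x\<^sub>0) \<in> borel_measurable P" "AE \<omega> in P. 0 \<le> Z \<omega> / kappa x\<^sub>0"
    using Z_measurable Z_nonneg kappa_start by (auto intro!: divide_nonneg_pos)
  have e: "(Z \<omega> / kappa x\<^sub>0) *\<^sub>R g (path_inversion \<omega>) = g (path_inversion \<omega>) * Z \<omega> / kappa x\<^sub>0" for \<omega> by simp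
  show "(\<integral>\<omega>. g \<omega> \<partial>kelvin_measure) = (\<integral>\<omega>. g (path_inversion \<omega>) * Z \<omega> \<partial>P) / kappa x\<^sub>0"
    unfolding kelvin_measure_def integral_distr[OF J g] integral_density[OF gJ d] e by simp
  show "integrable kelvin_measure g" if "integrable P (\<lambda>\<omega>. g (path_inversion \<omega>) * Z \<omega>)"
    unfolding kelvin_measure_def integrable_distr_eq[OF J g] integrable_density[OF gJ d] e using that by simp
qed

lemma prob_space_kelvin_measure: "prob_space kelvin_measure"
  unfolding kelvin_measure_def
proof (rule prob_space.prob_space_distr)
  show "prob_space (density P (\<lambda>\<omega>. ennreal (Z \<omega> / kappa x\<^sub>0)))"
  proof (rule prob_spaceI)
    have "emeasure (density P (\<lambda>\<omega>. ennreal (Z \<omega> / kappa x\<^sub>0))) (space P) = (\<integral>\<^sup>+\<omega>. ennreal (Z \<omega> / kappa x\<^sub>0) \<partial>P)"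
      using Z_measurable by (subst emeasure_density) (auto intro!: nn_integral_cong)
    also have "\<dots> = ennreal (\<integral>\<omega>. Z \<omega> / kappa x\<^sub>0 \<partial>P)"
      using Z_integrable Z_nonneg kappa_start by (intro nn_integral_eq_integral) auto
    also have "\<dots> = 1" using integral_Z kappa_start by simp
    finally show "emeasure (density P (\<lambda>\<omega>. ennreal (Z \<omega> / kappa x\<^sub>0))) (space (density P (\<lambda>\<omega>. ennreal (Z \<omega> / kappa x\<^sub>0)))) = 1"
      by simp
  qed
  show "path_inversion \<in> measurable (density P (\<lambda>\<omega>. ennreal (Z \<omega> / kappa x\<^sub>0))) path_space"
    using path_inversion_measurable_P by simp
qed

sublocale Q: filtered_prob_space kelvin_measure coord_filtration
  by (rule filtered_prob_space_coord_filtration[OF prob_space_kelvin_measure sets_kelvin_measure])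

text \<open>\<open>R\<close> is an arbitrary predicate, possibly not measurable, so a null set
  \<open>N\<close> carrying the exceptions is transported. Because \<open>path_inversion\<close> is
  an involution, the preimage of \<open>N'\<close> is \<open>N\<close> again.\<close>

lemma AE_kelvin_measure:
  assumes "AE \<omega> in P. R (path_inversion \<omega>)"
  shows "AE \<omega> in kelvin_measure. R \<omega>"
proof -
  let ?D = "density P (\<lambda>\<omega>. ennreal (Z \<omega> / kappa x\<^sub>0))"
  obtain N where N: "N \<in> null_sets P" "{\<omega> \<in> space P. \<not> R (path_inversion \<omega>)} \<subseteq> N"
    using assms unfolding eventually_ae_filter by auto
  have NP: "N \<in> sets P" "N \<subseteq> paths" using N(1) sets.sets_into_space[of N P] by (auto simp: space_P)
  define N' where "N' = path_inversion -` N \<inter> paths"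
  have N': "N' \<in> sets path_space"
    using measurable_sets[OF measurable_path_inversion, of N] NP(1) sets_P by (simp add: N'_def space_path_space)
  have J: "path_inversion \<in> measurable ?D path_space" using path_inversion_measurable_P by simp
  have "path_inversion -` N' \<inter> space ?D = N"
    using NP(2) by (auto simp: N'_def space_P path_inversion_involution path_inversion_paths)
  then have "emeasure kelvin_measure N' = emeasure ?D N"
    unfolding kelvin_measure_def by (subst emeasure_distr[OF J N']) simp
  also have "\<dots> = 0"
  proof -
    have "AE \<omega> in P. \<omega> \<notin> N" by (rule AE_not_in[OF N(1)])
    then have "AE \<omega> in ?D. \<omega> \<notin> N"
      using Z_measurable by (subst AE_density) auto
    then have "N \<in> null_sets ?D" using NP(1) by (subst AE_iff_null_sets) auto
    then show ?thesis by (rule null_setsD1)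
  qed
  finally have "N' \<in> null_sets kelvin_measure" using N' by (auto simp: sets_kelvin_measure null_sets_def)
  then show ?thesis
  proof (rule AE_I')
    show "{\<omega> \<in> space kelvin_measure. \<not> R \<omega>} \<subseteq> N'"
    proof
      fix \<omega> assume "\<omega> \<in> {\<omega> \<in> space kelvin_measure. \<not> R \<omega>}"
      then have w: "\<omega> \<in> paths" "\<not> R \<omega>"
        by (auto simp: sets_eq_imp_space_eq[OF sets_kelvin_measure] space_path_space)
      then have "path_inversion \<omega> \<in> {\<omega> \<in> space P. \<not> R (path_inversion \<omega>)}"
        by (simp add: space_P path_inversion_paths path_inversion_involution)
      then show "\<omega> \<in> N'" using N(2) w by (auto simp: N'_def)
    qed
  qed
qed

lemma AE_path_inversion:
  "AE \<omega> in P. (\<forall>t\<ge>0. \<omega> t \<noteq> 0) \<and> (\<forall>t\<ge>0. path_inversion \<omega> t = inversion (\<omega> t) \<and> norm (inversion (\<omega> t)) \<le> inverse \<rho>)"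
  using away
proof eventually_elim
  case (elim \<omega>)
  then have nz: "\<forall>t\<ge>0. \<omega> t \<noteq> 0" using rho by fastforce
  show ?case
    using nz elim rho by (auto simp: path_inversion_apply norm_inversion intro!: le_imp_inverse_le)
qed

lemma kelvin_norm_le: "AE \<omega> in kelvin_measure. \<forall>t\<ge>0. norm (\<omega> t) \<le> inverse \<rho>"
proof (rule AE_kelvin_measure)
  show "AE \<omega> in P. \<forall>t\<ge>0. norm (path_inversion \<omega> t) \<le> inverse \<rho>"
    using AE_path_inversion by eventually_elim auto
qed

text \<open>An event \<open>A\<close> of the inverted path corresponds, off the paths through the
  origin, to an event \<open>A'\<close> of the original one known at the same time. Closedness
  replaces \<open>Z\<close> by \<open>kappa\<close> at the time under consideration, and what
  remains is the martingale property of the Kelvin transform of \<open>g\<close>.\<close>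

lemma transfer_martingale:
  fixes g :: "real ^ 'd \<Rightarrow> real"
  assumes g: "g \<in> borel_measurable borel" and C: "\<And>y. norm y \<le> inverse \<rho> \<Longrightarrow> \<bar>g y\<bar> \<le> C"
    and M: "martingale P coord_filtration (\<lambda>t \<omega>. kappa (\<omega> t) * g (inversion (\<omega> t)))"
  shows "martingale kelvin_measure coord_filtration (\<lambda>t \<omega>. g (\<omega> t))"
proof (rule Q.martingaleI)
  let ?F = "coord_filtration :: real \<Rightarrow> (real \<Rightarrow> real ^ 'd) measure"
  show gF: "(\<lambda>\<omega>. g (\<omega> t)) \<in> borel_measurable (?F t)" if "0 \<le> t" for t
    by (rule measurable_compose[OF measurable_coord_filtration g]) (use that in auto)
  have C0: "0 \<le> C" using C[of 0] rho by simp
  show "integrable kelvin_measure (\<lambda>\<omega>. g (\<omega> t))" if "0 \<le> t" for t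
    by (intro Q.integrable_const_bound[where B=C] Q.measurable_F[OF gF[OF that]])
       (use kelvin_norm_le C that in \<open>auto elim!: eventually_mono\<close>)
  fix s t A assume st: "0 \<le> s" "s \<le> t" "A \<in> sets (?F s)"
  obtain A' where A': "A' \<in> sets (?F s)"
    "\<And>\<omega>. \<omega> \<in> paths \<Longrightarrow> (\<forall>t\<ge>0. \<omega> t \<noteq> 0) \<Longrightarrow> path_inversion \<omega> \<in> A \<longleftrightarrow> \<omega> \<in> A'"
    using path_inversion_filtration[OF st(3)] by blast
  have I: "(\<integral>\<omega>. indicator A \<omega> * g (\<omega> r) \<partial>kelvin_measure)
      = (\<integral>\<omega>. indicator A' \<omega> * (kappa (\<omega> r) * g (inversion (\<omega> r))) \<partial>P) / kappa x\<^sub>0" if r: "s \<le> r" for r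
  proof -
    have r0: "0 \<le> r" using st r by simp
    have Ar: "A' \<in> sets (?F r)" using A'(1) sets_F_mono[OF r] by auto
    have AQ: "A \<in> sets path_space" using Q.indicator_F[OF st(3)] sets_kelvin_measure by simp
    have gr: "(\<lambda>\<omega>. g (\<omega> r)) \<in> borel_measurable path_space"
      by (rule measurable_compose[OF measurable_coordinate[OF r0] g])
    have m: "(\<lambda>\<omega>. indicator A \<omega> * g (\<omega> r)) \<in> borel_measurable path_space" using AQ gr by measurable
    have gi: "(\<lambda>\<omega>. g (inversion (\<omega> r))) \<in> borel_measurable (?F r)"
      by (rule measurable_compose[OF measurable_coord_filtration measurable_compose[OF borel_measurable_inversion g]])
         (use r0 in auto)
    have W: "(\<lambda>\<omega>. indicator A' \<omega> * g (inversion (\<omega> r))) \<in> borel_measurable (?F r)" using Ar gi by measurable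
    have "(\<integral>\<omega>. indicator A (path_inversion \<omega>) * g (path_inversion \<omega> r) * Z \<omega> \<partial>P)
      = (\<integral>\<omega>. indicator A' \<omega> * g (inversion (\<omega> r)) * Z \<omega> \<partial>P)"
    proof (rule integral_cong_AE)
      show "(\<lambda>\<omega>. indicator A (path_inversion \<omega>) * g (path_inversion \<omega> r) * Z \<omega>) \<in> borel_measurable P"
        using measurable_compose[OF path_inversion_measurable_P m] Z_measurable by measurable
      show "(\<lambda>\<omega>. indicator A' \<omega> * g (inversion (\<omega> r)) * Z \<omega>) \<in> borel_measurable P"
        using measurable_F[OF W] Z_measurable by measurable
      show "AE \<omega> in P. indicator A (path_inversion \<omega>) * g (path_inversion \<omega> r) * Z \<omega>
         = indicator A' \<omega> * g (inversion (\<omega> r)) * Z \<omega>"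
        using AE_path_inversion AE_space
      proof eventually_elim
        case (elim \<omega>)
        then show ?case using A'(2)[of \<omega>] r0 by (auto simp: space_P split: split_indicator)
      qed
    qed
    also have "\<dots> = (\<integral>\<omega>. indicator A' \<omega> * g (inversion (\<omega> r)) * kappa (\<omega> r) \<partial>P)"
    proof (rule integral_mult_Z[OF r0 W])
      show "AE \<omega> in P. \<bar>indicator A' \<omega> * g (inversion (\<omega> r))\<bar> \<le> C"
        using AE_path_inversion
        by eventually_elim (use C C0 r0 in \<open>auto split: split_indicator\<close>)
    qed
    finally show ?thesis unfolding integral_kelvin_measure[OF m] by (simp add: mult_ac)
  qed
  show "(\<integral>\<omega>. indicator A \<omega> * g (\<omega> t) \<partial>kelvin_measure) = (\<integral>\<omega>. indicator A \<omega> * g (\<omega> s) \<partial>kelvin_measure)"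
    using I[OF st(2)] I[OF order_refl] martingale_set[OF M st(1,2) A'(1)] by simp
qed

text \<open>Differences of squared coordinates are martingales, so what compensates the square of
  coordinate \<open>c\<close> compensates all of them, and mixed products are compensated by
  zero.\<close>

lemma true_conformal_kelvin_measure:
  "true_conformal_martingale kelvin_measure coord_filtration (\<lambda>t \<omega>. \<omega> t)"
proof -
  let ?F = "coord_filtration :: real \<Rightarrow> (real \<Rightarrow> real ^ 'd) measure"
  let ?Q = kelvin_measure
  define c where "c = (undefined :: 'd)"
  define K where "K = inverse \<rho>"
  have K: "0 \<le> K" using rho by (simp add: K_def)
  have spQ: "space ?Q = paths" using sets_eq_imp_space_eq[OF sets_kelvin_measure] by (simp add: space_path_space)
  have cm: "\<bar>y $ i\<bar> \<le> K" if "norm y \<le> inverse \<rho>" for y :: "real ^ 'd" and i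
    using order_trans[OF component_le_norm_cart that] by (simp add: K_def)
  have im[measurable]: "(\<lambda>y::real ^ 'd. y $ i) \<in> borel_measurable borel" for i
    by (intro borel_measurable_continuous_onI continuous_intros)
  have m1: "martingale ?Q ?F (\<lambda>t \<omega>. \<omega> t $ i)" for i
    by (rule transfer_martingale[where g="\<lambda>y. y $ i" and C=K, OF im cm kappa_martingales(2)])
  have m2: "martingale ?Q ?F (\<lambda>t \<omega>. \<omega> t $ i * \<omega> t $ j)" if "i \<noteq> j" for i j
  proof (rule transfer_martingale[where g="\<lambda>y. y $ i * y $ j" and C="K * K", OF _ _ kappa_martingales(3)[OF that]])
    show "\<bar>y $ i * y $ j\<bar> \<le> K * K" if "norm y \<le> inverse \<rho>" for y :: "real ^ 'd"
      unfolding abs_mult using cm[OF that] by (intro mult_mono') auto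
  qed measurable
  have m3: "martingale ?Q ?F (\<lambda>t \<omega>. (\<omega> t $ i)\<^sup>2 - (\<omega> t $ c)\<^sup>2)" for i
  proof (rule transfer_martingale[where g="\<lambda>y. (y $ i)\<^sup>2 - (y $ c)\<^sup>2" and C="K\<^sup>2", OF _ _ kappa_martingales(4)])
    show "\<bar>(y $ i)\<^sup>2 - (y $ c)\<^sup>2\<bar> \<le> K\<^sup>2" if "norm y \<le> inverse \<rho>" for y :: "real ^ 'd"
    proof -
      have "(y $ j)\<^sup>2 \<le> K\<^sup>2" for j using power_mono[OF cm[OF that], of j 2] by simp
      from this[of i] this[of c] zero_le_power2[of "y $ i"] zero_le_power2[of "y $ c"] show ?thesis by linarith
    qed
  qed measurable
  \<comment> \<open>The coordinate is bounded only almost surely; clipping makes the bound hold on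
    every path and keeps continuity, as \<open>quadratic_variation_exists\<close> assumes.\<close>
  define M where "M t \<omega> = max (- K) (min K (\<omega> t $ c))" for t and \<omega> :: "real \<Rightarrow> real ^ 'd"
  have Meq: "AE \<omega> in ?Q. \<forall>t\<ge>0. M t \<omega> = \<omega> t $ c"
    using kelvin_norm_le
  proof eventually_elim
    case (elim \<omega>)
    have "M t \<omega> = \<omega> t $ c" if "0 \<le> t" for t
      using cm[of "\<omega> t" c] elim that unfolding M_def by auto
    then show ?case by blast
  qed
  have cF: "(\<lambda>\<omega>. \<omega> t $ i) \<in> borel_measurable (?F t)" if "0 \<le> t" for t i
    using Q.martingale_adapted[OF m1 that] .
  have MF: "M t \<in> borel_measurable (?F t)" if "0 \<le> t" for t
    using cF[OF that] unfolding M_def[abs_def] by measurable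
  have Mm: "martingale ?Q ?F M"
    by (rule Q.martingale_cong_AE[OF m1[of c] MF]) (use Meq in \<open>auto elim!: eventually_mono\<close>)
  have MK: "\<bar>M t \<omega>\<bar> \<le> K" for t \<omega> using K by (auto simp: M_def)
  have Mc: "continuous_on {0..} (\<lambda>t. M t \<omega>)" if "\<omega> \<in> space ?Q" for \<omega>
    using that unfolding M_def spQ by (auto simp: paths_def intro!: continuous_intros)
  obtain A where A: "\<And>t. 0 \<le> t \<Longrightarrow> A t \<in> borel_measurable (?F t)"
    "martingale ?Q ?F (\<lambda>t \<omega>. (M t \<omega>)\<^sup>2 - A t \<omega>)"
    "AE \<omega> in ?Q. A 0 \<omega> = 0 \<and> continuous_on {0..} (\<lambda>t. A t \<omega>) \<and> mono_on {0..} (\<lambda>t. A t \<omega>)"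
    by (rule Q.quadratic_variation_exists[OF Mm MK Mc]) (assumption | rule that)+
  have br: "is_bracket ?Q ?F (\<lambda>t \<omega>. \<omega> t $ i) (\<lambda>t \<omega>. \<omega> t $ j) (\<lambda>t \<omega>. if i = j then A t \<omega> else 0)" for i j
  proof (cases "i = j")
    case False
    have "locally_bounded_variation (\<lambda>t. 0)" by (auto simp: locally_bounded_variation_def)
    then show ?thesis
      using False Q.local_martingale_of_martingale[OF m2[OF False]] by (simp add: is_bracket_def)
  next
    case True
    have "AE \<omega> in ?Q. A 0 \<omega> = 0 \<and> continuous_on {0..} (\<lambda>t. A t \<omega>) \<and> locally_bounded_variation (\<lambda>t. A t \<omega>)"
      using A(3) by eventually_elim (auto intro: mono_on_locally_bounded_variation)
    moreover have "martingale ?Q ?F (\<lambda>t \<omega>. \<omega> t $ i * \<omega> t $ i - A t \<omega>)"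
    proof (rule Q.martingale_cong_AE[OF Q.martingale_add[OF m3[of i] A(2)]])
      show "(\<lambda>\<omega>. \<omega> t $ i * \<omega> t $ i - A t \<omega>) \<in> borel_measurable (?F t)" if "0 \<le> t" for t
        using cF[OF that] A(1)[OF that] by measurable
      show "AE \<omega> in ?Q. \<omega> t $ i * \<omega> t $ i - A t \<omega> = (\<omega> t $ i)\<^sup>2 - (\<omega> t $ c)\<^sup>2 + ((M t \<omega>)\<^sup>2 - A t \<omega>)" if "0 \<le> t" for t
        using Meq by eventually_elim (use that in \<open>auto simp: power2_eq_square\<close>)
    qed
    ultimately show ?thesis
      using True A(1) Q.local_martingale_of_martingale by (simp add: is_bracket_def)
  qed
  show ?thesis
    unfolding true_conformal_martingale_def conformal_local_martingale_def
    using m1 br Q.local_martingale_of_martingale by blast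
qed

text \<open>The weight tests the position at \<tau> itself while \<open>kappa\<close> is first taken
  at the rounded time, so the left side does not depend on the grid. On each level set of the
  rounded time \<open>integral_mult_Z\<close> applies, and dominated convergence moves the argument
  of \<open>kappa\<close> to \<tau>.\<close>

lemma stopped_law:
  fixes \<tau> :: "(real \<Rightarrow> real ^ 'd) \<Rightarrow> real"
  assumes \<tau>: "stopping_time coord_filtration \<tau>" and b: "\<And>\<omega>. \<omega> \<in> paths \<Longrightarrow> 0 \<le> \<tau> \<omega>" "\<And>\<omega>. \<omega> \<in> paths \<Longrightarrow> \<tau> \<omega> \<le> c"
    and B: "B \<in> sets borel"
  shows "(\<integral>\<omega>. indicator B (\<omega> (\<tau> \<omega>)) * Z \<omega> \<partial>P) = (\<integral>\<omega>. indicator B (\<omega> (\<tau> \<omega>)) * kappa (\<omega> (\<tau> \<omega>)) \<partial>P)"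
proof -
  let ?F = "coord_filtration :: real \<Rightarrow> (real \<Rightarrow> real ^ 'd) measure"
  have \<tau>m: "\<tau> \<in> borel_measurable path_space"
    using measurable_stopping_time[OF \<tau>] sets_coord_filtration_subset
    by (metis space_coord_filtration space_path_space)
  have ev: "(\<lambda>\<omega>. \<omega> (\<tau> \<omega>)) \<in> borel_measurable P"
    unfolding measurable_P_eq by (rule measurable_path_eval[OF \<tau>m b(1)])
  have evm: "(\<lambda>\<omega>. \<omega> (dyadic_ceiling m (\<tau> \<omega>))) \<in> borel_measurable P" for m
    unfolding measurable_P_eq
  proof (rule measurable_path_eval)
    show "(\<lambda>\<omega>. dyadic_ceiling m (\<tau> \<omega>)) \<in> borel_measurable path_space"
      unfolding dyadic_ceiling_def using \<tau>m by measurable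
  qed (simp add: dyadic_ceiling_def)
  have iB: "(\<lambda>\<omega>. indicator B (\<omega> (\<tau> \<omega>)) :: real) \<in> borel_measurable P" using ev B by measurable
  have eq: "(\<integral>\<omega>. indicator B (\<omega> (\<tau> \<omega>)) * Z \<omega> \<partial>P)
      = (\<integral>\<omega>. indicator B (\<omega> (\<tau> \<omega>)) * kappa (\<omega> (dyadic_ceiling m (\<tau> \<omega>))) \<partial>P)" for m
  proof -
    define j where "j \<omega> = nat \<lceil>\<tau> \<omega> * 2 ^ m\<rceil>" for \<omega>
    define N where "N = nat \<lceil>c * 2 ^ m\<rceil>"
    have jN: "j \<omega> \<le> N" if "\<omega> \<in> space P" for \<omega>
      unfolding j_def N_def using b(2)[of \<omega>] that by (intro nat_mono ceiling_mono mult_right_mono) (auto simp: space_P)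
    define A where "A k = {\<omega> \<in> space P. j \<omega> = k}" for k
    have A: "A k \<in> sets (?F (real k / 2 ^ m))" for k
      unfolding A_def j_def by (rule stopping_time_dyadic_level[OF \<tau>]) (use b(1) in \<open>simp add: space_P\<close>)
    \<comment> \<open>The minimum keeps the evaluated position known at time
      \<open>real k / 2 ^ m\<close>; on \<open>A k\<close> it equals \<tau>.\<close>
    define W where "W k \<omega> = indicator (A k) \<omega> * (indicator B (\<omega> (min (real k / 2 ^ m) (\<tau> \<omega>))) :: real)" for k \<omega>
    have WF: "W k \<in> borel_measurable (?F (real k / 2 ^ m))" for k
    proof -
      have "(\<lambda>\<omega>. \<omega> (min (real k / 2 ^ m) (\<tau> \<omega>))) \<in> borel_measurable (?F (real k / 2 ^ m))"
      proof (rule borel_measurable_vecI)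
        show "(\<lambda>\<omega>. \<omega> (min (real k / 2 ^ m) (\<tau> \<omega>)) $ i) \<in> borel_measurable (?F (real k / 2 ^ m))" for i
          by (rule stopped_adapted[of "\<lambda>t \<omega>. \<omega> t $ i" \<tau>, OF component_adapted component_continuous \<tau>])
             (use b(1) in \<open>auto simp: space_P\<close>)
      qed
      then show ?thesis unfolding W_def[abs_def] using A[of k] B by measurable
    qed
    have Wb: "AE \<omega> in P. \<bar>W k \<omega>\<bar> \<le> 1" for k by (rule AE_I2) (auto simp: W_def split: split_indicator)
    have sum: "(\<Sum>k\<le>N. W k \<omega> * h k) = indicator B (\<omega> (\<tau> \<omega>)) * h (j \<omega>)"
      if w: "\<omega> \<in> space P" for \<omega> and h :: "nat \<Rightarrow> real"
    proof -
      have "\<tau> \<omega> \<le> real (j \<omega>) / 2 ^ m"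
        using dyadic_ceiling_bounds(1)[of "\<tau> \<omega>" m] b(1)[of \<omega>] w by (simp add: dyadic_ceiling_def j_def space_P)
      then have "W k \<omega> * h k = (if k = j \<omega> then indicator B (\<omega> (\<tau> \<omega>)) * h (j \<omega>) else 0)" for k
        using w by (auto simp: W_def A_def split: split_indicator)
      then show ?thesis using jN[OF w] by simp
    qed
    have kI: "integrable P (\<lambda>\<omega>. W k \<omega> * kappa (\<omega> (real k / 2 ^ m)))" for k
      by (rule integrable_bounded_mult[OF martingale_integrable[OF kappa_martingale] measurable_F[OF WF], where C=1])
         (auto simp: W_def split: split_indicator)
    have "(\<integral>\<omega>. indicator B (\<omega> (\<tau> \<omega>)) * Z \<omega> \<partial>P) = (\<integral>\<omega>. (\<Sum>k\<le>N. W k \<omega> * Z \<omega>) \<partial>P)"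
    proof (rule Bochner_Integration.integral_cong[OF refl])
      show "indicator B (\<omega> (\<tau> \<omega>)) * Z \<omega> = (\<Sum>k\<le>N. W k \<omega> * Z \<omega>)" if w: "\<omega> \<in> space P" for \<omega>
        using sum[OF w, of "\<lambda>_. Z \<omega>"] by simp
    qed
    also have "\<dots> = (\<Sum>k\<le>N. \<integral>\<omega>. W k \<omega> * Z \<omega> \<partial>P)"
      by (rule Bochner_Integration.integral_sum) (rule integrable_mult_Z[OF measurable_F[OF WF] Wb])
    also have "\<dots> = (\<Sum>k\<le>N. \<integral>\<omega>. W k \<omega> * kappa (\<omega> (real k / 2 ^ m)) \<partial>P)"
      by (intro sum.cong refl integral_mult_Z[OF _ WF Wb]) auto
    also have "\<dots> = (\<integral>\<omega>. (\<Sum>k\<le>N. W k \<omega> * kappa (\<omega> (real k / 2 ^ m))) \<partial>P)"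
      by (rule Bochner_Integration.integral_sum[symmetric]) (rule kI)
    also have "\<dots> = (\<integral>\<omega>. indicator B (\<omega> (\<tau> \<omega>)) * kappa (\<omega> (dyadic_ceiling m (\<tau> \<omega>))) \<partial>P)"
    proof (rule Bochner_Integration.integral_cong[OF refl])
      show "(\<Sum>k\<le>N. W k \<omega> * kappa (\<omega> (real k / 2 ^ m)))
        = indicator B (\<omega> (\<tau> \<omega>)) * kappa (\<omega> (dyadic_ceiling m (\<tau> \<omega>)))" if w: "\<omega> \<in> space P" for \<omega>
        using sum[OF w, of "\<lambda>k. kappa (\<omega> (real k / 2 ^ m))"] by (simp add: dyadic_ceiling_def j_def)
    qed
    finally show ?thesis .
  qed
  have "(\<lambda>m. \<integral>\<omega>. indicator B (\<omega> (\<tau> \<omega>)) * kappa (\<omega> (dyadic_ceiling m (\<tau> \<omega>))) \<partial>P)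
     \<longlonglongrightarrow> (\<integral>\<omega>. indicator B (\<omega> (\<tau> \<omega>)) * kappa (\<omega> (\<tau> \<omega>)) \<partial>P)"
  proof (rule integral_dominated_convergence[where w="\<lambda>_. kappa_bound"])
    show "(\<lambda>\<omega>. indicator B (\<omega> (\<tau> \<omega>)) * kappa (\<omega> (\<tau> \<omega>))) \<in> borel_measurable P"
      using iB measurable_compose[OF ev kappa_measurable] by measurable
    show "(\<lambda>\<omega>. indicator B (\<omega> (\<tau> \<omega>)) * kappa (\<omega> (dyadic_ceiling m (\<tau> \<omega>)))) \<in> borel_measurable P" for m
      using iB measurable_compose[OF evm kappa_measurable] by measurable
    show "AE \<omega> in P. norm (indicator B (\<omega> (\<tau> \<omega>)) * kappa (\<omega> (dyadic_ceiling m (\<tau> \<omega>)))) \<le> kappa_bound" for m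
      using kappa_path_le
    proof eventually_elim
      case (elim \<omega>)
      have "0 \<le> dyadic_ceiling m (\<tau> \<omega>)" by (simp add: dyadic_ceiling_def)
      then have "kappa (\<omega> (dyadic_ceiling m (\<tau> \<omega>))) \<le> kappa_bound" using elim by blast
      then show ?case using kappa_nonneg[of "\<omega> (dyadic_ceiling m (\<tau> \<omega>))"]
        by (auto split: split_indicator)
    qed
    show "AE \<omega> in P. (\<lambda>m. indicator B (\<omega> (\<tau> \<omega>)) * kappa (\<omega> (dyadic_ceiling m (\<tau> \<omega>))))
       \<longlonglongrightarrow> indicator B (\<omega> (\<tau> \<omega>)) * kappa (\<omega> (\<tau> \<omega>))"
      using away AE_space
    proof eventually_elim
      case (elim \<omega>)
      have t0: "0 \<le> \<tau> \<omega>" using b(1) elim(2) by (simp add: space_P)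
      have "(\<lambda>m. \<omega> (dyadic_ceiling m (\<tau> \<omega>))) \<longlonglongrightarrow> \<omega> (\<tau> \<omega>)"
        by (rule continuous_on_halfline_tendsto[OF path_continuous[OF elim(2)] t0 dyadic_ceiling_tendsto[OF t0]])
           (simp add: dyadic_ceiling_def)
      moreover have "norm (\<omega> (\<tau> \<omega>)) \<noteq> 0" using elim(1) t0 rho by fastforce
      ultimately show ?case unfolding kappa_def by (intro tendsto_intros) auto
    qed
  qed auto
  then show ?thesis unfolding eq[symmetric] by (simp add: LIMSEQ_const_iff)
qed

text \<open>\<psi> grows with the norm, so \<open>Z\<close> cannot be exchanged for
  \<open>kappa\<close> by boundedness. Instead the law of the stopped position under the density
  \<open>Z\<close> has density \<open>kappa\<close> with respect to its law under \<open>P\<close>,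
  and the product of \<open>kappa\<close> and \<psi> is \<open>U\<close>, which is bounded along the
  path.\<close>

lemma kelvin_formula:
  fixes U :: "real ^ 'd \<Rightarrow> real" and \<tau> :: "(real \<Rightarrow> real ^ 'd) \<Rightarrow> real"
  assumes U: "U \<in> borel_measurable borel" and UC: "AE \<omega> in P. \<forall>t\<ge>0. \<bar>U (\<omega> t)\<bar> \<le> C"
    and \<tau>: "stopping_time coord_filtration \<tau>" and b: "\<And>\<omega>. \<omega> \<in> paths \<Longrightarrow> 0 \<le> \<tau> \<omega>" "\<And>\<omega>. \<omega> \<in> paths \<Longrightarrow> \<tau> \<omega> \<le> c"
  defines "f \<equiv> \<lambda>x :: real ^ 'd. norm x powi (2 - int CARD('d)) * U (inversion x)"
  shows "integrable kelvin_measure (\<lambda>\<omega>. f (\<omega> (\<tau> (path_inversion \<omega>))))"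
    and "norm x\<^sub>0 ^ (CARD('d) - 2) * (\<integral>\<omega>. U (\<omega> (\<tau> \<omega>)) \<partial>P)
      = (\<integral>\<omega>. f (\<omega> (\<tau> (path_inversion \<omega>))) \<partial>kelvin_measure)"
proof -
  have \<tau>m: "\<tau> \<in> borel_measurable path_space"
    using measurable_stopping_time[OF \<tau>] sets_coord_filtration_subset
    by (metis space_coord_filtration space_path_space)
  have ev: "(\<lambda>\<omega>. \<omega> (\<tau> \<omega>)) \<in> borel_measurable P"
    unfolding measurable_P_eq by (rule measurable_path_eval[OF \<tau>m b(1)])
  have fm: "f \<in> borel_measurable borel"
    unfolding f_def norm_powi_inversion(1)[OF dim]
    using measurable_compose[OF borel_measurable_inversion U] by measurable
  define \<psi> where "\<psi> x = norm x ^ (CARD('d) - 2) * U x" for x :: "real ^ 'd"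
  have \<psi>m: "\<psi> \<in> borel_measurable borel" unfolding \<psi>_def[abs_def] using U by measurable
  have f_inv: "f (inversion x) = \<psi> x" for x
    unfolding f_def norm_powi_inversion(2)[OF dim] inversion_involution \<psi>_def ..
  have km[measurable]: "kappa \<in> borel_measurable borel" by (rule kappa_measurable)
  let ?X = "\<lambda>\<omega>. \<omega> (\<tau> \<omega>)"
  have kI: "integrable P (\<lambda>\<omega>. indicator B (?X \<omega>) * kappa (?X \<omega>))" if "B \<in> sets borel" for B
  proof (rule integrable_const_bound[where B=kappa_bound])
    show "(\<lambda>\<omega>. indicator B (?X \<omega>) * kappa (?X \<omega>)) \<in> borel_measurable P"
      using measurable_compose[OF ev km] measurable_compose[OF ev borel_measurable_indicator[OF that]] by measurable
    show "AE \<omega> in P. norm (indicator B (?X \<omega>) * kappa (?X \<omega>)) \<le> kappa_bound"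
      using kappa_path_le AE_space
    proof eventually_elim
      case (elim \<omega>)
      then have "kappa (?X \<omega>) \<le> kappa_bound" using b(1)[of \<omega>] by (simp add: space_P)
      then show ?case using kappa_nonneg[of "?X \<omega>"] by (auto split: split_indicator)
    qed
  qed
  have zI: "integrable P (\<lambda>\<omega>. indicator B (?X \<omega>) * Z \<omega>)" if "B \<in> sets borel" for B
    by (rule integrable_mult_Z[where C=1])
       (use measurable_compose[OF ev borel_measurable_indicator[OF that]] in \<open>auto split: split_indicator\<close>)
  \<comment> \<open>The two measures are compared on every Borel set, where the integrands are
    bounded and \<open>stopped_law\<close> applies. Equality of measures then covers unbounded
    functions.\<close>
  have law: "distr (density P (\<lambda>\<omega>. ennreal (Z \<omega>))) borel ?X = density (distr P borel ?X) (\<lambda>x. ennreal (kappa x))"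
  proof (rule measure_eqI)
    fix B assume "B \<in> sets (distr (density P (\<lambda>\<omega>. ennreal (Z \<omega>))) borel ?X)"
    then have B: "B \<in> sets borel" by simp
    have XB: "?X -` B \<inter> space P \<in> sets P" using measurable_sets[OF ev B] .
    have "emeasure (distr (density P (\<lambda>\<omega>. ennreal (Z \<omega>))) borel ?X) B
      = (\<integral>\<^sup>+\<omega>. ennreal (Z \<omega>) * indicator (?X -` B \<inter> space P) \<omega> \<partial>P)"
      using ev B XB Z_measurable by (subst emeasure_distr) (auto simp: emeasure_density)
    also have "\<dots> = (\<integral>\<^sup>+\<omega>. ennreal (indicator B (?X \<omega>) * Z \<omega>) \<partial>P)"
      by (intro nn_integral_cong) (auto split: split_indicator)
    also have "\<dots> = ennreal (\<integral>\<omega>. indicator B (?X \<omega>) * Z \<omega> \<partial>P)"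
      by (rule nn_integral_eq_integral[OF zI[OF B]])
        (intro AE_I2 mult_nonneg_nonneg Z_nonneg indicator_pos_le)
    also have "\<dots> = ennreal (\<integral>\<omega>. indicator B (?X \<omega>) * kappa (?X \<omega>) \<partial>P)"
      using stopped_law[OF \<tau> b B] by simp
    also have "\<dots> = (\<integral>\<^sup>+\<omega>. ennreal (indicator B (?X \<omega>) * kappa (?X \<omega>)) \<partial>P)"
      by (rule nn_integral_eq_integral[OF kI[OF B], symmetric])
        (intro AE_I2 mult_nonneg_nonneg kappa_nonneg indicator_pos_le)
    also have "\<dots> = (\<integral>\<^sup>+\<omega>. ennreal (kappa (?X \<omega>)) * indicator B (?X \<omega>) \<partial>P)"
      by (intro nn_integral_cong) (auto split: split_indicator)
    also have "\<dots> = (\<integral>\<^sup>+x. ennreal (kappa x) * indicator B x \<partial>distr P borel ?X)"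
    proof -
      have "(\<lambda>x. ennreal (kappa x) * indicator B x) \<in> borel_measurable borel" using B by measurable
      then show ?thesis by (subst nn_integral_distr[OF ev]) simp_all
    qed
    also have "\<dots> = emeasure (density (distr P borel ?X) (\<lambda>x. ennreal (kappa x))) B"
      using km B by (subst emeasure_density) auto
    finally show "emeasure (distr (density P (\<lambda>\<omega>. ennreal (Z \<omega>))) borel ?X) B
      = emeasure (density (distr P borel ?X) (\<lambda>x. ennreal (kappa x))) B" .
  qed simp
  have AEU: "AE \<omega> in P. kappa (?X \<omega>) * \<psi> (?X \<omega>) = U (?X \<omega>) \<and> \<bar>U (?X \<omega>)\<bar> \<le> C"
    using away UC AE_space
  proof eventually_elim
    case (elim \<omega>)
    have t0: "0 \<le> \<tau> \<omega>" using b(1) elim(3) by (simp add: space_P)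
    then have "?X \<omega> \<noteq> 0" using elim(1) rho by fastforce
    from kappa_mult_power[OF this dim] have "kappa (?X \<omega>) * \<psi> (?X \<omega>) = U (?X \<omega>)"
      unfolding \<psi>_def by (simp add: mult.assoc[symmetric])
    then show ?case using elim(2) t0 by simp
  qed
  have UX: "(\<lambda>\<omega>. U (?X \<omega>)) \<in> borel_measurable P" by (rule measurable_compose[OF ev U])
  have UI: "integrable P (\<lambda>\<omega>. U (?X \<omega>))"
    by (rule integrable_const_bound[where B=C]) (use AEU UX in \<open>auto elim!: eventually_mono\<close>)
  have k\<psi>: "(\<lambda>\<omega>. kappa (?X \<omega>) * \<psi> (?X \<omega>)) \<in> borel_measurable P"
    using measurable_compose[OF ev km] measurable_compose[OF ev \<psi>m] by measurable
  have kP: "integrable P (\<lambda>\<omega>. kappa (?X \<omega>) * \<psi> (?X \<omega>))"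
    by (rule integrable_cong_AE_imp[OF UI k\<psi>]) (use AEU in \<open>auto elim!: eventually_mono\<close>)
  have kE: "(\<integral>\<omega>. kappa (?X \<omega>) * \<psi> (?X \<omega>) \<partial>P) = (\<integral>\<omega>. U (?X \<omega>) \<partial>P)"
    by (rule integral_cong_AE[OF k\<psi> UX]) (use AEU in \<open>auto elim!: eventually_mono\<close>)
  have evD: "?X \<in> borel_measurable (density P (\<lambda>\<omega>. ennreal (Z \<omega>)))" using ev by simp
  have k\<psi>b: "(\<lambda>x. kappa x *\<^sub>R \<psi> x) \<in> borel_measurable borel" using km \<psi>m by measurable
  have \<psi>X: "(\<lambda>\<omega>. \<psi> (?X \<omega>)) \<in> borel_measurable P" by (rule measurable_compose[OF ev \<psi>m])
  have Zn: "AE \<omega> in P. 0 \<le> Z \<omega>" using Z_nonneg by simp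
  have kn: "AE x in distr P borel ?X. 0 \<le> kappa x" by (rule AE_I2) (rule kappa_nonneg)
  have \<psi>d: "\<psi> \<in> borel_measurable (distr P borel ?X)" "kappa \<in> borel_measurable (distr P borel ?X)" using \<psi>m km by auto
  have i2: "integrable (density (distr P borel ?X) (\<lambda>x. ennreal (kappa x))) \<psi>"
    unfolding integrable_density[OF \<psi>d kn] integrable_distr_eq[OF ev k\<psi>b] using kP by simp
  have e2: "(\<integral>x. \<psi> x \<partial>density (distr P borel ?X) (\<lambda>x. ennreal (kappa x))) = (\<integral>\<omega>. U (?X \<omega>) \<partial>P)"
    unfolding integral_density[OF \<psi>d kn] integral_distr[OF ev k\<psi>b] using kE by simp
  have i1: "integrable P (\<lambda>\<omega>. \<psi> (?X \<omega>) * Z \<omega>)"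
    using i2 unfolding law[symmetric] integrable_distr_eq[OF evD \<psi>m] integrable_density[OF \<psi>X Z_measurable Zn]
    by (simp add: mult.commute)
  have e1: "(\<integral>\<omega>. \<psi> (?X \<omega>) * Z \<omega> \<partial>P) = (\<integral>\<omega>. U (?X \<omega>) \<partial>P)"
    using e2 unfolding law[symmetric] integral_distr[OF evD \<psi>m] integral_density[OF \<psi>X Z_measurable Zn]
    by (simp add: mult.commute)
  have gm: "(\<lambda>\<omega>. f (\<omega> (\<tau> (path_inversion \<omega>)))) \<in> borel_measurable path_space"
  proof (rule measurable_compose[OF measurable_path_eval fm])
    show "(\<lambda>\<omega>. \<tau> (path_inversion \<omega>)) \<in> borel_measurable path_space"
      by (rule measurable_compose[OF measurable_path_inversion \<tau>m])
  qed (use b(1) path_inversion_paths in auto)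
  \<comment> \<open>Inverting twice restores the path, so the time on the inverted side is
    \<open>\<tau> \<omega>\<close>, and \<open>f_inv\<close> evaluates the function there.\<close>
  have ae: "AE \<omega> in P. f (path_inversion \<omega> (\<tau> (path_inversion (path_inversion \<omega>)))) * Z \<omega> = \<psi> (?X \<omega>) * Z \<omega>"
    using AE_path_inversion AE_space
  proof eventually_elim
    case (elim \<omega>)
    have w: "\<omega> \<in> paths" using elim(2) by (simp add: space_P)
    then show ?case using elim(1) b(1)[OF w] by (simp add: path_inversion_involution f_inv)
  qed
  have gJ: "(\<lambda>\<omega>. f (path_inversion \<omega> (\<tau> (path_inversion (path_inversion \<omega>)))) * Z \<omega>) \<in> borel_measurable P"
    using measurable_compose[OF path_inversion_measurable_P gm] Z_measurable by measurable
  have \<psi>Z: "(\<lambda>\<omega>. \<psi> (?X \<omega>) * Z \<omega>) \<in> borel_measurable P" using \<psi>X Z_measurable by measurable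
  show "integrable kelvin_measure (\<lambda>\<omega>. f (\<omega> (\<tau> (path_inversion \<omega>))))"
    by (rule integrable_kelvin_measure[OF gm], rule integrable_cong_AE_imp[OF i1 gJ])
       (use ae in \<open>auto elim!: eventually_mono\<close>)
  have "(\<integral>\<omega>. f (\<omega> (\<tau> (path_inversion \<omega>))) \<partial>kelvin_measure) = (\<integral>\<omega>. \<psi> (?X \<omega>) * Z \<omega> \<partial>P) / kappa x\<^sub>0"
    unfolding integral_kelvin_measure[OF gm] using integral_cong_AE[OF gJ \<psi>Z ae] by simp
  also have "\<dots> = (\<integral>\<omega>. U (?X \<omega>) \<partial>P) / kappa x\<^sub>0" by (simp add: e1)
  also have "inverse (kappa x\<^sub>0) = norm x\<^sub>0 ^ (CARD('d) - 2)"
    using norm_start rho by (intro inverse_unique kappa_mult_power[OF _ dim]) auto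
  then have "(\<integral>\<omega>. U (?X \<omega>) \<partial>P) / kappa x\<^sub>0 = norm x\<^sub>0 ^ (CARD('d) - 2) * (\<integral>\<omega>. U (?X \<omega>) \<partial>P)"
    by (simp add: divide_inverse mult.commute)
  finally show "norm x\<^sub>0 ^ (CARD('d) - 2) * (\<integral>\<omega>. U (\<omega> (\<tau> \<omega>)) \<partial>P)
      = (\<integral>\<omega>. f (\<omega> (\<tau> (path_inversion \<omega>))) \<partial>kelvin_measure)" by simp
qed

end

text \<open>By connectedness a path from the complement into \<open>D\<close> meets the frontier on
  the way, and there it is absorbed. So it never reaches the part of \<open>D\<close> off the
  frontier.\<close>

lemma absorbed_path_exterior:
  fixes \<omega> :: "real \<Rightarrow> 'a::topological_space"
  assumes "continuous_on {0..} \<omega>" "\<omega> 0 \<in> - D" "absorbed_at (frontier D) \<omega>" "0 \<le> t"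
  shows "\<omega> t \<in> absorbed_exterior D"
proof (rule ccontr)
  assume n: "\<omega> t \<notin> absorbed_exterior D"
  have "connected (\<omega> ` {0..t})"
    by (intro connected_continuous_image continuous_on_subset[OF assms(1)]) auto
  moreover have "\<omega> t \<in> \<omega> ` {0..t} \<inter> D" "\<omega> 0 \<in> \<omega> ` {0..t} - D"
    using n assms by (auto simp: absorbed_exterior_def)
  ultimately have "\<omega> ` {0..t} \<inter> frontier D \<noteq> {}" by (intro connected_Int_frontier) auto
  then obtain s where s: "0 \<le> s" "s \<le> t" "\<omega> s \<in> frontier D" by auto
  then have "\<omega> t = \<omega> s" using assms(3) by (auto simp: absorbed_at_def)
  then show False using n s by (simp add: absorbed_exterior_def)
qed

text \<open>A stopping time is a function of the path. On the \<open>Q\<close> side it is evaluated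
  on the inverted path, that is on the path as seen under \<open>P\<close>, so both sides use the
  same random time. Integrability is part of the claim because the integral of a nonintegrable
  function is zero by convention.\<close>

theorem proposition10:
  fixes D :: "(real ^ 'd) set" and x\<^sub>0 :: "real ^ 'd"
    and P :: "(real \<Rightarrow> real ^ 'd) measure"
  assumes "CARD('d) > 2"
    and "compact D" and "0 \<in> interior D"
    and "x\<^sub>0 \<in> - D"
    and "prob_space P" and "sets P = sets path_space"
    and "AE \<omega> in P. \<omega> 0 = x\<^sub>0"
    and "conformal_local_martingale P coord_filtration (\<lambda>t \<omega>. \<omega> t)"
    and "AE \<omega> in P. absorbed_at (frontier D) \<omega>"
  shows "\<exists>Q :: (real \<Rightarrow> real ^ 'd) measure.
    prob_space Q \<and> sets Q = sets path_space \<and>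
    true_conformal_martingale Q coord_filtration (\<lambda>t \<omega>. \<omega> t) \<and>
    (AE \<omega> in Q. \<forall>t\<ge>0. \<omega> t \<in> inversion ` absorbed_exterior D) \<and>
    (\<forall>(U :: real ^ 'd \<Rightarrow> real) (\<tau> :: (real \<Rightarrow> real ^ 'd) \<Rightarrow> real) c.
       U \<in> borel_measurable borel \<and> bounded (U ` absorbed_exterior D) \<and>
       stopping_time coord_filtration \<tau> \<and> (\<forall>\<omega>\<in>paths. 0 \<le> \<tau> \<omega> \<and> \<tau> \<omega> \<le> c) \<longrightarrow>
       (let \<tau>' = (\<lambda>\<omega>. \<tau> (path_inversion \<omega>));
            f = (\<lambda>x. norm x powi (2 - int CARD('d)) * U (inversion x))
        in integrable Q (\<lambda>\<omega>. f (\<omega> (\<tau>' \<omega>))) \<and>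
           norm x\<^sub>0 ^ (CARD('d) - 2) * (\<integral>\<omega>. U (\<omega> (\<tau> \<omega>)) \<partial>P) =
             (\<integral>\<omega>. f (\<omega> (\<tau>' \<omega>)) \<partial>Q)))"
proof -
  \<comment> \<open>Interior and frontier are disjoint, so a ball inside the interior of
    \<open>D\<close> misses the closed state space.\<close>
  obtain \<rho> where \<rho>: "0 < \<rho>" "ball 0 \<rho> \<subseteq> interior D"
    using assms(3) open_contains_ball[of "interior D"] by auto
  have spP: "space P = paths" using sets_eq_imp_space_eq[OF assms(6)] by (simp add: space_path_space)
  have ext: "AE \<omega> in P. \<forall>t\<ge>0. \<omega> t \<in> absorbed_exterior D"
    using assms(7,9) AE_space
  proof eventually_elim
    case (elim \<omega>)
    then show ?case using absorbed_path_exterior[of \<omega> D] assms(4) by (auto simp: spP paths_def)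
  qed
  have far: "\<rho> \<le> norm x" if "x \<in> absorbed_exterior D" for x
  proof (rule ccontr)
    assume "\<not> \<rho> \<le> norm x"
    then have "x \<in> interior D" using \<rho>(2) by auto
    then show False using that interior_subset[of D] by (auto simp: absorbed_exterior_def frontier_def)
  qed
  have away: "AE \<omega> in P. \<forall>t\<ge>0. \<rho> \<le> norm (\<omega> t)" using ext by eventually_elim (auto intro: far)
  interpret exterior_process P x\<^sub>0 \<rho>
    by (intro exterior_process.intro exterior_process_axioms.intro assms \<rho>(1) away)
  obtain Z where "Z \<in> borel_measurable P" "\<And>\<omega>. 0 \<le> Z \<omega>" "\<And>\<omega>. Z \<omega> \<le> kappa_bound"
    "\<And>t A. 0 \<le> t \<Longrightarrow> A \<in> sets (coord_filtration t) \<Longrightarrow>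
       (\<integral>\<omega>. indicator A \<omega> * Z \<omega> \<partial>P) = (\<integral>\<omega>. indicator A \<omega> * kappa (\<omega> t) \<partial>P)"
    using limit_density_exists by blast
  then interpret exterior_density P x\<^sub>0 \<rho> Z by unfold_locales
  show ?thesis
  proof (intro exI[of _ kelvin_measure] conjI allI impI)
    show "AE \<omega> in kelvin_measure. \<forall>t\<ge>0. \<omega> t \<in> inversion ` absorbed_exterior D"
      by (rule AE_kelvin_measure) (use AE_path_inversion ext in eventually_elim, auto)
    fix U :: "real ^ 'd \<Rightarrow> real" and \<tau> :: "(real \<Rightarrow> real ^ 'd) \<Rightarrow> real" and c
    assume a: "U \<in> borel_measurable borel \<and> bounded (U ` absorbed_exterior D) \<and>
       stopping_time coord_filtration \<tau> \<and> (\<forall>\<omega>\<in>paths. 0 \<le> \<tau> \<omega> \<and> \<tau> \<omega> \<le> c)"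
    then obtain C where "\<And>x. x \<in> absorbed_exterior D \<Longrightarrow> \<bar>U x\<bar> \<le> C" by (auto simp: bounded_iff)
    then have "AE \<omega> in P. \<forall>t\<ge>0. \<bar>U (\<omega> t)\<bar> \<le> C" using ext by (auto elim!: eventually_mono)
    then show "let \<tau>' = (\<lambda>\<omega>. \<tau> (path_inversion \<omega>));
            f = (\<lambda>x. norm x powi (2 - int CARD('d)) * U (inversion x))
        in integrable kelvin_measure (\<lambda>\<omega>. f (\<omega> (\<tau>' \<omega>))) \<and>
           norm x\<^sub>0 ^ (CARD('d) - 2) * (\<integral>\<omega>. U (\<omega> (\<tau> \<omega>)) \<partial>P) =
             (\<integral>\<omega>. f (\<omega> (\<tau>' \<omega>)) \<partial>kelvin_measure)"
      unfolding Let_def using kelvin_formula[of U C \<tau> c] a by auto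
  qed (fact prob_space_kelvin_measure sets_kelvin_measure true_conformal_kelvin_measure)+
qed

end
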